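(* Let $n\geq 2$ be an integer and let $O_n$ be the Cuntz algebra, with gauge action $\tau$, fixed point algebra $O_n^{\tau}$ and diagonal subalgebra $D_n$. Let $B$ be a C*-subalgebra with $O_n^{\tau}\subset B\subset O_n$ which is a Cartan intermediate subalgebra, i.e. $D_n$ is a Cartan subalgebra of $B$. Then $B=O_n^m$ for some $m\in\mathbb{N}=\{0,1,2,\dots\}$. Moreover, there exists a conditional expectation from $O_n$ onto $B$.
   Context: The Cuntz algebra $O_n$ is the universal unital C*-algebra generated by isometries $S_1,\dots,S_n$ with $S_i^*S_j=\delta_{i,j}1$ and $\sum_{i=1}^nS_iS_i^*=1$. For a finite sequence (word) $\mu=(\mu_1,\dots,\mu_l)$ on $\{1,\dots,n\}$, put $S_{\mu}:=S_{\mu_1}\cdots S_{\mu_l}$ ($S_\mu=1$ for the empty word) and $|\mu|:=l$. $D_n$ is the C*-subalgebra of $O_n$ generated by all $S_{\mu}S_{\mu}^*$. The gauge action $\tau\colon\mathbb{T}\curvearrowright O_n$ is determined by $\tau_z(S_i)=zS_i$ for $z\in\mathbb{T}$, $i=1,\dots,n$, and $O_n^{\tau}:=\{x\in O_n\mid\tau_z(x)=x\text{ for all }z\in\mathbb{T}\}$. For $m\in\mathbb{N}$, $O_n^m$ is the C*-subalgebra of $O_n$ generated by $\{S_{\mu}S_{\nu}^*\mid |\mu|-|\nu|\in m\mathbb{Z}\}$. A commutative C*-subalgebra $D$ of a C*-algebra $B$ is a Cartan subalgebra if: (1) $D$ contains an approximate unit for $B$; (2) the normalizers, i.e. the $b\in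 B$ with $bDb^*\cup b^*Db\subset D$, generate $B$; (3) there is a faithful conditional expectation $B\to D$; (4) $D=\{b\in B\mid db=bd\ \forall d\in D\}$. *)

theory Defs
  imports "HOL-Analysis.Analysis" "HOL-Algebra.Ring"
begin

section \<open>C*-algebras\<close>

text \<open>Nonzero unital C*-algebras. The real scalar multiplication and the norm are inherited;
  the complex one extends the real one.\<close>

class cstar_algebra_1 = real_normed_algebra_1 + banach +
  fixes scaleC :: "complex \<Rightarrow> 'a \<Rightarrow> 'a"
    and star :: "'a \<Rightarrow> 'a"
  assumes scaleC_of_real: "scaleC (complex_of_real r) x = scaleR r x"
    and scaleC_add_right: "scaleC c (x + y) = scaleC c x + scaleC c y"
    and scaleC_add_left: "scaleC (c + d) x = scaleC c x + scaleC d x"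
    and scaleC_scaleC: "scaleC c (scaleC d x) = scaleC (c * d) x"
    and scaleC_mult_left: "scaleC c x * y = scaleC c (x * y)"
    and scaleC_mult_right: "x * scaleC c y = scaleC c (x * y)"
    and norm_scaleC: "norm (scaleC c x) = cmod c * norm x"
    and star_star: "star (star x) = x"
    and star_add: "star (x + y) = star x + star y"
    and star_scaleC: "star (scaleC c x) = scaleC (cnj c) (star x)"
    and star_mult: "star (x * y) = star y * star x"
    and cstar_identity: "norm (star x * x) = (norm x)\<^sup>2"

definition cstar_subalgebra :: "'a::cstar_algebra_1 set \<Rightarrow> bool" where
  "cstar_subalgebra A \<longleftrightarrow>
     closed A \<and> 0 \<in> A \<and>
     (\<forall>x\<in>A. \<forall>y\<in>A. x + y \<in> A \<and> x * y \<in> A) \<and>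
     (\<forall>c. \<forall>x\<in>A. scaleC c x \<in> A) \<and>
     (\<forall>x\<in>A. star x \<in> A)"

definition cstar_generated :: "'a::cstar_algebra_1 set \<Rightarrow> 'a set" where
  "cstar_generated X = cstar_subalgebra hull X"

definition positive_in :: "'a::cstar_algebra_1 set \<Rightarrow> 'a \<Rightarrow> bool" where
  "positive_in A x \<longleftrightarrow> (\<exists>y\<in>A. x = star y * y)"

definition unital_star_hom :: "('a::cstar_algebra_1 \<Rightarrow> 'b::cstar_algebra_1) \<Rightarrow> bool" where
  "unital_star_hom \<phi> \<longleftrightarrow>
     (\<forall>x y. \<phi> (x + y) = \<phi> x + \<phi> y) \<and>
     (\<forall>c x. \<phi> (scaleC c x) = scaleC c (\<phi> x)) \<and>
     (\<forall>x y. \<phi> (x * y) = \<phi> x * \<phi> y) \<and>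
     (\<forall>x. \<phi> (star x) = star (\<phi> x)) \<and>
     \<phi> 1 = 1"

text \<open>Complete positivity need not be demanded separately: it follows from positivity and the
  bimodule property, since the sum of the elements
  \<open>star (b i) * E (star (a i) * a j) * b j\<close> is \<open>E (star z * z)\<close> for \<open>z = (\<Sum>i. a i * b i)\<close>.
  Only the values of \<open>E\<close> on \<open>B\<close> matter.\<close>

definition conditional_expectation ::
    "'a::cstar_algebra_1 set \<Rightarrow> 'a set \<Rightarrow> ('a \<Rightarrow> 'a) \<Rightarrow> bool" where
  "conditional_expectation B D E \<longleftrightarrow>
     (\<forall>x\<in>B. E x \<in> D) \<and>
     (\<forall>d\<in>D. E d = d) \<and>
     (\<forall>x\<in>B. \<forall>y\<in>B. E (x + y) = E x + E y) \<and>
     (\<forall>c. \<forall>x\<in>B. E (scaleC c x) = scaleC c (E x)) \<and>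
     (\<forall>x\<in>B. norm (E x) \<le> norm x) \<and>
     (\<forall>x. positive_in B x \<longrightarrow> positive_in D (E x)) \<and>
     (\<forall>x\<in>B. \<forall>d\<in>D. E (d * x) = d * E x \<and> E (x * d) = E x * d)"

definition faithful_on :: "'a::cstar_algebra_1 set \<Rightarrow> ('a \<Rightarrow> 'a) \<Rightarrow> bool" where
  "faithful_on B E \<longleftrightarrow> (\<forall>x. positive_in B x \<longrightarrow> E x = 0 \<longrightarrow> x = 0)"

text \<open>A net is represented by the filter its tails generate.\<close>

definition contains_approximate_unit_for ::
    "'a::cstar_algebra_1 set \<Rightarrow> 'a set \<Rightarrow> bool" where
  "contains_approximate_unit_for D B \<longleftrightarrow>
     (\<exists>F. F \<noteq> bot \<and>
       (\<forall>\<^sub>F e in F. e \<in> D \<and> positive_in D e \<and> norm e \<le> 1) \<and>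
       (\<forall>b\<in>B. ((\<lambda>e. e * b) \<longlongrightarrow> b) F \<and> ((\<lambda>e. b * e) \<longlongrightarrow> b) F))"

definition normalizers :: "'a::cstar_algebra_1 set \<Rightarrow> 'a set \<Rightarrow> 'a set" where
  "normalizers D B = {b \<in> B. (\<forall>d\<in>D. b * d * star b \<in> D \<and> star b * d * b \<in> D)}"

definition cartan_subalgebra :: "'a::cstar_algebra_1 set \<Rightarrow> 'a set \<Rightarrow> bool" where
  "cartan_subalgebra D B \<longleftrightarrow>
     cstar_subalgebra B \<and> cstar_subalgebra D \<and> D \<subseteq> B \<and>
     (\<forall>x\<in>D. \<forall>y\<in>D. x * y = y * x) \<and>
     contains_approximate_unit_for D B \<and>
     cstar_generated (normalizers D B) = B \<and>
     (\<exists>E. conditional_expectation B D E \<and> faithful_on B E) \<and>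
     D = {b \<in> B. \<forall>d\<in>D. d * b = b * d}"


section \<open>The targets of the universal property\<close>

text \<open>A universal property quantifies over all unital C*-algebras, which in HOL cannot be a
  quantification over types. Hence the targets are C*-algebra structures on arbitrary subsets
  of a type. This is no restriction when that type has the cardinality of the continuum: a
  C*-algebra generated by finitely many elements has at most that cardinality, so it is
  isomorphic to one carried by a subset of that type.\<close>

record 'b cstar_struct = "'b ring" +
  cscale :: "complex \<Rightarrow> 'b \<Rightarrow> 'b"
  cadj :: "'b \<Rightarrow> 'b"
  cnorm :: "'b \<Rightarrow> real"

locale unital_cstar_struct = ring A for A :: "'b cstar_struct" (structure) +
  assumes cscale_closed: "x \<in> carrier A \<Longrightarrow> cscale A c x \<in> carrier A"
    and cscale_one: "x \<in> carrier A \<Longrightarrow> cscale A 1 x = x"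
    and cscale_add_right:
      "x \<in> carrier A \<Longrightarrow> y \<in> carrier A \<Longrightarrow> cscale A c (x \<oplus> y) = cscale A c x \<oplus> cscale A c y"
    and cscale_add_left:
      "x \<in> carrier A \<Longrightarrow> cscale A (c + d) x = cscale A c x \<oplus> cscale A d x"
    and cscale_cscale: "x \<in> carrier A \<Longrightarrow> cscale A c (cscale A d x) = cscale A (c * d) x"
    and cscale_mult_left:
      "x \<in> carrier A \<Longrightarrow> y \<in> carrier A \<Longrightarrow> cscale A c x \<otimes> y = cscale A c (x \<otimes> y)"
    and cscale_mult_right:
      "x \<in> carrier A \<Longrightarrow> y \<in> carrier A \<Longrightarrow> x \<otimes> cscale A c y = cscale A c (x \<otimes> y)"
    and cadj_closed: "x \<in> carrier A \<Longrightarrow> cadj A x \<in> carrier A"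
    and cadj_cadj: "x \<in> carrier A \<Longrightarrow> cadj A (cadj A x) = x"
    and cadj_add:
      "x \<in> carrier A \<Longrightarrow> y \<in> carrier A \<Longrightarrow> cadj A (x \<oplus> y) = cadj A x \<oplus> cadj A y"
    and cadj_cscale: "x \<in> carrier A \<Longrightarrow> cadj A (cscale A c x) = cscale A (cnj c) (cadj A x)"
    and cadj_mult:
      "x \<in> carrier A \<Longrightarrow> y \<in> carrier A \<Longrightarrow> cadj A (x \<otimes> y) = cadj A y \<otimes> cadj A x"
    and cnorm_eq_0: "x \<in> carrier A \<Longrightarrow> cnorm A x = 0 \<longleftrightarrow> x = \<zero>"
    and cnorm_triangle:
      "x \<in> carrier A \<Longrightarrow> y \<in> carrier A \<Longrightarrow> cnorm A (x \<oplus> y) \<le> cnorm A x + cnorm A y"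
    and cnorm_cscale: "x \<in> carrier A \<Longrightarrow> cnorm A (cscale A c x) = cmod c * cnorm A x"
    and cnorm_mult:
      "x \<in> carrier A \<Longrightarrow> y \<in> carrier A \<Longrightarrow> cnorm A (x \<otimes> y) \<le> cnorm A x * cnorm A y"
    and cnorm_cstar: "x \<in> carrier A \<Longrightarrow> cnorm A (cadj A x \<otimes> x) = (cnorm A x)\<^sup>2"
    and cnorm_complete:
      "\<lbrakk>\<forall>k::nat. X k \<in> carrier A;
        \<forall>e>0. \<exists>N. \<forall>j\<ge>N. \<forall>k\<ge>N. cnorm A (X j \<ominus> X k) < e\<rbrakk>
       \<Longrightarrow> \<exists>x\<in>carrier A. (\<lambda>k. cnorm A (X k \<ominus> x)) \<longlonglongrightarrow> 0"

definition unital_star_hom_into ::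
    "'b cstar_struct \<Rightarrow> ('a::cstar_algebra_1 \<Rightarrow> 'b) \<Rightarrow> bool" where
  "unital_star_hom_into A \<phi> \<longleftrightarrow>
     (\<forall>x. \<phi> x \<in> carrier A) \<and>
     (\<forall>x y. \<phi> (x + y) = \<phi> x \<oplus>\<^bsub>A\<^esub> \<phi> y) \<and>
     (\<forall>c x. \<phi> (scaleC c x) = cscale A c (\<phi> x)) \<and>
     (\<forall>x y. \<phi> (x * y) = \<phi> x \<otimes>\<^bsub>A\<^esub> \<phi> y) \<and>
     (\<forall>x. \<phi> (star x) = cadj A (\<phi> x)) \<and>
     \<phi> 1 = \<one>\<^bsub>A\<^esub>"


section \<open>The Cuntz algebra\<close>

definition cuntz_relations :: "nat \<Rightarrow> (nat \<Rightarrow> 'a::cstar_algebra_1) \<Rightarrow> bool" where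
  "cuntz_relations n S \<longleftrightarrow>
     (\<forall>i\<in>{1..n}. \<forall>j\<in>{1..n}. star (S i) * S j = (if i = j then 1 else 0)) \<and>
     (\<Sum>i=1..n. S i * star (S i)) = 1"

definition cuntz_relations_in :: "'b cstar_struct \<Rightarrow> nat \<Rightarrow> (nat \<Rightarrow> 'b) \<Rightarrow> bool" where
  "cuntz_relations_in A n T \<longleftrightarrow>
     (\<forall>i\<in>{1..n}. T i \<in> carrier A) \<and>
     (\<forall>i\<in>{1..n}. \<forall>j\<in>{1..n}. cadj A (T i) \<otimes>\<^bsub>A\<^esub> T j = (if i = j then \<one>\<^bsub>A\<^esub> else \<zero>\<^bsub>A\<^esub>)) \<and>
     (\<Oplus>\<^bsub>A\<^esub>i\<in>{1..n}. T i \<otimes>\<^bsub>A\<^esub> cadj A (T i)) = \<one>\<^bsub>A\<^esub>"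

text \<open>The whole type \<open>'a\<close> is the Cuntz algebra with canonical generators \<open>S 1, \<dots>, S n\<close>. The
  homomorphism in the universal property is unique because the \<open>S i\<close> generate.\<close>

definition cuntz_algebra :: "nat \<Rightarrow> (nat \<Rightarrow> 'a::cstar_algebra_1) \<Rightarrow> bool" where
  "cuntz_algebra n S \<longleftrightarrow>
     cuntz_relations n S \<and>
     cstar_generated (S ` {1..n}) = UNIV \<and>
     (\<forall>(A :: real cstar_struct) T.
        unital_cstar_struct A \<and> cuntz_relations_in A n T \<longrightarrow>
        (\<exists>\<phi> :: 'a \<Rightarrow> real. unital_star_hom_into A \<phi> \<and> (\<forall>i\<in>{1..n}. \<phi> (S i) = T i)))"

definition cuntz_words :: "nat \<Rightarrow> nat list set" where
  "cuntz_words n = lists {1..n}"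

definition word_prod :: "(nat \<Rightarrow> 'a::cstar_algebra_1) \<Rightarrow> nat list \<Rightarrow> 'a" where
  "word_prod S \<mu> = prod_list (map S \<mu>)"

definition cuntz_diagonal :: "nat \<Rightarrow> (nat \<Rightarrow> 'a::cstar_algebra_1) \<Rightarrow> 'a set" where
  "cuntz_diagonal n S =
     cstar_generated {word_prod S \<mu> * star (word_prod S \<mu>) | \<mu>. \<mu> \<in> cuntz_words n}"

text \<open>For \<open>m = 0\<close> the divisibility condition says that both words have the same length.\<close>

definition cuntz_sub :: "nat \<Rightarrow> (nat \<Rightarrow> 'a::cstar_algebra_1) \<Rightarrow> nat \<Rightarrow> 'a set" where
  "cuntz_sub n S m =
     cstar_generated {word_prod S \<mu> * star (word_prod S \<nu>) | \<mu> \<nu>.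
       \<mu> \<in> cuntz_words n \<and> \<nu> \<in> cuntz_words n \<and> int m dvd int (length \<mu>) - int (length \<nu>)}"

text \<open>A point-norm continuous action of the circle group by unital *-automorphisms (each
  \<open>\<tau> z\<close> is invertible by the action laws) with the prescribed values on the generators. These
  values determine \<open>\<tau> z\<close> for \<open>z\<close> on the circle; nothing is said about other \<open>z\<close>.\<close>

definition gauge_action ::
    "nat \<Rightarrow> (nat \<Rightarrow> 'a::cstar_algebra_1) \<Rightarrow> (complex \<Rightarrow> 'a \<Rightarrow> 'a) \<Rightarrow> bool" where
  "gauge_action n S \<tau> \<longleftrightarrow>
     (\<forall>z\<in>sphere 0 1. unital_star_hom (\<tau> z)) \<and>
     (\<forall>x. \<tau> 1 x = x) \<and>
     (\<forall>z\<in>sphere 0 1. \<forall>w\<in>sphere 0 1. \<forall>x. \<tau> (z * w) x = \<tau> z (\<tau> w x)) \<and>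
     (\<forall>x. continuous_on (sphere 0 1) (\<lambda>z. \<tau> z x)) \<and>
     (\<forall>z\<in>sphere 0 1. \<forall>i\<in>{1..n}. \<tau> z (S i) = scaleC z (S i))"

definition gauge_fixed :: "(complex \<Rightarrow> 'a \<Rightarrow> 'a) \<Rightarrow> 'a set" where
  "gauge_fixed \<tau> = {x. \<forall>z\<in>sphere 0 1. \<tau> z x = x}"

end

theory Submission
  imports Defs
begin

text \<open>The Fourier components of a normalizer \<open>v\<close> of \<open>D\<close> for the gauge action are
  limits of elements \<open>v u d\<close> with \<open>d \<in> D\<close> and \<open>u\<close> in the relative commutant of \<open>D\<close>. A nonzero element of
  nonzero degree does not commute with \<open>D\<close>, because aperiodic words are dense, so that \<open>u\<close> is gauge
  invariant and the components of \<open>v\<close> lie in \<open>B\<close>. Every spectral subspace is irreducible as a bimodule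
  over the fixed point algebra, which is simple; hence it either lies in \<open>B\<close> or meets \<open>B\<close> only in \<open>0\<close>.
  The degrees for which it lies in \<open>B\<close> form a subgroup \<open>m\<int>\<close> of \<open>\<int>\<close>. The expectation onto \<open>B\<close> is the average
  of the gauge action over the \<open>m\<close>-th roots of unity, or over the circle when \<open>m = 0\<close>.\<close>

section \<open>Square roots and homomorphisms\<close>

text \<open>Two demands shape the proof. Positivity in \<open>conditional_expectation\<close> asks
  for an actual factor \<open>y\<close> with \<open>x = star y * y\<close> inside the smaller
  algebra, and norm bounds must come from the C*-identity and the Cuntz relations. Square roots are
  therefore limits of a polynomial iteration, sharp norms come from the growth of powers, and
  integrals over the circle are limits of averages over roots of unity. Simplicity of the fixed
  point algebra enters through one computation: a nonzero \<open>star x * x\<close> of degree 0 is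
  approximated by a matrix, the faithful expectation onto \<open>D\<close> exhibits a large diagonal
  entry, and compression by the corresponding word gives a nearly scalar, hence invertible, element.
  A Fourier component \<open>x\<close> of a normalizer \<open>v\<close> obeys the same exchange
  relations with \<open>D\<close> as \<open>v\<close>, since \<open>D\<close> is gauge invariant; so
  \<open>star v * x\<close> commutes with \<open>D\<close> after multiplication by
  \<open>star v * v\<close>, and this factor is divided out approximately.\<close>

lemma scaleC_zero_left [simp]: "scaleC 0 x = 0"
  using scaleC_of_real[of 0 x] by simp

lemma scaleC_one [simp]: "scaleC 1 x = x"
  using scaleC_of_real[of 1 x] by simp

lemma scaleC_zero_right [simp]: "scaleC c 0 = 0"
  using scaleC_add_right[of c 0 0] by simp

lemma scaleC_minus_left: "scaleC (- c) x = - scaleC c x"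
  using scaleC_add_left[of "- c" c x] by (simp add: eq_neg_iff_add_eq_0)

lemma scaleC_minus_right: "scaleC c (- x) = - scaleC c x"
  using scaleC_add_right[of c "- x" x] by (simp add: eq_neg_iff_add_eq_0)

lemma scaleC_diff_right: "scaleC c (x - y) = scaleC c x - scaleC c y"
  using scaleC_add_right[of c x "- y"] by (simp add: scaleC_minus_right)

lemma scaleC_diff_left: "scaleC (c - d) x = scaleC c x - scaleC d x"
  using scaleC_add_left[of c "- d" x] by (simp add: scaleC_minus_left)

lemma scaleC_sum_right: "scaleC c (sum f A) = (\<Sum>i\<in>A. scaleC c (f i))"
  by (induction A rule: infinite_finite_induct) (simp_all add: scaleC_add_right)

lemma scaleC_sum_left: "scaleC (sum f A) x = (\<Sum>i\<in>A. scaleC (f i) x)"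
  by (induction A rule: infinite_finite_induct) (simp_all add: scaleC_add_left)

lemma scaleC_eq_0_iff [simp]: "scaleC c x = 0 \<longleftrightarrow> c = 0 \<or> x = 0"
  by (metis norm_scaleC norm_eq_zero mult_eq_0_iff)

lemma star_0 [simp]: "star 0 = 0"
  using star_add[of 0 0] by simp

lemma star_minus: "star (- x) = - star x"
  using star_add[of "- x" x] by (simp add: eq_neg_iff_add_eq_0)

lemma star_diff: "star (x - y) = star x - star y"
  using star_add[of x "- y"] by (simp add: star_minus)

lemma star_sum: "star (sum f A) = (\<Sum>i\<in>A. star (f i))"
  by (induction A rule: infinite_finite_induct) (simp_all add: star_add)

lemma star_1 [simp]: "star 1 = 1"
  using star_mult[of "star 1" 1] by (simp add: star_star)

lemma star_power: "star (x ^ k) = star x ^ k"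
  by (induction k) (simp_all add: star_mult power_commutes)

lemma star_scaleR: "star (scaleR r x) = scaleR r (star x)"
  using star_scaleC[of "complex_of_real r" x] by (simp add: scaleC_of_real)

text \<open>The C*-identity gives \<open>(norm y)\<^sup>2 \<le> norm (star y) * norm y\<close>;
  cancelling, and applying this to \<open>star y\<close> too, gives both inequalities.\<close>

lemma norm_star [simp]: "norm (star x) = norm (x :: 'a::cstar_algebra_1)"
proof -
  have le: "norm y \<le> norm (star y)" for y :: 'a
  proof (cases "y = 0")
    case False
    have "(norm y)\<^sup>2 \<le> norm (star y) * norm y"
      using cstar_identity[of y] norm_mult_ineq[of "star y" y] by simp
    then have "norm y * norm y \<le> norm (star y) * norm y" by (simp add: power2_eq_square)
    then show ?thesis using False by (simp del: mult_le_cancel_right add: mult_right_le_imp_le)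
  qed simp
  show ?thesis using le[of x] le[of "star x"] by (simp add: star_star)
qed

lemma norm_mult_star: "norm (x * star x) = (norm x)\<^sup>2"
  using cstar_identity[of "star x"] by (simp add: star_star)

lemma bounded_linear_star: "bounded_linear (star :: 'a::cstar_algebra_1 \<Rightarrow> 'a)"
  by (rule bounded_linear_intro[of _ 1]) (simp_all add: star_add star_scaleR)

lemma bounded_linear_scaleC: "bounded_linear (scaleC c :: 'a::cstar_algebra_1 \<Rightarrow> 'a)"
  by (rule bounded_linear_intro[of _ "cmod c"])
     (simp_all add: scaleC_add_right norm_scaleC scaleC_of_real[symmetric] scaleC_scaleC mult.commute)

lemmas tendsto_scaleC [tendsto_intros] = bounded_linear.tendsto[OF bounded_linear_scaleC]
lemmas continuous_on_star [continuous_intros] = bounded_linear.continuous_on[OF bounded_linear_star]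

lemma scaleC_1_mult: "scaleC c 1 * x = scaleC c (x :: 'a::cstar_algebra_1)"
  by (simp add: scaleC_mult_left)

lemma mult_scaleC_1: "x * scaleC c 1 = scaleC c (x :: 'a::cstar_algebra_1)"
  by (simp add: scaleC_mult_right)

text \<open>The majorant of the iteration \<open>y \<mapsto> (g + y\<^sup>2) / 2\<close> with fixed point \<open>1 - sqrt (1 - g)\<close>
  is the same iteration at \<open>g = 1\<close>, which increases to \<open>1\<close>.\<close>

fun sqrt_majorant :: "nat \<Rightarrow> real" where
  "sqrt_majorant 0 = 0"
| "sqrt_majorant (Suc k) = (1 + (sqrt_majorant k)\<^sup>2) / 2"

fun sqrt_iteration :: "'a::real_normed_algebra_1 \<Rightarrow> nat \<Rightarrow> 'a" where
  "sqrt_iteration g 0 = 0"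
| "sqrt_iteration g (Suc k) = scaleR (1/2) (g + sqrt_iteration g k * sqrt_iteration g k)"

lemma sqrt_majorant_bounds: "0 \<le> sqrt_majorant k \<and> sqrt_majorant k \<le> 1"
proof (induction k)
  case (Suc k)
  then have "(sqrt_majorant k)\<^sup>2 \<le> 1" by (simp add: power_le_one)
  then show ?case by simp
qed simp

lemma sqrt_majorant_mono: "sqrt_majorant k \<le> sqrt_majorant (Suc k)"
proof -
  have "0 \<le> (1 - sqrt_majorant k)\<^sup>2" by simp
  then show ?thesis by (simp add: power2_eq_square algebra_simps)
qed

lemma norm_sqrt_iteration:
  assumes "norm g \<le> 1"
  shows "norm (sqrt_iteration g k) \<le> sqrt_majorant k"
proof (induction k)
  case (Suc k)
  let ?y = "sqrt_iteration g k"
  have "norm (?y * ?y) \<le> sqrt_majorant k * sqrt_majorant k"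
    by (meson Suc.IH mult_mono norm_ge_zero norm_mult_ineq order_trans sqrt_majorant_bounds)
  then have "norm (g + ?y * ?y) \<le> 1 + (sqrt_majorant k)\<^sup>2"
    using assms by (smt (verit) norm_triangle_ineq power2_eq_square)
  then show ?case by simp
qed simp

lemma norm_sqrt_iteration_diff:
  assumes "norm g \<le> 1"
  shows "norm (sqrt_iteration g (Suc k) - sqrt_iteration g k) \<le> sqrt_majorant (Suc k) - sqrt_majorant k"
proof (induction k)
  case 0
  show ?case using assms by simp
next
  case (Suc k)
  let ?y = "sqrt_iteration g k" and ?z = "sqrt_iteration g (Suc k)"
  let ?r = "sqrt_majorant k" and ?s = "sqrt_majorant (Suc k)"
  have "sqrt_iteration g (Suc (Suc k)) - ?z = scaleR (1/2) (?z * ?z - ?y * ?y)"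
    by (simp only: sqrt_iteration.simps(2)[of g "Suc k"] sqrt_iteration.simps(2)[of g k, symmetric])
       (subst (3) sqrt_iteration.simps(2), simp only: scaleR_right_diff_distrib[symmetric], simp del: sqrt_iteration.simps)
  also have "?z * ?z - ?y * ?y = ?z * (?z - ?y) + (?z - ?y) * ?y"
    by (simp add: algebra_simps del: sqrt_iteration.simps)
  finally have eq: "sqrt_iteration g (Suc (Suc k)) - ?z = scaleR (1/2) (?z * (?z - ?y) + (?z - ?y) * ?y)" .
  have b: "norm ?z \<le> ?s" "norm ?y \<le> ?r" "norm (?z - ?y) \<le> ?s - ?r"
    using norm_sqrt_iteration[OF assms] Suc.IH by blast+
  have "norm (?z * (?z - ?y)) \<le> ?s * (?s - ?r)"
    by (rule order_trans[OF norm_mult_ineq mult_mono]) (use b sqrt_majorant_bounds in auto)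
  moreover have "norm ((?z - ?y) * ?y) \<le> (?s - ?r) * ?r"
    by (rule order_trans[OF norm_mult_ineq mult_mono]) (use b sqrt_majorant_mono in auto)
  ultimately have "norm (?z * (?z - ?y) + (?z - ?y) * ?y) \<le> ?s * (?s - ?r) + (?s - ?r) * ?r"
    by (meson add_mono norm_triangle_ineq order_trans)
  also have "\<dots> = 2 * (sqrt_majorant (Suc (Suc k)) - ?s)"
    by (simp add: power2_eq_square algebra_simps)
  finally show ?case unfolding eq norm_scaleR by (simp del: sqrt_iteration.simps sqrt_majorant.simps)
qed

text \<open>The increments are dominated by those of a bounded increasing real sequence, which is
  Cauchy even when \<open>norm g = 1\<close>, where the iteration is no strict contraction.
  \<open>X\<close> is any closed set preserved by the iteration: this keeps the root self-adjoint,
  commuting with a given element, or inside a subalgebra.\<close>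

lemma one_minus_square_root:
  fixes g :: "'a::{real_normed_algebra_1,banach}"
  assumes g: "norm g \<le> 1"
    and X: "closed X" "0 \<in> X" "\<And>y. y \<in> X \<Longrightarrow> scaleR (1/2) (g + y * y) \<in> X"
  obtains y where "y \<in> X" "(1 - y) * (1 - y) = 1 - g"
proof -
  let ?y = "sqrt_iteration g" and ?r = sqrt_majorant
  have inc: "incseq ?r" using sqrt_majorant_mono by (rule incseq_SucI)
  have diff: "norm (?y (k + d) - ?y k) \<le> ?r (k + d) - ?r k" for k d
  proof (induction d)
    case (Suc d)
    have "norm (?y (k + Suc d) - ?y k) \<le> norm (?y (Suc (k + d)) - ?y (k + d)) + norm (?y (k + d) - ?y k)"
      using dist_triangle[of "?y (Suc (k + d))" "?y k" "?y (k + d)"] by (simp add: dist_norm del: sqrt_iteration.simps)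
    also have "\<dots> \<le> ?r (k + Suc d) - ?r k"
      using norm_sqrt_iteration_diff[OF g, of "k + d"] Suc.IH by (simp del: sqrt_iteration.simps sqrt_majorant.simps)
    finally show ?case .
  qed simp
  have "convergent ?r"
    using inc sqrt_majorant_bounds by (meson incseq_convergent convergent_def)
  then have cau: "Cauchy ?r" by (rule convergent_Cauchy)
  have "Cauchy ?y"
  proof (rule metric_CauchyI)
    fix e :: real assume "e > 0"
    then obtain M where M: "\<And>m n. m \<ge> M \<Longrightarrow> n \<ge> M \<Longrightarrow> dist (?r m) (?r n) < e"
      using metric_CauchyD[OF cau] by blast
    have aux: "dist (?y m) (?y n) < e" if "m \<le> n" "m \<ge> M" for m n
      using diff[of m "n - m"] M[of m n] that by (auto simp: dist_norm norm_minus_commute)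
    show "\<exists>M. \<forall>m\<ge>M. \<forall>n\<ge>M. dist (?y m) (?y n) < e"
      by (metis aux dist_commute linorder_linear)
  qed
  then obtain l where l: "?y \<longlonglongrightarrow> l"
    using Cauchy_convergent convergent_def by blast
  have "?y k \<in> X" for k by (induction k) (use X in auto)
  then have lX: "l \<in> X" using closed_sequentially[OF X(1) _ l] by blast
  have "(\<lambda>k. ?y (Suc k)) \<longlonglongrightarrow> scaleR (1/2) (g + l * l)"
    unfolding sqrt_iteration.simps by (intro tendsto_intros l)
  then have "l = scaleR (1/2) (g + l * l)"
    using LIMSEQ_Suc[OF l] LIMSEQ_unique by blast
  then have "l + l = g + l * l"
    by (metis (no_types) scaleR_2 scaleR_half_double scaleR_left_imp_eq scaleR_right_distrib real_vector.scale_right_distrib)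
  then have "(1 - l) * (1 - l) = 1 - g" by (simp add: algebra_simps)
  with lX show ?thesis using that by blast
qed

text \<open>Squaring is exact on self-adjoint elements,
  \<open>norm (h ^ 2 ^ k) = norm h ^ 2 ^ k\<close>, so a factor \<open>C\<close> independent of the
  exponent is harmless. Later \<open>C\<close> is a number of words, and a crude bound summed over
  words becomes a sharp one.\<close>

lemma power_bounded_self_adjoint:
  fixes h :: "'a::cstar_algebra_1"
  assumes h: "star h = h" and bd: "\<And>m. norm (h ^ m) \<le> C * R ^ m" and R: "R \<ge> 0"
  shows "norm h \<le> R"
proof (rule ccontr)
  assume "\<not> norm h \<le> R"
  then have less: "R < norm h" by simp
  have pw: "norm (h ^ (2 ^ k)) = norm h ^ (2 ^ k)" for k
  proof (induction k)
    case (Suc k)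
    have "norm (h ^ (2 ^ Suc k)) = norm (star (h ^ 2 ^ k) * h ^ 2 ^ k)"
      by (simp add: star_power h power_add[symmetric] mult_2)
    also have "\<dots> = norm h ^ (2 ^ Suc k)"
      by (simp add: cstar_identity Suc.IH power_mult[symmetric] mult.commute)
    finally show ?case .
  qed simp
  show False
  proof (cases "R = 0")
    case True
    then show False using bd[of 1] less by simp
  next
    case False
    with R less have "R > 0" by simp
    then have one: "norm h / R > 1" using less by simp
    then obtain k where k: "C < (norm h / R) ^ k" using real_arch_pow by blast
    have "(norm h / R) ^ k \<le> (norm h / R) ^ (2 ^ k)"
      using one by (intro power_increasing) (auto intro: less_imp_le)
    also have "\<dots> \<le> C"
      using bd[of "2 ^ k"] \<open>R > 0\<close> by (simp add: pw power_divide divide_simps)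
    finally show False using k by simp
  qed
qed

lemma norm_unitary:
  fixes u :: "'a::cstar_algebra_1"
  assumes "star u * u = 1"
  shows "norm u = 1"
  using cstar_identity[of u] assms by (simp add: power2_eq_1_iff) (smt (verit) norm_ge_zero)

text \<open>A self-adjoint contraction \<open>h\<close> is the real part of the unitary \<open>h + i sqrt (1 - h\<^sup>2)\<close>, which
  every homomorphism maps to a unitary.\<close>

lemma unital_star_hom_norm_le:
  fixes \<phi> :: "'a::cstar_algebra_1 \<Rightarrow> 'b::cstar_algebra_1"
  assumes hom: "unital_star_hom \<phi>"
  shows "norm (\<phi> x) \<le> norm x"
proof -
  have add: "\<phi> (a + b) = \<phi> a + \<phi> b" and sc: "\<phi> (scaleC c a) = scaleC c (\<phi> a)"
    and mult: "\<phi> (a * b) = \<phi> a * \<phi> b" and st: "\<phi> (star a) = star (\<phi> a)" and one: "\<phi> 1 = 1" for a b c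
    using hom unfolding unital_star_hom_def by blast+
  have main: "norm (\<phi> h) \<le> 1" if sa: "star h = h" and le: "norm h \<le> 1" for h
  proof -
    have "norm (h * h) \<le> 1" using le norm_mult_ineq[of h h] mult_le_one[of "norm h" "norm h"] by simp
    \<comment> \<open>The root \<open>1 - z\<close> of \<open>1 - h * h\<close> is taken among the
      self-adjoint elements commuting with \<open>h\<close>; the commutation cancels the cross terms
      of \<open>star u * u\<close> below.\<close>
    then obtain z where z: "z \<in> {y. star y = y \<and> y * h = h * y}" "(1 - z) * (1 - z) = 1 - h * h"
    proof (rule one_minus_square_root)
      show "closed {y. star y = y \<and> y * h = h * y}"
        by (intro closed_Collect_conj closed_Collect_eq continuous_intros continuous_on_star)
      fix y assume "y \<in> {y. star y = y \<and> y * h = h * y}"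
      then show "scaleR (1/2) (h * h + y * y) \<in> {y. star y = y \<and> y * h = h * y}"
        by (auto simp: star_scaleR star_add star_mult sa algebra_simps)
           (metis mult.assoc)
    qed auto
    define y where "y = 1 - z"
    have y: "star y = y" "y * h = h * y" "y * y = 1 - h * h"
      using z by (auto simp: y_def star_diff algebra_simps)
    define u where "u = h + scaleC \<i> y"
    have su: "star u = h - scaleC \<i> y"
      by (simp add: u_def star_add star_scaleC sa y scaleC_minus_left)
    have "star u * u = h * h + y * y + (scaleC \<i> (h * y) - scaleC \<i> (y * h))"
      unfolding su
      by (simp add: u_def algebra_simps scaleC_mult_left scaleC_mult_right scaleC_scaleC scaleC_minus_left scaleC_diff_right)
    then have "star u * u = 1" by (simp add: y)
    then have "star (\<phi> u) * \<phi> u = 1" by (metis mult st one)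
    then have nu: "norm (\<phi> u) = 1" by (rule norm_unitary)
    have "u + star u = scaleC 2 h"
      unfolding su by (simp add: u_def scaleC_add_left[of 1 1, simplified])
    then have "scaleC 2 (\<phi> h) = \<phi> u + star (\<phi> u)" by (metis add sc st)
    then have "2 * norm (\<phi> h) = norm (\<phi> u + star (\<phi> u))" by (metis norm_scaleC norm_numeral)
    also have "\<dots> \<le> 2" using norm_triangle_ineq[of "\<phi> u" "star (\<phi> u)"] nu by simp
    finally show ?thesis by simp
  qed
  show ?thesis
  proof (cases "x = 0")
    case True
    then show ?thesis using sc[of 0 0] by simp
  next
    case False
    \<comment> \<open>The C*-identity reduces an arbitrary \<open>x\<close> to the self-adjoint
      contraction \<open>star x * x\<close> divided by \<open>(norm x)\<^sup>2\<close>.\<close>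
    define h where "h = scaleC (of_real (1 / (norm x)\<^sup>2)) (star x * x)"
    have "norm (\<phi> h) \<le> 1"
      by (rule main) (use False in \<open>simp_all add: h_def star_scaleC star_mult star_star norm_scaleC cstar_identity norm_divide norm_power\<close>)
    moreover have "norm (\<phi> h) = (norm (\<phi> x))\<^sup>2 / (norm x)\<^sup>2"
      by (simp add: h_def sc mult st norm_scaleC cstar_identity norm_divide norm_power)
    ultimately have "(norm (\<phi> x))\<^sup>2 \<le> (norm x)\<^sup>2"
      using False by (metis divide_le_eq_1_pos zero_less_norm_iff zero_less_power)
    then show ?thesis by (rule power2_le_imp_le) simp
  qed
qed

text \<open>Neumann series in \<open>1 - t\<close>, whose partial sums stay in \<open>X\<close>;
  hence the inverse stays in the subalgebra under consideration.\<close>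

lemma left_inverse_near_one:
  fixes t :: "'a::{real_normed_algebra_1,banach}"
  assumes t: "norm (1 - t) < 1"
    and X: "closed X" "1 \<in> X" "\<And>x y. x \<in> X \<Longrightarrow> y \<in> X \<Longrightarrow> x + y \<in> X" "\<And>x. x \<in> X \<Longrightarrow> x * (1 - t) \<in> X"
  obtains s where "s \<in> X" "s * t = 1"
proof -
  define a where "a = 1 - t"
  have sm: "summable (\<lambda>k. a ^ k)" using t by (simp add: a_def complete_algebra_summable_geometric)
  have pX: "a ^ k \<in> X" for k
    by (induction k) (use X in \<open>simp_all add: a_def power_commutes\<close>, metis power_commutes)
  have "(\<Sum>k<Suc m. a ^ k) \<in> X" for m
  proof (induction m)
    case (Suc m)
    show ?case using X(3)[OF Suc.IH pX[of "Suc m"]] by (simp only: sum.lessThan_Suc)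
  qed (simp add: X(2))
  then have "(\<Sum>k. a ^ k) \<in> X"
    by (intro closed_sequentially[OF X(1) _ LIMSEQ_Suc[OF summable_LIMSEQ[OF sm]]])
  moreover have "(\<Sum>k. a ^ k) * t = 1"
  proof -
    have "(\<Sum>k. a ^ k) = (\<Sum>k. a ^ Suc k) + 1" using suminf_split_head[OF sm] by simp
    also have "(\<Sum>k. a ^ Suc k) = (\<Sum>k. a ^ k) * a"
      by (simp only: power_Suc2 suminf_mult2[OF sm])
    finally show ?thesis by (simp add: a_def algebra_simps)
  qed
  ultimately show ?thesis using that by blast
qed

section \<open>Words in Cuntz isometries\<close>

lemma word_prod_Nil [simp]: "word_prod S [] = 1"
  and word_prod_Cons: "word_prod S (i # \<mu>) = S i * word_prod S \<mu>"
  and word_prod_append: "word_prod S (\<mu> @ \<nu>) = word_prod S \<mu> * word_prod S \<nu>"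
  by (simp_all add: word_prod_def)

locale cuntz_family =
  fixes n :: nat and S :: "nat \<Rightarrow> 'a::cstar_algebra_1"
  assumes relations: "cuntz_relations n S"
begin

definition words_of_length :: "nat \<Rightarrow> nat list set" where
  "words_of_length k = {\<mu>. set \<mu> \<subseteq> {1..n} \<and> length \<mu> = k}"

abbreviation s :: "nat list \<Rightarrow> 'a" where
  "s \<equiv> word_prod S"

lemma finite_words [simp]: "finite (words_of_length k)"
  unfolding words_of_length_def by (rule finite_lists_length_eq) simp

lemma words_0 [simp]: "words_of_length 0 = {[]}"
  by (auto simp: words_of_length_def)

lemma in_words_lengthI: "\<mu> \<in> cuntz_words n \<Longrightarrow> \<mu> \<in> words_of_length (length \<mu>)"
  by (auto simp: cuntz_words_def words_of_length_def)

lemma words_lengthD: "\<mu> \<in> words_of_length k \<Longrightarrow> \<mu> \<in> cuntz_words n \<and> length \<mu> = k"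
  by (auto simp: cuntz_words_def words_of_length_def)

lemma append_words: "\<mu> \<in> words_of_length j \<Longrightarrow> \<nu> \<in> words_of_length k \<Longrightarrow> \<mu> @ \<nu> \<in> words_of_length (j + k)"
  by (auto simp: words_of_length_def)

lemma split_words:
  assumes "\<mu> \<in> words_of_length (j + k)"
  obtains \<mu>1 \<mu>2 where "\<mu> = \<mu>1 @ \<mu>2" "\<mu>1 \<in> words_of_length j" "\<mu>2 \<in> words_of_length k"
proof
  show "\<mu> = take j \<mu> @ drop j \<mu>" by simp
  show "take j \<mu> \<in> words_of_length j" "drop j \<mu> \<in> words_of_length k"
    using assms set_take_subset[of j \<mu>] set_drop_subset[of j \<mu>] by (auto simp: words_of_length_def)
qed

lemma generator_orthogonal: "i \<in> {1..n} \<Longrightarrow> j \<in> {1..n} \<Longrightarrow> star (S i) * S j = (if i = j then 1 else 0)"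
  using relations by (auto simp: cuntz_relations_def)

lemma sum_generators: "(\<Sum>i=1..n. S i * star (S i)) = 1"
  using relations by (auto simp: cuntz_relations_def)

lemma words_orthogonal:
  "\<mu> \<in> words_of_length k \<Longrightarrow> \<nu> \<in> words_of_length k \<Longrightarrow> star (s \<mu>) * s \<nu> = (if \<mu> = \<nu> then 1 else 0)"
proof (induction k arbitrary: \<mu> \<nu>)
  case (Suc k)
  from Suc.prems obtain i \<alpha> j \<beta> where eq: "\<mu> = i # \<alpha>" "\<nu> = j # \<beta>"
    and mem: "i \<in> {1..n}" "j \<in> {1..n}" "\<alpha> \<in> words_of_length k" "\<beta> \<in> words_of_length k"
    by (auto simp: words_of_length_def length_Suc_conv)
  have "star (s \<mu>) * s \<nu> = star (s \<alpha>) * (star (S i) * S j) * s \<beta>"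
    by (simp add: eq word_prod_Cons star_mult mult.assoc)
  then show ?case using Suc.IH[OF mem(3,4)] mem by (auto simp: generator_orthogonal eq)
qed simp

lemma word_isometry: "\<mu> \<in> cuntz_words n \<Longrightarrow> star (s \<mu>) * s \<mu> = 1"
  using words_orthogonal[of \<mu> "length \<mu>" \<mu>] in_words_lengthI by simp

lemma norm_word [simp]: "\<mu> \<in> cuntz_words n \<Longrightarrow> norm (s \<mu>) = 1"
  by (rule norm_unitary) (rule word_isometry)

lemma sum_words_Suc:
  "(\<Sum>\<mu>\<in>words_of_length (Suc k). f \<mu>) = (\<Sum>\<mu>\<in>words_of_length k. \<Sum>i=1..n. f (i # \<mu>))"
proof -
  have eq: "words_of_length (Suc k) = (\<lambda>(\<mu>, i). i # \<mu>) ` (words_of_length k \<times> {1..n})"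
  proof (intro equalityI subsetI)
    fix \<mu> assume "\<mu> \<in> words_of_length (Suc k)"
    then obtain i \<alpha> where "\<mu> = i # \<alpha>" "i \<in> {1..n}" "\<alpha> \<in> words_of_length k"
      by (auto simp: words_of_length_def length_Suc_conv)
    then show "\<mu> \<in> (\<lambda>(\<mu>, i). i # \<mu>) ` (words_of_length k \<times> {1..n})"
      by (intro image_eqI[of _ _ "(\<alpha>, i)"]) auto
  qed (auto simp: words_of_length_def)
  have inj: "inj_on (\<lambda>(\<mu>, i). i # \<mu>) (words_of_length k \<times> {1..n})" by (auto simp: inj_on_def)
  show ?thesis unfolding eq sum.reindex[OF inj] sum.cartesian_product by (rule sum.cong) auto
qed

lemma sum_words_projections: "(\<Sum>\<mu>\<in>words_of_length k. s \<mu> * star (s \<mu>)) = 1"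
proof (induction k)
  case (Suc k)
  have "(\<Sum>\<mu>\<in>words_of_length (Suc k). s \<mu> * star (s \<mu>))
      = (\<Sum>i=1..n. S i * (\<Sum>\<mu>\<in>words_of_length k. s \<mu> * star (s \<mu>)) * star (S i))"
    unfolding sum_words_Suc
    by (subst sum.swap) (simp add: word_prod_Cons star_mult sum_distrib_left sum_distrib_right mult.assoc)
  then show ?case by (simp only: Suc.IH mult_1_right sum_generators)
qed simp

text \<open>Equal first letters cancel and a mismatch gives 0. If one word is a prefix of the other,
  the rest of the longer one remains.\<close>

lemma star_word_mult_word:
  assumes "\<mu> \<in> cuntz_words n" "\<nu> \<in> cuntz_words n"
  shows "star (s \<mu>) * s \<nu> = 0 \<or> (\<exists>\<delta>\<in>cuntz_words n. star (s \<mu>) * s \<nu> = s \<delta>)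
       \<or> (\<exists>\<delta>\<in>cuntz_words n. star (s \<mu>) * s \<nu> = star (s \<delta>))"
  using assms
proof (induction \<mu> arbitrary: \<nu>)
  case Nil
  then show ?case by auto
next
  case (Cons i \<mu>)
  show ?case
  proof (cases \<nu>)
    case Nil
    then show ?thesis using Cons.prems by auto
  next
    case (Cons j \<nu>')
    have "star (s (i # \<mu>)) * s \<nu> = star (s \<mu>) * (star (S i) * S j) * s \<nu>'"
      by (simp add: Cons word_prod_Cons star_mult mult.assoc)
    moreover have "i \<in> {1..n}" "j \<in> {1..n}" "\<mu> \<in> cuntz_words n" "\<nu>' \<in> cuntz_words n"
      using Cons.prems Cons by (auto simp: cuntz_words_def)
    ultimately show ?thesis using Cons.IH[of \<nu>'] by (cases "i = j") (simp_all add: generator_orthogonal)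
  qed
qed

lemma star_word_mult_longer_word:
  assumes "\<mu> \<in> cuntz_words n" "\<nu> \<in> cuntz_words n" "length \<mu> \<le> length \<nu>"
  shows "star (s \<mu>) * s \<nu> = 0 \<or> (\<exists>\<delta>\<in>cuntz_words n. star (s \<mu>) * s \<nu> = s \<delta>)"
proof -
  obtain \<nu>1 \<nu>2 where \<nu>: "\<nu> = \<nu>1 @ \<nu>2" "\<nu>1 \<in> words_of_length (length \<mu>)" "\<nu>2 \<in> words_of_length (length \<nu> - length \<mu>)"
    using split_words[of \<nu> "length \<mu>" "length \<nu> - length \<mu>"] in_words_lengthI[OF assms(2)] assms(3) by auto
  have "star (s \<mu>) * s \<nu> = star (s \<mu>) * s \<nu>1 * s \<nu>2" by (simp add: \<nu>(1) word_prod_append mult.assoc)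
  then show ?thesis
    using words_orthogonal[OF in_words_lengthI[OF assms(1)] \<nu>(2)] words_lengthD[OF \<nu>(3)] by auto
qed

text \<open>\<open>matrix_units a b\<close> is the span of the \<open>s \<mu> * star (s \<nu>)\<close> with \<open>\<bar>\<mu>\<bar> = a\<close> and \<open>\<bar>\<nu>\<bar> = b\<close>.\<close>

definition matrix_units :: "nat \<Rightarrow> nat \<Rightarrow> 'a set" where
  "matrix_units a b = {x. \<forall>\<mu>\<in>words_of_length a. \<forall>\<nu>\<in>words_of_length b. \<exists>c. star (s \<mu>) * x * s \<nu> = scaleC c 1}"

lemma expand_left: "x = (\<Sum>\<mu>\<in>words_of_length a. s \<mu> * (star (s \<mu>) * x))"
  using arg_cong[OF sum_words_projections[of a], of "\<lambda>y. y * x"]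
  by (simp add: sum_distrib_right mult.assoc)

lemma expand_right: "x = (\<Sum>\<nu>\<in>words_of_length b. x * s \<nu> * star (s \<nu>))"
  using arg_cong[OF sum_words_projections[of b], of "\<lambda>y. x * y"]
  by (simp add: sum_distrib_left mult.assoc)

lemma matrix_units_zero [simp]: "0 \<in> matrix_units a b"
  unfolding matrix_units_def by (auto intro!: exI[of _ 0])

lemma matrix_units_add:
  assumes "x \<in> matrix_units a b" "y \<in> matrix_units a b"
  shows "x + y \<in> matrix_units a b"
  unfolding matrix_units_def
proof (intro CollectI ballI)
  fix \<mu> \<nu> assume "\<mu> \<in> words_of_length a" "\<nu> \<in> words_of_length b"
  then obtain c d where "star (s \<mu>) * x * s \<nu> = scaleC c 1" "star (s \<mu>) * y * s \<nu> = scaleC d 1"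
    using assms unfolding matrix_units_def by blast
  then show "\<exists>c. star (s \<mu>) * (x + y) * s \<nu> = scaleC c 1"
    by (auto intro!: exI[of _ "c + d"] simp: algebra_simps scaleC_add_left)
qed

lemma matrix_units_scaleC:
  assumes "x \<in> matrix_units a b"
  shows "scaleC c x \<in> matrix_units a b"
  unfolding matrix_units_def
proof (intro CollectI ballI)
  fix \<mu> \<nu> assume "\<mu> \<in> words_of_length a" "\<nu> \<in> words_of_length b"
  then obtain d where "star (s \<mu>) * x * s \<nu> = scaleC d 1"
    using assms unfolding matrix_units_def by blast
  then show "\<exists>d. star (s \<mu>) * scaleC c x * s \<nu> = scaleC d 1"
    by (auto intro!: exI[of _ "c * d"] simp: scaleC_mult_left scaleC_mult_right scaleC_scaleC[symmetric])
qed

lemma matrix_units_sum: "(\<And>i. i \<in> I \<Longrightarrow> f i \<in> matrix_units a b) \<Longrightarrow> sum f I \<in> matrix_units a b"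
  by (induction I rule: infinite_finite_induct) (auto intro: matrix_units_add)

lemma matrix_units_diff: "x \<in> matrix_units a b \<Longrightarrow> y \<in> matrix_units a b \<Longrightarrow> x - y \<in> matrix_units a b"
  using matrix_units_add[OF _ matrix_units_scaleC[of y a b "-1"], of x] by (simp add: scaleC_minus_left)

lemma matrix_units_star:
  assumes "x \<in> matrix_units a b"
  shows "star x \<in> matrix_units b a"
  unfolding matrix_units_def
proof (intro CollectI ballI)
  fix \<mu> \<nu> assume "\<mu> \<in> words_of_length b" "\<nu> \<in> words_of_length a"
  then obtain d where "star (s \<nu>) * x * s \<mu> = scaleC d 1"
    using assms unfolding matrix_units_def by blast
  then have "star (star (s \<nu>) * x * s \<mu>) = scaleC (cnj d) 1" by (simp add: star_scaleC)
  then show "\<exists>d. star (s \<mu>) * star x * s \<nu> = scaleC d 1"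
    by (auto simp: star_mult star_star mult.assoc)
qed

lemma matrix_units_mult:
  assumes "x \<in> matrix_units a b" "y \<in> matrix_units b c"
  shows "x * y \<in> matrix_units a c"
  unfolding matrix_units_def
proof (intro CollectI ballI)
  fix \<mu> \<nu> assume m: "\<mu> \<in> words_of_length a" "\<nu> \<in> words_of_length c"
  have "\<forall>\<beta>\<in>words_of_length b. \<exists>c. star (s \<mu>) * x * s \<beta> = scaleC c 1"
    using assms(1) m unfolding matrix_units_def by blast
  then obtain f where f: "\<And>\<beta>. \<beta> \<in> words_of_length b \<Longrightarrow> star (s \<mu>) * x * s \<beta> = scaleC (f \<beta>) 1" by metis
  have "\<forall>\<beta>\<in>words_of_length b. \<exists>c. star (s \<beta>) * y * s \<nu> = scaleC c 1"
    using assms(2) m unfolding matrix_units_def by blast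
  then obtain g where g: "\<And>\<beta>. \<beta> \<in> words_of_length b \<Longrightarrow> star (s \<beta>) * y * s \<nu> = scaleC (g \<beta>) 1" by metis
  \<comment> \<open>The identity between \<open>x\<close> and \<open>y\<close> is resolved into the
    range projections of the words of length \<open>b\<close>: matrix multiplication with inner
    index \<open>\<beta>\<close>.\<close>
  have "star (s \<mu>) * (x * y) * s \<nu> = (star (s \<mu>) * x) * (\<Sum>\<beta>\<in>words_of_length b. s \<beta> * star (s \<beta>)) * (y * s \<nu>)"
    by (simp add: sum_words_projections mult.assoc)
  also have "\<dots> = (\<Sum>\<beta>\<in>words_of_length b. (star (s \<mu>) * x * s \<beta>) * (star (s \<beta>) * y * s \<nu>))"
    by (simp add: sum_distrib_left sum_distrib_right mult.assoc)
  also have "\<dots> = scaleC (\<Sum>\<beta>\<in>words_of_length b. f \<beta> * g \<beta>) 1"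
    by (simp add: f g scaleC_sum_left scaleC_1_mult scaleC_scaleC)
  finally show "\<exists>d. star (s \<mu>) * (x * y) * s \<nu> = scaleC d 1" by blast
qed

lemma monomial_in_matrix_units:
  assumes "\<mu> \<in> words_of_length a" "\<nu> \<in> words_of_length b"
  shows "s \<mu> * star (s \<nu>) \<in> matrix_units a b"
  unfolding matrix_units_def
proof (intro CollectI ballI)
  fix \<alpha> \<beta> assume m: "\<alpha> \<in> words_of_length a" "\<beta> \<in> words_of_length b"
  have "star (s \<alpha>) * (s \<mu> * star (s \<nu>)) * s \<beta> = (star (s \<alpha>) * s \<mu>) * (star (s \<nu>) * s \<beta>)"
    by (simp add: mult.assoc)
  also have "\<dots> = scaleC (if \<alpha> = \<mu> \<and> \<nu> = \<beta> then 1 else 0) 1"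
    using assms m by (simp add: words_orthogonal)
  finally show "\<exists>c. star (s \<alpha>) * (s \<mu> * star (s \<nu>)) * s \<beta> = scaleC c 1" by blast
qed

lemma scalar_in_matrix_units: "scaleC c 1 \<in> matrix_units a a"
  unfolding matrix_units_def
  by (auto simp: mult_scaleC_1 scaleC_mult_left words_orthogonal intro: exI[of _ 0])

text \<open>The entry at \<open>\<mu>1 @ \<mu>2\<close>, \<open>\<nu>1 @ \<nu>2\<close> is the entry
  at \<open>\<mu>1\<close>, \<open>\<nu>1\<close> if the tails agree and 0 otherwise: matrices are
  tensored with the identity. This brings elements of different levels to a common one.\<close>

lemma matrix_units_raise:
  assumes "x \<in> matrix_units a b"
  shows "x \<in> matrix_units (a + k) (b + k)"
  unfolding matrix_units_def
proof (intro CollectI ballI)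
  fix \<mu> \<nu> assume "\<mu> \<in> words_of_length (a + k)" "\<nu> \<in> words_of_length (b + k)"
  then obtain \<mu>1 \<mu>2 \<nu>1 \<nu>2 where eq: "\<mu> = \<mu>1 @ \<mu>2" "\<nu> = \<nu>1 @ \<nu>2"
    and m: "\<mu>1 \<in> words_of_length a" "\<nu>1 \<in> words_of_length b"
      "\<mu>2 \<in> words_of_length k" "\<nu>2 \<in> words_of_length k"
    by (metis split_words)
  obtain c where c: "star (s \<mu>1) * x * s \<nu>1 = scaleC c 1" using m assms unfolding matrix_units_def by blast
  have "star (s \<mu>) * x * s \<nu> = star (s \<mu>2) * (star (s \<mu>1) * x * s \<nu>1) * s \<nu>2"
    by (simp add: eq word_prod_append star_mult mult.assoc)
  also have "\<dots> = scaleC (if \<mu>2 = \<nu>2 then c else 0) 1"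
    using m by (simp add: c mult_scaleC_1 scaleC_mult_left words_orthogonal)
  finally show "\<exists>c. star (s \<mu>) * x * s \<nu> = scaleC c 1" by blast
qed

lemma matrix_units_expand:
  assumes "x \<in> matrix_units a b"
  obtains f where "x = (\<Sum>\<mu>\<in>words_of_length a. \<Sum>\<nu>\<in>words_of_length b. scaleC (f \<mu> \<nu>) (s \<mu> * star (s \<nu>)))"
    "\<And>\<mu> \<nu>. \<mu> \<in> words_of_length a \<Longrightarrow> \<nu> \<in> words_of_length b \<Longrightarrow> star (s \<mu>) * x * s \<nu> = scaleC (f \<mu> \<nu>) 1"
proof -
  have "\<forall>\<mu>\<in>words_of_length a. \<forall>\<nu>\<in>words_of_length b. \<exists>c. star (s \<mu>) * x * s \<nu> = scaleC c 1"
    using assms unfolding matrix_units_def by blast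
  then obtain f where f: "\<And>\<mu> \<nu>. \<mu> \<in> words_of_length a \<Longrightarrow> \<nu> \<in> words_of_length b \<Longrightarrow> star (s \<mu>) * x * s \<nu> = scaleC (f \<mu> \<nu>) 1"
    by metis
  have "x = (\<Sum>\<mu>\<in>words_of_length a. s \<mu> * star (s \<mu>)) * x * (\<Sum>\<nu>\<in>words_of_length b. s \<nu> * star (s \<nu>))"
    by (simp add: sum_words_projections)
  also have "\<dots> = (\<Sum>\<mu>\<in>words_of_length a. \<Sum>\<nu>\<in>words_of_length b. s \<mu> * (star (s \<mu>) * x * s \<nu>) * star (s \<nu>))"
    unfolding sum_distrib_left sum_distrib_right by (subst sum.swap) (simp add: mult.assoc)
  also have "\<dots> = (\<Sum>\<mu>\<in>words_of_length a. \<Sum>\<nu>\<in>words_of_length b. scaleC (f \<mu> \<nu>) (s \<mu> * star (s \<nu>)))"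
    by (intro sum.cong refl) (simp add: f mult_scaleC_1 scaleC_mult_left)
  finally show ?thesis using that f by blast
qed

end

section \<open>Density of the span of the monomials\<close>

locale generating_cuntz_family = cuntz_family +
  assumes generating: "cstar_generated (S ` {1..n}) = UNIV"
begin

definition monomials :: "'a set" where
  "monomials = {scaleC c (s \<mu> * star (s \<nu>)) | c \<mu> \<nu>. \<mu> \<in> cuntz_words n \<and> \<nu> \<in> cuntz_words n}"

lemma monomials_mult:
  assumes "x \<in> monomials" "y \<in> monomials"
  shows "x * y = 0 \<or> x * y \<in> monomials"
proof -
  obtain c d \<mu> \<nu> \<alpha> \<beta> where x: "x = scaleC c (s \<mu> * star (s \<nu>))" and y: "y = scaleC d (s \<alpha> * star (s \<beta>))"
    and w: "\<mu> \<in> cuntz_words n" "\<nu> \<in> cuntz_words n" "\<alpha> \<in> cuntz_words n" "\<beta> \<in> cuntz_words n"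
    using assms unfolding monomials_def by blast
  have xy: "x * y = scaleC (c * d) (s \<mu> * (star (s \<nu>) * s \<alpha>) * star (s \<beta>))"
    by (simp add: x y scaleC_mult_left scaleC_mult_right scaleC_scaleC mult.assoc mult.commute)
  consider "star (s \<nu>) * s \<alpha> = 0" | \<delta> where "\<delta> \<in> cuntz_words n" "star (s \<nu>) * s \<alpha> = s \<delta>"
    | \<delta> where "\<delta> \<in> cuntz_words n" "star (s \<nu>) * s \<alpha> = star (s \<delta>)"
    using star_word_mult_word[OF w(2,3)] by blast
  then show ?thesis
  proof cases
    case 2
    then have "x * y = scaleC (c * d) (s (\<mu> @ \<delta>) * star (s \<beta>))" by (simp add: xy word_prod_append)
    moreover have "\<mu> @ \<delta> \<in> cuntz_words n" using w 2 by (auto simp: cuntz_words_def)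
    ultimately show ?thesis using w unfolding monomials_def by blast
  next
    case 3
    then have "x * y = scaleC (c * d) (s \<mu> * star (s (\<beta> @ \<delta>)))"
      by (simp add: xy word_prod_append star_mult mult.assoc)
    moreover have "\<beta> @ \<delta> \<in> cuntz_words n" using w 3 by (auto simp: cuntz_words_def)
    ultimately show ?thesis using w unfolding monomials_def by blast
  qed (simp add: xy)
qed

text \<open>The smallest closed additive set \<open>H\<close> containing the monomials is a
  C*-subalgebra: a bounded linear map that sends monomials into \<open>H\<close> sends
  \<open>H\<close> into \<open>H\<close>, and this applies to scaling, to \<open>star\<close>, to
  multiplication by a monomial and then by any element of \<open>H\<close>. Since \<open>X\<close>
  itself need not be multiplicative, the lemma serves as an induction principle.\<close>

lemma dense_monomials:
  assumes X: "closed X" "0 \<in> X" "\<And>x y. x \<in> X \<Longrightarrow> y \<in> X \<Longrightarrow> x + y \<in> X" "monomials \<subseteq> X"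
  shows "x \<in> X"
proof -
  define P where "P Y \<longleftrightarrow> closed Y \<and> 0 \<in> Y \<and> (\<forall>x\<in>Y. \<forall>y\<in>Y. x + y \<in> Y) \<and> monomials \<subseteq> Y" for Y :: "'a set"
  define H where "H = \<Inter>{Y. P Y}"
  have PH: "P H"
    unfolding P_def
  proof (intro conjI)
    show "closed H" unfolding H_def by (rule closed_Inter) (simp add: P_def)
  qed (auto simp: H_def P_def)
  then have H: "closed H" "0 \<in> H" "\<And>x y. x \<in> H \<Longrightarrow> y \<in> H \<Longrightarrow> x + y \<in> H" "monomials \<subseteq> H"
    unfolding P_def by auto
  have min: "H \<subseteq> Y" if "P Y" for Y using that unfolding H_def by blast
  have lin: "f x \<in> H" if "bounded_linear f" "\<And>m. m \<in> monomials \<Longrightarrow> f m \<in> H" "x \<in> H" for f x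
  proof -
    interpret bounded_linear f by fact
    have "closed (f -` H)" by (rule closed_vimage[OF H(1) linear_continuous_on[OF that(1)]])
    then have "P {x. f x \<in> H}"
      unfolding P_def vimage_def using H(2,3) that(2) by (auto simp: add zero)
    then show ?thesis using min that(3) by blast
  qed
  have sc: "scaleC c x \<in> H" if "x \<in> H" for c x
  proof (rule lin[OF bounded_linear_scaleC _ that])
    fix m assume "m \<in> monomials"
    then have "scaleC c m \<in> monomials"
      unfolding monomials_def using scaleC_scaleC by fastforce
    then show "scaleC c m \<in> H" using H(4) by blast
  qed
  have st: "star x \<in> H" if "x \<in> H" for x
  proof (rule lin[OF bounded_linear_star _ that])
    fix m assume "m \<in> monomials"
    then have "star m \<in> monomials"
      unfolding monomials_def by (force simp: star_scaleC star_mult star_star)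
    then show "star m \<in> H" using H(4) by blast
  qed
  have mult1: "x * m \<in> H" if "x \<in> H" "m \<in> monomials" for x m
  proof (rule lin[OF bounded_linear_mult_left[of m] _ that(1)])
    fix m' assume "m' \<in> monomials"
    then show "m' * m \<in> H" using monomials_mult[OF _ that(2), of m'] H(2,4) by auto
  qed
  have mult: "x * y \<in> H" if "x \<in> H" "y \<in> H" for x y
    by (rule lin[OF bounded_linear_mult_right[of x] _ that(2)]) (rule mult1[OF that(1)])
  have "cstar_subalgebra H"
    unfolding cstar_subalgebra_def by (intro conjI ballI allI H(1-3) sc st mult)
  moreover have "S ` {1..n} \<subseteq> H"
  proof safe
    fix i assume "i \<in> {1..n}"
    then have "scaleC 1 (s [i] * star (s [])) \<in> monomials"
      unfolding monomials_def
      by - (rule CollectI, rule exI[of _ 1], rule exI[of _ "[i]"], rule exI[of _ "[]"], auto simp: cuntz_words_def)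
    then show "S i \<in> H" using H(4) by (auto simp: word_prod_Cons)
  qed
  ultimately have "UNIV \<subseteq> H"
    using hull_minimal[of "S ` {1..n}" H cstar_subalgebra] generating by (simp add: cstar_generated_def)
  moreover have "H \<subseteq> X" by (rule min) (use X in \<open>auto simp: P_def\<close>)
  ultimately show ?thesis by blast
qed

end

section \<open>The spectral subspaces of the gauge action\<close>

text \<open>An \<epsilon>/3 argument: nonexpansive maps transfer convergence from a set to its
  closure, so that it suffices to test convergence on homogeneous elements.\<close>

lemma closed_convergent_nonexpansive:
  fixes T :: "nat \<Rightarrow> 'a::real_normed_vector \<Rightarrow> 'b::banach"
  assumes T: "\<And>N x y. norm (T N x - T N y) \<le> norm (x - y)"
  shows "closed {x. convergent (\<lambda>N. T N x)}"
proof -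
  have "convergent (\<lambda>N. T N x)" if x: "x \<in> closure {x. convergent (\<lambda>N. T N x)}" for x
  proof (rule Cauchy_convergent, rule CauchyI)
    fix e :: real assume "e > 0"
    then obtain y where y: "convergent (\<lambda>N. T N y)" "dist y x < e / 3"
      using x unfolding closure_approachable by (metis mem_Collect_eq zero_less_divide_iff zero_less_numeral)
    then obtain M where M: "\<And>m n. m \<ge> M \<Longrightarrow> n \<ge> M \<Longrightarrow> norm (T m y - T n y) < e / 3"
      using CauchyD[OF convergent_Cauchy[OF y(1)], of "e / 3"] \<open>e > 0\<close> by auto
    have "norm (T m x - T n x) < e" if "m \<ge> M" "n \<ge> M" for m n
    proof -
      have "T m x - T n x = (T m x - T m y) + (T m y - T n y) + (T n y - T n x)" by simp
      then have "norm (T m x - T n x) \<le> norm (T m x - T m y) + norm (T m y - T n y) + norm (T n y - T n x)"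
        by (metis norm_triangle_ineq norm_triangle_mono order_refl)
      then show ?thesis
        using M[OF that] T[of m x y] T[of n y x] y(2) by (simp add: dist_norm norm_minus_commute)
    qed
    then show "\<exists>M. \<forall>m\<ge>M. \<forall>n\<ge>M. norm (T m x - T n x) < e" by blast
  qed
  then show ?thesis by (metis (mono_tags, lifting) closure_subset_eq mem_Collect_eq subsetI)
qed

lemma closed_tendsto_self_nonexpansive:
  fixes T :: "nat \<Rightarrow> 'a::real_normed_vector \<Rightarrow> 'a"
  assumes T: "\<And>N x y. norm (T N x - T N y) \<le> norm (x - y)"
  shows "closed {x. (\<lambda>N. T N x) \<longlonglongrightarrow> x}"
proof -
  have "(\<lambda>N. T N x) \<longlonglongrightarrow> x" if x: "x \<in> closure {x. (\<lambda>N. T N x) \<longlonglongrightarrow> x}" for x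
  proof (rule LIMSEQ_I)
    fix e :: real assume "e > 0"
    then obtain y where y: "(\<lambda>N. T N y) \<longlonglongrightarrow> y" "dist y x < e / 3"
      using x unfolding closure_approachable by (metis mem_Collect_eq zero_less_divide_iff zero_less_numeral)
    then obtain M where M: "\<And>m. m \<ge> M \<Longrightarrow> norm (T m y - y) < e / 3"
      using LIMSEQ_D[OF y(1), of "e / 3"] \<open>e > 0\<close> by auto
    have "norm (T m x - x) < e" if "m \<ge> M" for m
    proof -
      have "T m x - x = (T m x - T m y) + (T m y - y) + (y - x)" by simp
      then have "norm (T m x - x) \<le> norm (T m x - T m y) + norm (T m y - y) + norm (y - x)"
        by (metis norm_triangle_ineq norm_triangle_mono order_refl)
      then show ?thesis
        using M[OF that] T[of m x y] y(2) by (simp add: dist_norm norm_minus_commute)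
    qed
    then show "\<exists>M. \<forall>m\<ge>M. norm (T m x - x) < e" by blast
  qed
  then show ?thesis by (metis (mono_tags, lifting) closure_subset_eq mem_Collect_eq subsetI)
qed

definition unity_root :: "nat \<Rightarrow> nat \<Rightarrow> complex" where
  "unity_root N l = cis (2 * pi * real l / real N)"

lemma norm_unity_root [simp]: "cmod (unity_root N l) = 1"
  by (simp add: unity_root_def)

lemma unity_root_nonzero [simp]: "unity_root N l \<noteq> 0"
  by (simp add: unity_root_def)

lemma sum_unity_roots:
  assumes N: "N > 0"
  shows "(\<Sum>l<N. unity_root N l powi i) = (if int N dvd i then of_nat N else 0)"
proof -
  define w where "w = cis (2 * pi * of_int i / real N)"
  have pw: "unity_root N l powi i = w ^ l" for l
    by (simp add: unity_root_def w_def cis_power_int Complex.DeMoivre mult_ac)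
  show ?thesis
  proof (cases "int N dvd i")
    case True
    then obtain q where "i = int N * q" by blast
    then have "2 * pi * of_int i / real N = 2 * pi * of_int q" using N by simp
    then have "w = 1" unfolding w_def by (simp only: cis_multiple_2pi Ints_of_int)
    then show ?thesis using True by (simp add: pw)
  next
    case False
    have "w \<noteq> 1"
    proof
      assume "w = 1"
      then have "cos (2 * pi * of_int i / real N) = 1" by (metis w_def cis.simps(1) one_complex.simps(1))
      then obtain q :: int where "2 * pi * of_int i / real N = of_int q * 2 * pi"
        using cos_one_2pi_int by blast
      then have "2 * pi * of_int i = 2 * pi * (real N * of_int q)" using N by (simp add: field_simps)
      then have "of_int i = real N * of_int q" by (subst (asm) mult_left_cancel) simp_all
      then have "i = int N * q" by (metis of_int_eq_iff of_int_mult of_int_of_nat_eq)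
      then show False using False by simp
    qed
    moreover have "real N * (2 * pi * of_int i / real N) = 2 * pi * of_int i" using N by simp
    then have "w ^ N = 1" by (simp only: w_def Complex.DeMoivre cis_multiple_2pi Ints_of_int)
    ultimately show ?thesis using False by (simp add: pw geometric_sum)
  qed
qed

lemma cnj_powi_unimodular:
  assumes "cmod z = 1"
  shows "cnj (z powi k) = z powi (- k)"
proof -
  have "cmod (z powi k) = 1" by (simp add: norm_power_int assms)
  then have "z powi k * cnj (z powi k) = 1" by (metis complex_norm_square of_real_1 power_one)
  then show ?thesis by (metis inverse_unique power_int_minus)
qed

locale gauged_cuntz_family = generating_cuntz_family +
  fixes \<tau> :: "complex \<Rightarrow> 'a \<Rightarrow> 'a"
  assumes gauge: "gauge_action n S \<tau>"
begin

lemma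
  assumes "cmod z = 1"
  shows \<tau>_hom: "unital_star_hom (\<tau> z)"
    and \<tau>_add: "\<tau> z (x + y) = \<tau> z x + \<tau> z y"
    and \<tau>_scaleC: "\<tau> z (scaleC c x) = scaleC c (\<tau> z x)"
    and \<tau>_mult: "\<tau> z (x * y) = \<tau> z x * \<tau> z y"
    and \<tau>_star: "\<tau> z (star x) = star (\<tau> z x)"
    and \<tau>_one: "\<tau> z 1 = 1"
    and \<tau>_generator: "i \<in> {1..n} \<Longrightarrow> \<tau> z (S i) = scaleC z (S i)"
    and norm_\<tau>: "norm (\<tau> z x) \<le> norm x"
proof -
  have z: "z \<in> sphere 0 1" using assms by simp
  show hom: "unital_star_hom (\<tau> z)" using gauge z unfolding gauge_action_def by blast
  then show "\<tau> z (x + y) = \<tau> z x + \<tau> z y" "\<tau> z (scaleC c x) = scaleC c (\<tau> z x)"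
    "\<tau> z (x * y) = \<tau> z x * \<tau> z y" "\<tau> z (star x) = star (\<tau> z x)" "\<tau> z 1 = 1"
    unfolding unital_star_hom_def by blast+
  show "i \<in> {1..n} \<Longrightarrow> \<tau> z (S i) = scaleC z (S i)" using gauge z unfolding gauge_action_def by blast
  show "norm (\<tau> z x) \<le> norm x" by (rule unital_star_hom_norm_le[OF hom])
qed

lemma bounded_linear_\<tau>: "cmod z = 1 \<Longrightarrow> bounded_linear (\<tau> z)"
  by (rule bounded_linear_intro[of _ 1]) (simp_all add: \<tau>_add norm_\<tau> scaleC_of_real[symmetric] \<tau>_scaleC)

definition degree :: "int \<Rightarrow> 'a set" where
  "degree k = {x. \<forall>z. cmod z = 1 \<longrightarrow> \<tau> z x = scaleC (z powi k) x}"

lemma degreeD: "x \<in> degree k \<Longrightarrow> cmod z = 1 \<Longrightarrow> \<tau> z x = scaleC (z powi k) x"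
  by (simp add: degree_def)

lemma degree_0_eq: "degree 0 = gauge_fixed \<tau>"
  by (auto simp: degree_def gauge_fixed_def)

lemma degree_zero [simp]: "0 \<in> degree k"
  by (simp add: degree_def linear_0[OF bounded_linear.linear[OF bounded_linear_\<tau>]])

lemma degree_add: "x \<in> degree k \<Longrightarrow> y \<in> degree k \<Longrightarrow> x + y \<in> degree k"
  by (simp add: degree_def \<tau>_add scaleC_add_right)

lemma degree_scaleC: "x \<in> degree k \<Longrightarrow> scaleC c x \<in> degree k"
  by (simp add: degree_def \<tau>_scaleC scaleC_scaleC mult.commute)

lemma degree_sum: "(\<And>i. i \<in> I \<Longrightarrow> f i \<in> degree k) \<Longrightarrow> sum f I \<in> degree k"
  by (induction I rule: infinite_finite_induct) (auto intro: degree_add)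

lemma degree_diff: "x \<in> degree k \<Longrightarrow> y \<in> degree k \<Longrightarrow> x - y \<in> degree k"
  using degree_add[OF _ degree_scaleC[of y k "-1"], of x] by (simp add: scaleC_minus_left)

lemma degree_mult:
  assumes "x \<in> degree j" "y \<in> degree k"
  shows "x * y \<in> degree (j + k)"
proof -
  have "\<tau> z (x * y) = scaleC (z powi (j + k)) (x * y)" if z: "cmod z = 1" for z
  proof -
    have nz: "z \<noteq> 0" using z by auto
    have "\<tau> z (x * y) = scaleC (z powi j) x * scaleC (z powi k) y"
      by (simp only: \<tau>_mult[OF z] degreeD[OF assms(1) z] degreeD[OF assms(2) z])
    also have "\<dots> = scaleC (z powi k * z powi j) (x * y)"
      by (simp only: scaleC_mult_left scaleC_mult_right scaleC_scaleC)
    also have "z powi k * z powi j = z powi (j + k)" using nz by (simp add: power_int_add mult.commute)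
    finally show ?thesis .
  qed
  then show ?thesis by (simp add: degree_def)
qed

lemma degree_star: "x \<in> degree k \<Longrightarrow> star x \<in> degree (- k)"
  using cnj_powi_unimodular by (simp add: degree_def \<tau>_star star_scaleC)

lemma degree_one: "1 \<in> degree 0"
  by (simp add: degree_def \<tau>_one)

lemma closed_degree: "closed (degree k)"
proof -
  have "closed {x. \<tau> z x = scaleC (z powi k) x}" if "cmod z = 1" for z
    by (intro closed_Collect_eq linear_continuous_on bounded_linear_\<tau> bounded_linear_scaleC that)
  moreover have "degree k = (\<Inter>z\<in>{z. cmod z = 1}. {x. \<tau> z x = scaleC (z powi k) x})"
    by (auto simp: degree_def)
  ultimately show ?thesis by (simp add: closed_INT)
qed

lemma cstar_subalgebra_degree_0: "cstar_subalgebra (degree 0)"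
  unfolding cstar_subalgebra_def
  using closed_degree degree_add degree_scaleC degree_mult[of _ 0 _ 0] degree_star[of _ 0] by simp

lemma degree_generator: "i \<in> {1..n} \<Longrightarrow> S i \<in> degree 1"
  by (simp add: degree_def \<tau>_generator)

lemma degree_word: "\<mu> \<in> cuntz_words n \<Longrightarrow> s \<mu> \<in> degree (int (length \<mu>))"
proof (induction \<mu>)
  case (Cons i \<mu>)
  then have "S i * s \<mu> \<in> degree (1 + int (length \<mu>))"
    by (intro degree_mult degree_generator) (auto simp: cuntz_words_def)
  then show ?case by (simp add: word_prod_Cons)
qed (simp add: degree_one)

lemma degree_monomial:
  "\<mu> \<in> cuntz_words n \<Longrightarrow> \<nu> \<in> cuntz_words n \<Longrightarrow> s \<mu> * star (s \<nu>) \<in> degree (int (length \<mu>) - int (length \<nu>))"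
  using degree_mult[OF degree_word degree_star[OF degree_word]] by fastforce

lemma monomials_degree: "x \<in> monomials \<Longrightarrow> \<exists>k. x \<in> degree k"
  unfolding monomials_def using degree_scaleC degree_monomial by blast

lemma matrix_units_degree:
  assumes "x \<in> matrix_units a b"
  shows "x \<in> degree (int a - int b)"
proof -
  obtain f where f: "x = (\<Sum>\<mu>\<in>words_of_length a. \<Sum>\<nu>\<in>words_of_length b. scaleC (f \<mu> \<nu>) (s \<mu> * star (s \<nu>)))"
    by (rule matrix_units_expand[OF assms]) (rule that)
  show ?thesis
    unfolding f
  proof (intro degree_sum degree_scaleC)
    fix \<mu> \<nu> assume "\<mu> \<in> words_of_length a" "\<nu> \<in> words_of_length b"
    then show "s \<mu> * star (s \<nu>) \<in> degree (int a - int b)"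
      using degree_monomial[of \<mu> \<nu>] words_lengthD[of \<mu>] words_lengthD[of \<nu>] by simp
  qed
qed

lemma dense_degrees:
  assumes "closed X" "0 \<in> X" "\<And>x y. x \<in> X \<Longrightarrow> y \<in> X \<Longrightarrow> x + y \<in> X" "\<And>k. degree k \<subseteq> X"
  shows "x \<in> X"
proof (rule dense_monomials[OF assms(1-3)])
  show "monomials \<subseteq> X" using monomials_degree assms(4) by blast
qed auto

text \<open>The sum of the spectral subspaces is dense. This turns each identity for
  \<open>spectral\<close> below into a divisibility question about degrees.\<close>

lemma eq_by_degrees:
  assumes f: "bounded_linear f" and g: "bounded_linear g"
    and eq: "\<And>k x. x \<in> degree k \<Longrightarrow> f x = g x"
  shows "f x = g x"
proof -
  interpret f: bounded_linear f by fact
  interpret g: bounded_linear g by fact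
  have "x \<in> {x. f x = g x}"
    by (rule dense_degrees) (auto simp: eq f.zero g.zero f.add g.add intro!: closed_Collect_eq linear_continuous_on f g)
  then show ?thesis by simp
qed

text \<open>A discrete Fourier coefficient over the \<open>N\<close>-th roots of unity. For
  \<open>N > 0\<close> it retains the degrees congruent to \<open>k\<close> modulo \<open>N\<close>;
  for \<open>N = 0\<close> it is 0.\<close>

definition average :: "nat \<Rightarrow> int \<Rightarrow> 'a \<Rightarrow> 'a" where
  "average N k x = scaleR (1 / real N) (\<Sum>l<N. scaleC (unity_root N l powi (- k)) (\<tau> (unity_root N l) x))"

lemma average_add: "average N k (x + y) = average N k x + average N k y"
  by (simp add: average_def \<tau>_add scaleC_add_right sum.distrib scaleR_add_right)

lemma average_scaleC: "average N k (scaleC c x) = scaleC c (average N k x)"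
  by (simp add: average_def \<tau>_scaleC scaleC_sum_right scaleC_of_real[symmetric] scaleC_scaleC mult_ac)

lemma average_diff: "average N k (x - y) = average N k x - average N k y"
  using average_add[of N k x "scaleC (-1) y"] average_scaleC[of N k "-1" y] by (simp add: scaleC_minus_left)

lemma norm_average: "norm (average N k x) \<le> norm x"
proof (cases "N = 0")
  case False
  have "norm (\<Sum>l<N. scaleC (unity_root N l powi (- k)) (\<tau> (unity_root N l) x)) \<le> (\<Sum>l<N. norm x)"
    by (rule sum_norm_le) (simp add: norm_scaleC norm_power_int norm_\<tau>)
  then show ?thesis using False by (simp add: average_def divide_simps mult.commute)
qed (simp add: average_def)

lemma average_degree:
  assumes "x \<in> degree j" "N > 0"
  shows "average N k x = (if int N dvd j - k then x else 0)"
proof -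
  have "scaleC (unity_root N l powi (- k)) (\<tau> (unity_root N l) x) = scaleC (unity_root N l powi (j - k)) x" for l
    using degreeD[OF assms(1)] power_int_add[of "unity_root N l" "-k" j]
    by (simp add: scaleC_scaleC)
  then have "average N k x = scaleR (1 / real N) (scaleC (\<Sum>l<N. unity_root N l powi (j - k)) x)"
    by (simp add: average_def scaleC_sum_left)
  also have "\<dots> = (if int N dvd j - k then x else 0)"
    unfolding sum_unity_roots[OF assms(2)]
    using assms(2) scaleC_of_real[of "real N" x] by simp
  finally show ?thesis .
qed

lemma average_eventually:
  assumes "x \<in> degree j"
  shows "eventually (\<lambda>N. average (Suc N) k x = (if j = k then x else 0)) sequentially"
  using eventually_ge_at_top[of "nat \<bar>j - k\<bar>"]
proof eventually_elim
  case (elim N)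
  have "\<bar>j - k\<bar> \<le> int N" using elim by linarith
  then have "int (Suc N) dvd j - k \<longleftrightarrow> j = k"
    using zdvd_imp_le[of "int (Suc N)" "\<bar>j - k\<bar>"] by auto
  then show ?case using average_degree[OF assms, of "Suc N"] by simp
qed

text \<open>For \<open>m = 0\<close> this is the \<open>k\<close>-th Fourier coefficient over the
  whole circle, for \<open>m > 0\<close> over the \<open>m\<close>-th roots of unity. With
  congruence modulo 0 read as equality, both cases keep the degrees congruent to \<open>k\<close>
  modulo \<open>m\<close>, and \<open>m\<close> matches the index of
  \<open>cuntz_sub\<close>.\<close>

definition spectral :: "nat \<Rightarrow> int \<Rightarrow> 'a \<Rightarrow> 'a" where
  "spectral m k x = (if m = 0 then lim (\<lambda>N. average (Suc N) k x) else average m k x)"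

text \<open>On \<open>degree j\<close> the sequence is eventually constant, because \<open>j\<close>
  and \<open>k\<close> are congruent modulo a large number only if equal; contractivity extends
  convergence to all \<open>x\<close>.\<close>

lemma average_tendsto: "(\<lambda>N. average (Suc N) k x) \<longlonglongrightarrow> spectral 0 k x"
proof -
  have "x \<in> {x. convergent (\<lambda>N. average (Suc N) k x)}"
  proof (rule dense_degrees)
    show "closed {x. convergent (\<lambda>N. average (Suc N) k x)}"
      by (rule closed_convergent_nonexpansive) (metis average_diff norm_average)
    show "degree j \<subseteq> {x. convergent (\<lambda>N. average (Suc N) k x)}" for j
    proof
      fix x assume "x \<in> degree j"
      then show "x \<in> {x. convergent (\<lambda>N. average (Suc N) k x)}"
        using tendsto_eventually[OF average_eventually[of x j k]] by (auto simp: convergent_def)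
    qed
    have "average (Suc N) k 0 = 0" for N using average_diff[of "Suc N" k 0 0] by simp
    then show "0 \<in> {x. convergent (\<lambda>N. average (Suc N) k x)}" by (simp add: convergent_const)
  qed (simp add: average_add convergent_add)
  then show ?thesis by (simp add: spectral_def convergent_LIMSEQ_iff)
qed

lemma spectral_add: "spectral m k (x + y) = spectral m k x + spectral m k y"
proof (cases "m = 0")
  case True
  have "(\<lambda>N. average (Suc N) k (x + y)) \<longlonglongrightarrow> spectral 0 k x + spectral 0 k y"
    unfolding average_add by (intro tendsto_add average_tendsto)
  then show ?thesis using True LIMSEQ_unique[OF average_tendsto] by blast
qed (simp add: spectral_def average_add)

lemma spectral_scaleC: "spectral m k (scaleC c x) = scaleC c (spectral m k x)"
proof (cases "m = 0")
  case True
  have "(\<lambda>N. average (Suc N) k (scaleC c x)) \<longlonglongrightarrow> scaleC c (spectral 0 k x)"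
    unfolding average_scaleC by (intro tendsto_scaleC average_tendsto)
  then show ?thesis using True LIMSEQ_unique[OF average_tendsto] by blast
qed (simp add: spectral_def average_scaleC)

lemma norm_spectral: "norm (spectral m k x) \<le> norm x"
proof (cases "m = 0")
  case True
  show ?thesis unfolding True
    by (rule Lim_bounded[OF tendsto_norm[OF average_tendsto]]) (simp add: norm_average)
qed (simp add: spectral_def norm_average)

lemma bounded_linear_spectral: "bounded_linear (spectral m k)"
  by (rule bounded_linear_intro[of _ 1])
     (simp_all add: spectral_add norm_spectral scaleC_of_real[symmetric] spectral_scaleC)

lemmas spectral_diff = linear_diff[OF bounded_linear.linear[OF bounded_linear_spectral]]
  and spectral_zero [simp] = linear_0[OF bounded_linear.linear[OF bounded_linear_spectral]]
  and spectral_sum = linear_sum[OF bounded_linear.linear[OF bounded_linear_spectral]]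

lemma spectral_degree:
  assumes "x \<in> degree j"
  shows "spectral m k x = (if int m dvd j - k then x else 0)"
proof (cases "m = 0")
  case True
  then show ?thesis
    using LIMSEQ_unique[OF average_tendsto tendsto_eventually[OF average_eventually[OF assms]]] by simp
qed (simp add: spectral_def average_degree[OF assms])

lemmas bounded_linear_compose_spectral = bounded_linear_compose[OF _ bounded_linear_spectral]

lemma spectral_in_degree: "spectral 0 k x \<in> degree k"
proof -
  have "\<tau> z (spectral 0 k x) = scaleC (z powi k) (spectral 0 k x)" if z: "cmod z = 1" for z
    by (rule eq_by_degrees[OF bounded_linear_compose_spectral[OF bounded_linear_\<tau>[OF z]]
          bounded_linear_compose_spectral[OF bounded_linear_scaleC]])
       (use z in \<open>simp add: spectral_degree degreeD linear_0[OF bounded_linear.linear[OF bounded_linear_\<tau>]]\<close>)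
  then show ?thesis by (simp add: degree_def)
qed

lemma spectral_cong: "int m dvd j - k \<Longrightarrow> spectral m j x = spectral m k x"
proof (rule eq_by_degrees[OF bounded_linear_spectral bounded_linear_spectral])
  fix i x assume d: "int m dvd j - k" and x: "x \<in> degree i"
  have "int m dvd i - j \<longleftrightarrow> int m dvd i - k"
    using dvd_add_right_iff[OF d, of "i - j"] by simp
  then show "spectral m j x = spectral m k x" using x by (simp add: spectral_degree)
qed

lemma spectral_spectral:
  "spectral m j (spectral m k x) = (if int m dvd j - k then spectral m k x else 0)"
proof (cases "int m dvd j - k")
  case True
  have "spectral m j (spectral m k x) = spectral m k x"
    by (rule eq_by_degrees[OF bounded_linear_compose_spectral[OF bounded_linear_spectral] bounded_linear_spectral])
       (simp add: spectral_degree spectral_cong[OF True])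
  then show ?thesis using True by simp
next
  case False
  have "spectral m j (spectral m k x) = 0"
  proof (rule eq_by_degrees[OF bounded_linear_compose_spectral[OF bounded_linear_spectral] bounded_linear_zero])
    fix i x assume x: "x \<in> degree i"
    have "\<not> int m dvd i - j" if "int m dvd i - k"
      using dvd_diff[OF that, of "i - j"] False by auto
    then show "spectral m j (spectral m k x) = 0" using x by (simp add: spectral_degree)
  qed
  then show ?thesis using False by simp
qed

lemma spectral_0_spectral: "spectral 0 j (spectral m 0 x) = (if int m dvd j then spectral 0 j x else 0)"
proof (cases "int m dvd j")
  case True
  have "spectral 0 j (spectral m 0 x) = spectral 0 j x"
    by (rule eq_by_degrees[OF bounded_linear_compose_spectral[OF bounded_linear_spectral] bounded_linear_spectral])
       (use True in \<open>auto simp: spectral_degree\<close>)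
  then show ?thesis using True by simp
next
  case False
  have "spectral 0 j (spectral m 0 x) = 0"
    by (rule eq_by_degrees[OF bounded_linear_compose_spectral[OF bounded_linear_spectral] bounded_linear_zero])
       (use False in \<open>auto simp: spectral_degree\<close>)
  then show ?thesis using False by simp
qed

lemma spectral_star: "spectral m k (star x) = star (spectral m (- k) x)"
proof (rule eq_by_degrees[OF bounded_linear_compose[OF bounded_linear_spectral bounded_linear_star]
      bounded_linear_compose_spectral[OF bounded_linear_star]])
  fix j x assume x: "x \<in> degree j"
  have "int m dvd - j - k \<longleftrightarrow> int m dvd j - - k"
    using dvd_minus_iff[of "int m" "j + k"] by (simp add: algebra_simps)
  then show "spectral m k (star x) = star (spectral m (- k) x)"
    using x degree_star[OF x] by (simp add: spectral_degree)
qed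

lemma spectral_mult_left:
  assumes d: "d \<in> degree i"
  shows "spectral m k (d * x) = d * spectral m (k - i) x"
proof (rule eq_by_degrees[OF bounded_linear_compose[OF bounded_linear_spectral bounded_linear_mult_right]
      bounded_linear_compose_spectral[OF bounded_linear_mult_right]])
  fix j x assume x: "x \<in> degree j"
  show "spectral m k (d * x) = d * spectral m (k - i) x"
    using x degree_mult[OF d x] by (simp add: spectral_degree algebra_simps)
qed

lemma spectral_mult_right:
  assumes d: "d \<in> degree i"
  shows "spectral m k (x * d) = spectral m (k - i) x * d"
proof (rule eq_by_degrees[OF bounded_linear_compose[OF bounded_linear_spectral bounded_linear_mult_left]
      bounded_linear_compose_spectral[OF bounded_linear_mult_left]])
  fix j x assume x: "x \<in> degree j"
  show "spectral m k (x * d) = spectral m (k - i) x * d"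
    using x degree_mult[OF x d] by (simp add: spectral_degree algebra_simps)
qed

text \<open>Both sides are bounded linear in \<open>x\<close>, so \<open>x\<close> may have a degree
  \<open>i\<close>. Either both sides vanish, or \<open>i\<close> is congruent to \<open>j\<close>
  modulo \<open>m\<close> and \<open>spectral_cong\<close> absorbs the difference. The factor
  \<open>y\<close> remains arbitrary.\<close>

lemma spectral_mult_spectral_left:
  "spectral m (j + k) (spectral m j x * y) = spectral m j x * spectral m k y"
proof (rule eq_by_degrees[OF bounded_linear_compose[OF bounded_linear_spectral
        bounded_linear_compose[OF bounded_linear_mult_left bounded_linear_spectral]]
      bounded_linear_compose_spectral[OF bounded_linear_mult_left]])
  fix i x assume x: "x \<in> degree i"
  show "spectral m (j + k) (spectral m j x * y) = spectral m j x * spectral m k y"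
  proof (cases "int m dvd i - j")
    case True
    then have "int m dvd (j + k - i) - k" using dvd_minus_iff[of "int m" "i - j"] by simp
    from spectral_cong[OF this] show ?thesis
      using True by (simp add: spectral_degree[OF x] spectral_mult_left[OF x])
  qed (use x in \<open>simp add: spectral_degree\<close>)
qed

lemma spectral_mult_spectral_right:
  "spectral m (j + k) (y * spectral m j x) = spectral m k y * spectral m j x"
proof (rule eq_by_degrees[OF bounded_linear_compose[OF bounded_linear_spectral
        bounded_linear_compose[OF bounded_linear_mult_right bounded_linear_spectral]]
      bounded_linear_compose_spectral[OF bounded_linear_mult_right]])
  fix i x assume x: "x \<in> degree i"
  show "spectral m (j + k) (y * spectral m j x) = spectral m k y * spectral m j x"
  proof (cases "int m dvd i - j")
    case True
    then have "int m dvd (j + k - i) - k" using dvd_minus_iff[of "int m" "i - j"] by simp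
    from spectral_cong[OF this] show ?thesis
      using True by (simp add: spectral_degree[OF x] spectral_mult_right[OF x])
  qed (use x in \<open>simp add: spectral_degree\<close>)
qed

text \<open>The Fejer kernel \<open>\<bar>\<Sum>i<J. z^i\<bar>\<^sup>2 / J\<close> is positive with mean \<open>1\<close>.\<close>

lemma norm_Fejer_average:
  assumes J: "J \<le> N" "N > 0"
  shows "norm (\<Sum>i<J. \<Sum>j<J. average N (int i - int j) x) \<le> real J * norm x"
proof -
  let ?w = "unity_root N"
  define \<kappa> where "\<kappa> l = (\<Sum>i<J. \<Sum>j<J. ?w l powi (int j - int i))" for l
  have \<kappa>: "\<kappa> l = complex_of_real ((cmod (\<Sum>i<J. ?w l powi int i))\<^sup>2)" for l
  proof -
    have "complex_of_real ((cmod (\<Sum>i<J. ?w l powi int i))\<^sup>2)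
        = (\<Sum>j<J. ?w l powi int j) * (\<Sum>i<J. cnj (?w l powi int i))"
      by (simp only: complex_norm_square cnj_sum)
    also have "\<dots> = (\<Sum>i<J. \<Sum>j<J. ?w l powi int j * ?w l powi (- int i))"
      unfolding sum_product by (subst sum.swap) (simp only: cnj_powi_unimodular[OF norm_unity_root])
    also have "\<dots> = \<kappa> l"
      by (simp add: \<kappa>_def power_int_add[of "?w l", symmetric] del: power_int_of_nat)
    finally show ?thesis by simp
  qed
  have "(\<Sum>l<N. \<kappa> l) = (\<Sum>i<J. \<Sum>j<J. \<Sum>l<N. ?w l powi (int j - int i))"
    unfolding \<kappa>_def by (subst sum.swap, rule sum.cong[OF refl], subst sum.swap, rule refl)
  \<comment> \<open>Here \<open>J \<le> N\<close> matters: indices below \<open>J\<close> that agree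
    modulo \<open>N\<close> are equal.\<close>
  also have "\<dots> = (\<Sum>i<J. \<Sum>j<J. if j = i then of_nat N else 0)"
  proof (intro sum.cong refl)
    fix i j assume "i \<in> {..<J}" "j \<in> {..<J}"
    then have "\<bar>int j - int i\<bar> < int N" using J by auto
    then have "int N dvd int j - int i \<longleftrightarrow> j = i"
      using zdvd_imp_le[of "int N" "\<bar>int j - int i\<bar>"] by auto
    then show "(\<Sum>l<N. ?w l powi (int j - int i)) = (if j = i then of_nat N else 0)"
      by (simp add: sum_unity_roots[OF J(2)])
  qed
  finally have "(\<Sum>l<N. \<kappa> l) = of_nat J * of_nat N" by simp
  \<comment> \<open>As the kernel is nonnegative, its mean equals its total mass; this yields the
    factor \<open>J\<close> instead of the number \<open>J * J\<close> of pairs.\<close>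
  moreover have "\<kappa> l = complex_of_real (cmod (\<kappa> l))" for l
    using \<kappa>[of l] by (metis norm_of_real abs_power2)
  then have "(\<Sum>l<N. \<kappa> l) = complex_of_real (\<Sum>l<N. cmod (\<kappa> l))" by (simp only: of_real_sum)
  ultimately have "complex_of_real (\<Sum>l<N. cmod (\<kappa> l)) = complex_of_real (real J * real N)"
    by simp
  then have sum\<kappa>: "(\<Sum>l<N. cmod (\<kappa> l)) = real J * real N" by (simp only: of_real_eq_iff)
  have "(\<Sum>i<J. \<Sum>j<J. average N (int i - int j) x)
      = scaleR (1 / real N) (\<Sum>i<J. \<Sum>j<J. \<Sum>l<N. scaleC (?w l powi (int j - int i)) (\<tau> (?w l) x))"
    by (simp add: average_def scaleR_sum_right)
  also have "(\<Sum>i<J. \<Sum>j<J. \<Sum>l<N. scaleC (?w l powi (int j - int i)) (\<tau> (?w l) x))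
      = (\<Sum>l<N. scaleC (\<kappa> l) (\<tau> (?w l) x))"
    unfolding \<kappa>_def scaleC_sum_left
    by (rule trans[OF sum.cong[OF refl sum.swap] sum.swap])
  finally have eq: "(\<Sum>i<J. \<Sum>j<J. average N (int i - int j) x)
      = scaleR (1 / real N) (\<Sum>l<N. scaleC (\<kappa> l) (\<tau> (?w l) x))" .
  have "norm (\<Sum>l<N. scaleC (\<kappa> l) (\<tau> (?w l) x)) \<le> (\<Sum>l<N. cmod (\<kappa> l) * norm x)"
    by (rule sum_norm_le) (simp add: norm_scaleC mult_left_mono norm_\<tau>)
  also have "\<dots> = real J * real N * norm x" by (simp add: sum_distrib_right[symmetric] sum\<kappa>)
  finally show ?thesis unfolding eq using J(2) by (simp add: divide_simps mult_ac)
qed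

text \<open>The Cesaro mean of the Fourier series: for \<open>\<bar>k\<bar> < J\<close>, exactly
  \<open>J - \<bar>k\<bar>\<close> of the pairs \<open>(i, j)\<close> have difference
  \<open>k\<close>, so degree \<open>k\<close> receives the weight
  \<open>1 - \<bar>k\<bar> / J\<close>.\<close>

definition Fejer :: "nat \<Rightarrow> 'a \<Rightarrow> 'a" where
  "Fejer J x = scaleR (1 / real J) (\<Sum>i<J. \<Sum>j<J. spectral 0 (int i - int j) x)"

lemma norm_Fejer: "norm (Fejer J x) \<le> norm x"
proof (cases "J = 0")
  case False
  have "(\<lambda>N. \<Sum>i<J. \<Sum>j<J. average (Suc N) (int i - int j) x) \<longlonglongrightarrow> (\<Sum>i<J. \<Sum>j<J. spectral 0 (int i - int j) x)"
    by (intro tendsto_sum average_tendsto)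
  then have "norm (\<Sum>i<J. \<Sum>j<J. spectral 0 (int i - int j) x) \<le> real J * norm x"
    by (rule Lim_bounded[OF tendsto_norm, of _ _ J]) (simp add: norm_Fejer_average)
  then show ?thesis using False by (simp add: Fejer_def divide_simps mult.commute)
qed (simp add: Fejer_def)

lemma Fejer_add: "Fejer J (x + y) = Fejer J x + Fejer J y"
  by (simp add: Fejer_def spectral_add sum.distrib scaleR_add_right)

lemma Fejer_diff: "Fejer J (x - y) = Fejer J x - Fejer J y"
  by (simp add: Fejer_def spectral_diff sum_subtractf scaleR_diff_right)

lemma Fejer_degree:
  assumes x: "x \<in> degree k" and J: "J > 0"
  shows "norm (Fejer J x - x) \<le> \<bar>real_of_int k\<bar> * norm x / real J"
proof -
  define P where "P i \<longleftrightarrow> 0 \<le> int i - k \<and> int i - k < int J" for i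
  have inner: "(\<Sum>j<J. spectral 0 (int i - int j) x) = (if P i then x else 0)" for i
  proof -
    have "(\<Sum>j<J. spectral 0 (int i - int j) x) = (\<Sum>j<J. if j = nat (int i - k) then (if 0 \<le> int i - k then x else 0) else 0)"
      by (rule sum.cong) (auto simp: spectral_degree[OF x])
    also have "\<dots> = (if P i then x else 0)"
      by (subst sum.delta) (auto simp: P_def nat_less_iff)
    finally show ?thesis .
  qed
  define Q where "Q = {i \<in> {..<J}. \<not> P i}"
  \<comment> \<open>The indices \<open>i\<close> that have no partner \<open>j\<close> with
    \<open>i - j = k\<close> are the first ones, at most \<open>k\<close> of them, if
    \<open>k > 0\<close>, and the last ones, at most \<open>- k\<close>, if
    \<open>k < 0\<close>.\<close>
  have "Q \<subseteq> {..<nat k} \<union> {nat (int J + k)..<J}"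
    by (auto simp: Q_def P_def)
  then have "card Q \<le> card ({..<nat k} \<union> {nat (int J + k)..<J})" by (intro card_mono) auto
  also have "\<dots> \<le> nat k + (J - nat (int J + k))" using card_Un_le[of "{..<nat k}" "{nat (int J + k)..<J}"] by simp
  also have "\<dots> \<le> nat \<bar>k\<bar>" by linarith
  finally have cQ: "real (card Q) \<le> \<bar>real_of_int k\<bar>" by linarith
  have "(\<Sum>i<J. if P i then x else 0) = (\<Sum>i<J. x) - (\<Sum>i<J. if P i then 0 else x)"
    unfolding sum_subtractf[symmetric] by (rule sum.cong) auto
  also have "(\<Sum>i<J. if P i then 0 else x) = scaleR (real (card Q)) x"
    by (simp add: Q_def sum.If_cases Int_def scaleR_conv_of_real)
  also have "(\<Sum>i<J. x) = scaleR (real J) x" by (simp add: scaleR_conv_of_real)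
  finally have "Fejer J x - x = scaleR (- (real (card Q) / real J)) x"
    using J by (simp add: Fejer_def inner scaleR_diff_right)
  then have "norm (Fejer J x - x) = real (card Q) / real J * norm x" by simp
  also have "\<dots> \<le> \<bar>real_of_int k\<bar> / real J * norm x"
    using cQ by (intro mult_right_mono divide_right_mono) auto
  finally show ?thesis by simp
qed

lemma Fejer_tendsto: "(\<lambda>J. Fejer J x) \<longlonglongrightarrow> x"
proof -
  have "x \<in> {x. (\<lambda>J. Fejer J x) \<longlonglongrightarrow> x}"
  proof (rule dense_degrees)
    show "closed {x. (\<lambda>J. Fejer J x) \<longlonglongrightarrow> x}"
      by (rule closed_tendsto_self_nonexpansive) (metis Fejer_diff norm_Fejer)
    show "degree k \<subseteq> {x. (\<lambda>J. Fejer J x) \<longlonglongrightarrow> x}" for k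
    proof
      fix x assume x: "x \<in> degree k"
      have "(\<lambda>J. \<bar>real_of_int k\<bar> * norm x / real J) \<longlonglongrightarrow> 0"
        by (rule lim_const_over_n)
      then have "(\<lambda>J. Fejer J x - x) \<longlonglongrightarrow> 0"
        by (rule Lim_null_comparison[rotated])
           (use Fejer_degree[OF x] in \<open>auto intro: eventually_sequentiallyI[of 1]\<close>)
      then show "x \<in> {x. (\<lambda>J. Fejer J x) \<longlonglongrightarrow> x}" by (simp add: LIM_zero_iff)
    qed
  qed (auto simp: Fejer_add intro: tendsto_add, simp add: Fejer_def)
  then show ?thesis by simp
qed

text \<open>The Fejer means are built from the Fourier coefficients alone and converge to the
  element.\<close>

lemma zero_if_spectral_zero:
  assumes "\<And>k. spectral 0 k x = 0"
  shows "x = 0"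
proof -
  have "Fejer J x = 0" for J by (simp add: Fejer_def assms)
  then show ?thesis using Fejer_tendsto[of x] LIMSEQ_unique[OF tendsto_const] by auto
qed

lemma spectral_fixed_iff: "spectral m 0 x = x \<longleftrightarrow> (\<forall>k. \<not> int m dvd k \<longrightarrow> spectral 0 k x = 0)"
proof
  assume "spectral m 0 x = x"
  then show "\<forall>k. \<not> int m dvd k \<longrightarrow> spectral 0 k x = 0" by (metis spectral_0_spectral)
next
  assume "\<forall>k. \<not> int m dvd k \<longrightarrow> spectral 0 k x = 0"
  then have "spectral 0 k (spectral m 0 x - x) = 0" for k
    by (simp add: spectral_diff spectral_0_spectral)
  then show "spectral m 0 x = x" using zero_if_spectral_zero by fastforce
qed

end

section \<open>The conditional expectation onto \<open>cuntz_sub\<close>\<close>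

lemma closure_add_closed:
  fixes A :: "'a::real_normed_vector set"
  assumes "\<And>x y. x \<in> A \<Longrightarrow> y \<in> A \<Longrightarrow> x + y \<in> A" "x \<in> closure A" "y \<in> closure A"
  shows "x + y \<in> closure A"
proof -
  obtain f g where "\<And>k. f k \<in> A" "f \<longlonglongrightarrow> x" "\<And>k. g k \<in> A" "g \<longlonglongrightarrow> y"
    using assms(2,3) unfolding closure_sequential by blast
  then have "\<And>k. f k + g k \<in> A" "(\<lambda>k. f k + g k) \<longlonglongrightarrow> x + y"
    using assms(1) by (auto intro: tendsto_add)
  then show ?thesis unfolding closure_sequential by (intro exI[of _ "\<lambda>k. f k + g k"]) simp
qed

lemma scaleC_1_inject: "scaleC a (1 :: 'a::cstar_algebra_1) = scaleC b 1 \<longleftrightarrow> a = b"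
proof
  assume "scaleC a (1 :: 'a) = scaleC b 1"
  then have "scaleC (a - b) (1 :: 'a) = 0" by (simp add: scaleC_diff_left)
  then show "a = b" by simp
qed simp

lemma cstar_subalgebra_cstar_generated: "cstar_subalgebra (cstar_generated X)"
  unfolding cstar_generated_def
proof (rule hull_in)
  fix T :: "'a set set" assume T: "Ball T cstar_subalgebra"
  have "closed (\<Inter>T)" using T by (intro closed_Inter) (auto simp: cstar_subalgebra_def)
  then show "cstar_subalgebra (\<Inter>T)" using T by (simp add: cstar_subalgebra_def)
qed

lemma
  assumes "cstar_subalgebra A"
  shows cstar_subalgebra_closed: "closed A"
    and cstar_subalgebra_zero: "0 \<in> A"
    and cstar_subalgebra_add: "x \<in> A \<Longrightarrow> y \<in> A \<Longrightarrow> x + y \<in> A"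
    and cstar_subalgebra_mult: "x \<in> A \<Longrightarrow> y \<in> A \<Longrightarrow> x * y \<in> A"
    and cstar_subalgebra_scaleC: "x \<in> A \<Longrightarrow> scaleC c x \<in> A"
    and cstar_subalgebra_star: "x \<in> A \<Longrightarrow> star x \<in> A"
    and cstar_subalgebra_diff: "x \<in> A \<Longrightarrow> y \<in> A \<Longrightarrow> x - y \<in> A"
    and cstar_subalgebra_sum: "(\<And>i. i \<in> I \<Longrightarrow> f i \<in> A) \<Longrightarrow> sum f I \<in> A"
proof -
  show *: "closed A" "0 \<in> A" "\<And>x y. x \<in> A \<Longrightarrow> y \<in> A \<Longrightarrow> x + y \<in> A"
    "x \<in> A \<Longrightarrow> y \<in> A \<Longrightarrow> x * y \<in> A" "\<And>c x. x \<in> A \<Longrightarrow> scaleC c x \<in> A" "x \<in> A \<Longrightarrow> star x \<in> A"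
    using assms by (simp_all add: cstar_subalgebra_def)
  show "x - y \<in> A" if "x \<in> A" "y \<in> A"
    using *(3)[OF that(1) *(5)[OF that(2), of "-1"]] by (simp add: scaleC_minus_left)
  show "(\<And>i. i \<in> I \<Longrightarrow> f i \<in> A) \<Longrightarrow> sum f I \<in> A"
    by (induction I rule: infinite_finite_induct) (auto intro: *)
qed

context cuntz_family
begin

lemma scalar_of_matrix_units_0: "x \<in> matrix_units 0 0 \<Longrightarrow> \<exists>c. x = scaleC c 1"
  by (simp add: matrix_units_def)

lemma column_in_matrix_units: "\<mu> \<in> words_of_length a \<Longrightarrow> s \<mu> \<in> matrix_units a 0"
  using monomial_in_matrix_units[of \<mu> a "[]" 0] by simp

text \<open>The elements of \<open>matrix_units a 0\<close> are the combinations of the words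
  \<open>s \<mu>\<close>, which are orthonormal for the scalar-valued form
  \<open>star x * y\<close>; hence the C*-norm is a Hilbert space norm on them.\<close>

lemma star_mult_column:
  assumes x: "x \<in> matrix_units a 0"
  shows "star x * x = scaleC (of_real ((norm x)\<^sup>2)) 1"
proof -
  have "\<forall>\<mu>\<in>words_of_length a. \<exists>c. star (s \<mu>) * x = scaleC c 1"
    using x by (simp add: matrix_units_def)
  then obtain f where f: "\<And>\<mu>. \<mu> \<in> words_of_length a \<Longrightarrow> star (s \<mu>) * x = scaleC (f \<mu>) 1" by metis
  define r where "r = (\<Sum>\<mu>\<in>words_of_length a. (cmod (f \<mu>))\<^sup>2)"
  have "r \<ge> 0" unfolding r_def by (intro sum_nonneg) simp
  have "star x * x = star x * (\<Sum>\<mu>\<in>words_of_length a. s \<mu> * (star (s \<mu>) * x))"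
    using expand_left[of x a] by simp
  also have "\<dots> = (\<Sum>\<mu>\<in>words_of_length a. star (star (s \<mu>) * x) * (star (s \<mu>) * x))"
    by (simp add: sum_distrib_left star_mult star_star mult.assoc)
  also have "\<dots> = (\<Sum>\<mu>\<in>words_of_length a. scaleC (of_real ((cmod (f \<mu>))\<^sup>2)) 1)"
    by (rule sum.cong)
       (simp_all add: f star_scaleC scaleC_1_mult scaleC_scaleC complex_norm_square mult.commute del: of_real_power)
  finally have eq: "star x * x = scaleC (of_real r) 1"
    by (simp add: r_def scaleC_sum_left)
  have "(norm x)\<^sup>2 = r"
    using cstar_identity[of x] \<open>r \<ge> 0\<close> by (simp add: eq norm_scaleC)
  then show ?thesis using eq by simp
qed

text \<open>Here \<open>g\<close> acts on the finite-dimensional Hilbert space \<open>matrix_units L 0\<close>, which does not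
  determine the norm of \<open>g\<close> directly; it does so by the growth of the powers of \<open>g\<close>.\<close>

lemma norm_le_if_form_bounded:
  assumes g: "g \<in> matrix_units L L" "star g = g" and R: "R \<ge> 0"
    and form: "\<And>u. u \<in> matrix_units L 0 \<Longrightarrow>
      \<exists>r. star u * g * u = scaleC (of_real r) 1 \<and> 0 \<le> r \<and> r \<le> R * (norm u)\<^sup>2"
  shows "norm g \<le> R"
proof -
  obtain q where q: "\<And>u. u \<in> matrix_units L 0 \<Longrightarrow> star u * g * u = scaleC (of_real (q u)) 1"
    and q0: "\<And>u. u \<in> matrix_units L 0 \<Longrightarrow> 0 \<le> q u"
    and qR: "\<And>u. u \<in> matrix_units L 0 \<Longrightarrow> q u \<le> R * (norm u)\<^sup>2"
    using form by metis
  have gu: "g * u \<in> matrix_units L 0" if "u \<in> matrix_units L 0" for u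
    using matrix_units_mult[OF g(1) that] .
  have contr: "norm (g * u) \<le> R * norm u" if u: "u \<in> matrix_units L 0" for u
  proof -
    define w where "w = g * u"
    have w: "w \<in> matrix_units L 0" using gu[OF u] by (simp add: w_def)
    \<comment> \<open>Testing the positive form \<open>q\<close> on \<open>u - t w\<close> with
      \<open>w = g * u\<close> is the Cauchy-Schwarz argument; the linear term is
      \<open>(norm w)\<^sup>2\<close> because \<open>star u * g * w = star w * w\<close>.\<close>
    have exp: "q (u - scaleR t w) = q u - 2 * t * (norm w)\<^sup>2 + t\<^sup>2 * q w" for t
    proof -
      let ?c = "complex_of_real t"
      have m: "u - scaleC ?c w \<in> matrix_units L 0" using matrix_units_diff[OF u matrix_units_scaleC[OF w]] .
      have sw: "star w = star u * g" by (simp add: w_def star_mult g)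
      have "star u * g * w = star w * w" "star w * g * u = star w * w"
        by (simp add: sw) (simp add: w_def mult.assoc)
      then have "star (u - scaleC ?c w) * g * (u - scaleC ?c w)
          = star u * g * u - scaleC ?c (star w * w) - scaleC ?c (star w * w) + scaleC (?c * ?c) (star w * g * w)"
        by (simp add: star_diff star_scaleC left_diff_distrib right_diff_distrib scaleC_mult_left
            scaleC_mult_right scaleC_scaleC scaleC_diff_right)
      also have "\<dots> = scaleC (of_real (q u - 2 * t * (norm w)\<^sup>2 + t\<^sup>2 * q w)) 1"
        unfolding q[OF u] q[OF w] star_mult_column[OF w]
        by (simp add: scaleC_scaleC scaleC_diff_left[symmetric] scaleC_add_left[symmetric] power2_eq_square algebra_simps)
      finally have "q (u - scaleC ?c w) = q u - 2 * t * (norm w)\<^sup>2 + t\<^sup>2 * q w"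
        unfolding q[OF m] scaleC_1_inject of_real_eq_iff .
      then show ?thesis by (simp add: scaleC_of_real)
    qed
    have m: "u - scaleR t w \<in> matrix_units L 0" for t
      using matrix_units_diff[OF u matrix_units_scaleC[OF w, of "of_real t"]] by (simp add: scaleC_of_real)
    have ineq: "0 \<le> R * (norm u)\<^sup>2 - 2 * t * (norm w)\<^sup>2 + t\<^sup>2 * (R * (norm w)\<^sup>2)" for t
      using q0[OF m[of t]] qR[OF u] mult_left_mono[OF qR[OF w], of "t\<^sup>2"] unfolding exp by simp
    have "(norm w)\<^sup>2 \<le> (R * norm u)\<^sup>2"
    proof (cases "R = 0")
      case True
      then show ?thesis using ineq[of 1] by simp
    next
      case False
      then have "R > 0" using R by simp
      \<comment> \<open>The value \<open>t = 1 / R\<close> minimizes the right-hand side of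
        \<open>ineq\<close>.\<close>
      have "0 \<le> R * (R * (norm u)\<^sup>2 - 2 * (1 / R) * (norm w)\<^sup>2 + (1 / R)\<^sup>2 * (R * (norm w)\<^sup>2))"
        using ineq[of "1 / R"] \<open>R > 0\<close> by (intro mult_nonneg_nonneg) auto
      also have "\<dots> = (R * norm u)\<^sup>2 - (norm w)\<^sup>2"
        using \<open>R > 0\<close> by (simp add: field_simps power2_eq_square)
      finally show ?thesis by simp
    qed
    then have "norm w \<le> R * norm u" by (rule power2_le_imp_le) (simp add: R)
    then show ?thesis by (simp add: w_def)
  qed
  have pow: "g ^ m * u \<in> matrix_units L 0 \<and> norm (g ^ m * u) \<le> R ^ m * norm u" if u: "u \<in> matrix_units L 0" for m u
  proof (induction m)
    case (Suc m)
    have "norm (g * (g ^ m * u)) \<le> R * (R ^ m * norm u)"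
      using contr[of "g ^ m * u"] Suc.IH mult_left_mono[OF conjunct2[OF Suc.IH] R] by linarith
    then show ?case using gu[of "g ^ m * u"] Suc.IH by (simp add: mult.assoc)
  qed (simp add: u)
  \<comment> \<open>Only the columns of \<open>g ^ m\<close> are controlled. Adding them up costs
    the number of words, which \<open>power_bounded_self_adjoint\<close> removes.\<close>
  have "norm (g ^ m) \<le> real (card (words_of_length L)) * R ^ m" for m
  proof -
    have "norm (g ^ m) = norm (\<Sum>\<nu>\<in>words_of_length L. g ^ m * s \<nu> * star (s \<nu>))"
      using expand_right[of "g ^ m" L] by simp
    also have "\<dots> \<le> (\<Sum>\<nu>\<in>words_of_length L. R ^ m)"
    proof (rule sum_norm_le)
      fix \<nu> assume \<nu>: "\<nu> \<in> words_of_length L"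
      then have n1: "norm (s \<nu>) = 1" using words_lengthD by auto
      have "norm (g ^ m * s \<nu> * star (s \<nu>)) \<le> norm (g ^ m * s \<nu>)"
        using norm_mult_ineq[of "g ^ m * s \<nu>" "star (s \<nu>)"] n1 by simp
      also have "\<dots> \<le> R ^ m" using pow[OF column_in_matrix_units[OF \<nu>], of m] n1 by simp
      finally show "norm (g ^ m * s \<nu> * star (s \<nu>)) \<le> R ^ m" .
    qed
    finally show ?thesis by simp
  qed
  then show ?thesis by (rule power_bounded_self_adjoint[OF g(2) _ R])
qed

end

context gauged_cuntz_family
begin

text \<open>The fixed points of \<open>spectral m 0\<close> form a C*-subalgebra containing the
  generators of \<open>cuntz_sub\<close>. Conversely, \<open>spectral m 0\<close> maps a monomial to
  itself or to 0, hence by density everything into \<open>cuntz_sub\<close>.\<close>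

lemma cuntz_sub_eq: "cuntz_sub n S m = {x. spectral m 0 x = x}"
proof
  have "cstar_subalgebra {x. spectral m 0 x = x}"
  proof -
    have "closed {x. spectral m 0 x = x}"
      by (intro closed_Collect_eq linear_continuous_on bounded_linear_spectral continuous_on_id)
    moreover have "spectral m 0 (x * y) = x * y" if "spectral m 0 x = x" "spectral m 0 y = y" for x y
      using spectral_mult_spectral_left[of m 0 0 x y] that by simp
    ultimately show ?thesis
      by (simp add: cstar_subalgebra_def spectral_add spectral_scaleC spectral_star)
  qed
  then show "cuntz_sub n S m \<subseteq> {x. spectral m 0 x = x}"
    unfolding cuntz_sub_def cstar_generated_def
    by (rule hull_minimal[rotated]) (auto simp: spectral_degree[OF degree_monomial])
next
  let ?C = "cuntz_sub n S m"
  have C: "cstar_subalgebra ?C" unfolding cuntz_sub_def by (rule cstar_subalgebra_cstar_generated)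
  have "x \<in> {x. spectral m 0 x \<in> ?C}" for x
  proof (rule dense_monomials)
    have "closed (spectral m 0 -` ?C)"
      by (rule closed_vimage[OF cstar_subalgebra_closed[OF C] linear_continuous_on[OF bounded_linear_spectral]])
    then show "closed {x. spectral m 0 x \<in> ?C}" by (simp add: vimage_def)
    show "monomials \<subseteq> {x. spectral m 0 x \<in> ?C}"
    proof
      fix x assume "x \<in> monomials"
      then obtain c \<mu> \<nu> where x: "x = scaleC c (s \<mu> * star (s \<nu>))" "\<mu> \<in> cuntz_words n" "\<nu> \<in> cuntz_words n"
        unfolding monomials_def by blast
      have "s \<mu> * star (s \<nu>) \<in> ?C" if "int m dvd int (length \<mu>) - int (length \<nu>)"
        unfolding cuntz_sub_def cstar_generated_def using that x by (intro hull_inc) blast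
      then show "x \<in> {x. spectral m 0 x \<in> ?C}"
        using cstar_subalgebra_scaleC[OF C] cstar_subalgebra_zero[OF C]
        by (simp add: x(1) spectral_scaleC spectral_degree[OF degree_monomial[OF x(2,3)]])
    qed
  qed (simp_all add: spectral_add cstar_subalgebra_zero[OF C] cstar_subalgebra_add[OF C])
  then show "{x. spectral m 0 x = x} \<subseteq> ?C" by (metis (mono_tags, lifting) mem_Collect_eq subsetI)
qed

section \<open>Positivity of the average over the m-th roots of unity\<close>

lemma spectral_fixed_add_degrees:
  assumes "m > 0"
  shows "x = (\<Sum>r<m. spectral m (int r) x)"
proof (rule eq_by_degrees[of "\<lambda>x. x"])
  show "bounded_linear (\<lambda>x. \<Sum>r<m. spectral m (int r) x)"
    by (intro bounded_linear_sum bounded_linear_spectral)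
  fix k x assume x: "x \<in> degree k"
  have "(\<Sum>r<m. spectral m (int r) x) = (\<Sum>r<m. if r = nat (k mod int m) then x else 0)"
  proof (rule sum.cong)
    fix r assume "r \<in> {..<m}"
    then have "int m dvd k - int r \<longleftrightarrow> int r = k mod int m"
      by (metis lessThan_iff mod_eq_dvd_iff mod_pos_pos_trivial of_nat_0_le_iff of_nat_less_iff)
    then show "spectral m (int r) x = (if r = nat (k mod int m) then x else 0)"
      using assms by (auto simp: spectral_degree[OF x])
  qed simp
  also have "\<dots> = x" using assms by (subst sum.delta) (auto simp: nat_less_iff)
  finally show "x = (\<Sum>r<m. spectral m (int r) x)" by simp
qed (rule bounded_linear_ident)

text \<open>Parseval's identity: a cross term has degree \<open>r - q\<close> modulo
  \<open>m\<close>, which is not 0 for distinct \<open>q, r < m\<close>.\<close>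

lemma spectral_star_mult_self:
  assumes "m > 0"
  shows "spectral m 0 (star x * x) = (\<Sum>r<m. star (spectral m (int r) x) * spectral m (int r) x)"
proof -
  have summand: "spectral m 0 (star (spectral m (int q) x) * spectral m (int r) x)
      = (if r = q then star (spectral m (int r) x) * spectral m (int r) x else 0)" if "q < m" "r < m" for q r
  proof -
    have "spectral m 0 (star (spectral m (int q) x) * spectral m (int r) x)
        = spectral m (- int q + int q) (spectral m (- int q) (star x) * spectral m (int r) x)"
      by (simp add: spectral_star)
    also have "\<dots> = star (spectral m (int q) x) * spectral m (int q) (spectral m (int r) x)"
      unfolding spectral_mult_spectral_left by (simp add: spectral_star)
    also have "spectral m (int q) (spectral m (int r) x) = (if r = q then spectral m (int r) x else 0)"
      unfolding spectral_spectral using that zdvd_imp_le[of "int m" "\<bar>int q - int r\<bar>"] by auto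
    finally show ?thesis by simp
  qed
  have "spectral m 0 (star x * x)
      = spectral m 0 ((\<Sum>q<m. star (spectral m (int q) x)) * (\<Sum>r<m. spectral m (int r) x))"
    using spectral_fixed_add_degrees[OF assms, of x] by (simp add: star_sum[symmetric])
  also have "\<dots> = (\<Sum>q<m. \<Sum>r<m. spectral m 0 (star (spectral m (int q) x) * spectral m (int r) x))"
    by (simp add: sum_product spectral_sum)
  also have "\<dots> = (\<Sum>q<m. \<Sum>r<m. if r = q then star (spectral m (int r) x) * spectral m (int r) x else 0)"
    by (intro sum.cong refl summand) auto
  finally show ?thesis by simp
qed

text \<open>The isometries \<open>S 1 ^ a * S 2\<close> have pairwise orthogonal ranges; they move the summands of
  \<open>spectral_star_mult_self\<close> into degrees divisible by \<open>m\<close>.\<close>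

lemma spectral_positive_finite:
  assumes n: "n \<ge> 2" and m: "m > 0"
  shows "positive_in {x. spectral m 0 x = x} (spectral m 0 (star x * x))"
proof -
  \<comment> \<open>\<open>V r\<close> is a word \<open>1 ... 1 2\<close> of length
    \<open>m - r\<close>, so \<open>V r * spectral m (int r) x\<close> has degree 0 modulo
    \<open>m\<close>. The final letter 2 prevents any of these words from being a prefix of
    another.\<close>
  define V where "V r = s (replicate (m - 1 - r) 1 @ [2])" for r
  have word: "replicate a 1 @ [2] \<in> cuntz_words n" for a
    using n by (auto simp: cuntz_words_def)
  have V_degree: "V r \<in> degree (int (m - r))" if "r < m" for r
    using degree_word[OF word[of "m - 1 - r"]] that by (simp add: V_def of_nat_diff algebra_simps)
  have orth1: "star (V q) * V r = 0" if "q < r" "r < m" for q r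
  proof -
    define a where "a = m - 1 - r"
    define d where "d = r - q"
    have d: "m - 1 - q = a + d" "d > 0" using that by (auto simp: a_def d_def)
    have "V q = s (replicate a 1) * s (replicate d 1 @ [2])"
      by (simp only: V_def d(1) replicate_add append_assoc word_prod_append)
    moreover have "V r = s (replicate a 1) * S 2"
      by (simp only: V_def a_def[symmetric] word_prod_append word_prod_Cons word_prod_Nil mult_1_right)
    ultimately have "star (V q) * V r = star (s (replicate d 1 @ [2])) * (star (s (replicate a 1)) * s (replicate a 1)) * S 2"
      by (simp only: star_mult mult.assoc)
    also have "\<dots> = star (s (replicate d 1 @ [2])) * S 2"
      using n by (subst word_isometry) (auto simp: cuntz_words_def)
    also have "\<dots> = star (s (replicate (d - 1) 1 @ [2])) * (star (S 1) * S 2)"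
      using d(2) by (cases d) (simp_all add: word_prod_Cons star_mult mult.assoc)
    also have "\<dots> = 0" using n by (simp add: generator_orthogonal)
    finally show ?thesis .
  qed
  have orth: "star (V q) * V r = (if r = q then 1 else 0)" if "q < m" "r < m" for q r
  proof (cases q r rule: linorder_cases)
    case equal then show ?thesis using word_isometry[OF word] by (simp add: V_def)
  next
    case greater
    then have "star (star (V r) * V q) = 0" using orth1 that by simp
    then show ?thesis using greater by (simp add: star_mult star_star)
  qed (use orth1 that in auto)
  define y where "y = (\<Sum>r<m. V r * spectral m (int r) x)"
  have "spectral m 0 y = y"
    unfolding y_def spectral_sum
  proof (rule sum.cong[OF refl])
    fix r assume "r \<in> {..<m}"
    then have r: "r < m" by simp
    have "spectral m (0 - int (m - r)) (spectral m (int r) x) = spectral m (int r) x"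
      unfolding spectral_spectral using r by (simp add: of_nat_diff)
    then show "spectral m 0 (V r * spectral m (int r) x) = V r * spectral m (int r) x"
      using spectral_mult_left[OF V_degree[OF r]] by simp
  qed
  moreover have "star y * y = spectral m 0 (star x * x)"
  proof -
    have "star y * y = (\<Sum>q<m. \<Sum>r<m. star (spectral m (int q) x) * (star (V q) * V r) * spectral m (int r) x)"
      unfolding y_def star_sum sum_product by (simp add: star_mult mult.assoc)
    also have "\<dots> = (\<Sum>q<m. \<Sum>r<m. if r = q then star (spectral m (int r) x) * spectral m (int r) x else 0)"
      by (intro sum.cong refl) (simp add: orth)
    finally show ?thesis by (simp add: spectral_star_mult_self[OF m])
  qed
  ultimately show ?thesis unfolding positive_in_def by auto
qed

section \<open>Positivity of the average over the circle\<close>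

text \<open>The span of all \<open>s \<mu>\<close>, sorted by length. Equality for every
  \<open>K \<ge> K0\<close> forces \<open>g k = 0\<close> from \<open>K0\<close> on, so that two
  elements can be written with a common number of terms.\<close>

definition columns :: "'a set" where
  "columns = {t. \<exists>g K0. (\<forall>k. g k \<in> matrix_units k 0) \<and> (\<forall>K\<ge>K0. t = (\<Sum>k<K. g k))}"

lemma columns_zero: "0 \<in> columns"
  unfolding columns_def by (auto intro!: exI[of _ "\<lambda>_. 0"])

lemma columns_add:
  assumes "t \<in> columns" "u \<in> columns"
  shows "t + u \<in> columns"
proof -
  obtain g K h M where "\<forall>k. g k \<in> matrix_units k 0" "\<forall>k. h k \<in> matrix_units k 0"
    "\<forall>N\<ge>K. t = (\<Sum>k<N. g k)" "\<forall>N\<ge>M. u = (\<Sum>k<N. h k)"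
    using assms unfolding columns_def by blast
  then have "(\<forall>k. g k + h k \<in> matrix_units k 0) \<and> (\<forall>N\<ge>max K M. t + u = (\<Sum>k<N. g k + h k))"
    by (auto simp: matrix_units_add sum.distrib)
  then show ?thesis unfolding columns_def by (intro CollectI exI[of _ "\<lambda>k. g k + h k"]) blast
qed

lemma columns_sum: "(\<And>i. i \<in> I \<Longrightarrow> f i \<in> columns) \<Longrightarrow> sum f I \<in> columns"
  by (induction I rule: infinite_finite_induct) (auto intro: columns_add columns_zero)

lemma columns_scaleC:
  assumes "t \<in> columns"
  shows "scaleC c t \<in> columns"
proof -
  obtain g K where "\<forall>k. g k \<in> matrix_units k 0" "\<forall>N\<ge>K. t = (\<Sum>k<N. g k)"
    using assms unfolding columns_def by blast
  then have "(\<forall>k. scaleC c (g k) \<in> matrix_units k 0) \<and> (\<forall>N\<ge>K. scaleC c t = (\<Sum>k<N. scaleC c (g k)))"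
    by (auto simp: matrix_units_scaleC scaleC_sum_right)
  then show ?thesis unfolding columns_def by (intro CollectI exI[of _ "\<lambda>k. scaleC c (g k)"]) blast
qed

lemma word_in_columns:
  assumes "\<mu> \<in> cuntz_words n"
  shows "s \<mu> \<in> columns"
proof -
  let ?g = "\<lambda>k. if k = length \<mu> then s \<mu> else 0"
  have "(\<forall>k. ?g k \<in> matrix_units k 0) \<and> (\<forall>N\<ge>Suc (length \<mu>). s \<mu> = (\<Sum>k<N. ?g k))"
    using column_in_matrix_units[OF in_words_lengthI[OF assms]] by auto
  then show ?thesis unfolding columns_def by (intro CollectI exI[of _ ?g]) blast
qed

text \<open>Averaging leaves only the products of columns of equal length, and these are scalar. So
  \<open>spectral 0 0 (star t * u)\<close> is an inner product on the span of the words.\<close>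

lemma spectral_star_mult_columns:
  assumes "t \<in> columns" "u \<in> columns"
  shows "spectral 0 0 (star t * u) \<in> matrix_units 0 0"
    and "\<exists>r\<ge>0. spectral 0 0 (star t * t) = scaleC (of_real r) 1"
proof -
  have expand: "spectral 0 0 (star (\<Sum>k<N. g k) * (\<Sum>k<N. h k)) = (\<Sum>k<N. star (g k) * h k)"
    if gh: "\<forall>k. g k \<in> matrix_units k 0" "\<forall>k. h k \<in> matrix_units k 0" for g h and N :: nat
  proof -
    have "spectral 0 0 (star (g k) * h l) = (if l = k then star (g k) * h k else 0)" for k l
    proof -
      have "g k \<in> degree (int k)" "h l \<in> degree (int l)"
        using gh matrix_units_degree[of _ _ 0] by auto
      then have "star (g k) * h l \<in> degree (- int k + int l)" by (intro degree_mult degree_star)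
      then show ?thesis by (auto simp: spectral_degree)
    qed
    then show ?thesis by (simp add: star_sum sum_product spectral_sum)
  qed
  obtain g K h M where g: "\<forall>k. g k \<in> matrix_units k 0" and h: "\<forall>k. h k \<in> matrix_units k 0"
    and tu: "\<forall>N\<ge>K. t = (\<Sum>k<N. g k)" "\<forall>N\<ge>M. u = (\<Sum>k<N. h k)"
    using assms unfolding columns_def by blast
  have "t = (\<Sum>k<max K M. g k)" "u = (\<Sum>k<max K M. h k)" using tu by auto
  then have "spectral 0 0 (star t * u) = (\<Sum>k<max K M. star (g k) * h k)"
    using expand[OF g h] by simp
  then show "spectral 0 0 (star t * u) \<in> matrix_units 0 0"
    using g h by (auto intro!: matrix_units_sum matrix_units_mult matrix_units_star)
  have "t = (\<Sum>k<K. g k)" using tu(1) by simp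
  then have "spectral 0 0 (star t * t) = (\<Sum>k<K. star (g k) * g k)"
    using expand[OF g g, of K] by simp
  also have "\<dots> = scaleC (of_real (\<Sum>k<K. (norm (g k))\<^sup>2)) 1"
    using star_mult_column[OF g[rule_format]] by (simp add: scaleC_sum_left)
  finally show "\<exists>r\<ge>0. spectral 0 0 (star t * t) = scaleC (of_real r) 1"
    by (meson sum_nonneg zero_le_power2)
qed

text \<open>Finite sums of monomials are of this kind: a factor \<open>star (s \<alpha>)\<close> is
  absorbed by every word at least as long as \<open>\<alpha>\<close>, which leaves combinations of
  words.\<close>

definition column_finite :: "'a set" where
  "column_finite = {p. \<exists>L0. \<forall>L\<ge>L0. \<forall>\<nu>\<in>words_of_length L. p * s \<nu> \<in> columns}"

lemma dense_column_finite: "x \<in> closure column_finite"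
proof (rule dense_monomials)
  have add: "x + y \<in> column_finite" if xy: "x \<in> column_finite" "y \<in> column_finite" for x y
  proof -
    obtain K where K: "\<forall>L\<ge>K. \<forall>\<nu>\<in>words_of_length L. x * s \<nu> \<in> columns"
      using xy(1) unfolding column_finite_def by blast
    obtain M where M: "\<forall>L\<ge>M. \<forall>\<nu>\<in>words_of_length L. y * s \<nu> \<in> columns"
      using xy(2) unfolding column_finite_def by blast
    have "\<forall>L\<ge>max K M. \<forall>\<nu>\<in>words_of_length L. (x + y) * s \<nu> \<in> columns"
      using K M by (auto simp: distrib_right intro!: columns_add)
    then show ?thesis unfolding column_finite_def by blast
  qed
  show "x + y \<in> closure column_finite" if "x \<in> closure column_finite" "y \<in> closure column_finite" for x y
    using closure_add_closed[OF add that] .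
  have "0 \<in> column_finite" by (simp add: column_finite_def columns_zero)
  then show "0 \<in> closure column_finite" using closure_subset by blast
  have "monomials \<subseteq> column_finite"
  proof
    fix x assume "x \<in> monomials"
    then obtain c \<mu> \<nu> where x: "x = scaleC c (s \<mu> * star (s \<nu>))" "\<mu> \<in> cuntz_words n" "\<nu> \<in> cuntz_words n"
      unfolding monomials_def by blast
    have "x * s \<alpha> \<in> columns" if "L \<ge> length \<nu>" "\<alpha> \<in> words_of_length L" for L \<alpha>
    proof -
      have eq: "x * s \<alpha> = scaleC c (s \<mu> * (star (s \<nu>) * s \<alpha>))" by (simp add: x(1) scaleC_mult_left mult.assoc)
      have "star (s \<nu>) * s \<alpha> = 0 \<or> (\<exists>\<delta>\<in>cuntz_words n. star (s \<nu>) * s \<alpha> = s \<delta>)"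
        using star_word_mult_longer_word[OF x(3)] words_lengthD[OF that(2)] that(1) by auto
      then show ?thesis
      proof
        assume "\<exists>\<delta>\<in>cuntz_words n. star (s \<nu>) * s \<alpha> = s \<delta>"
        then obtain \<delta> where "\<delta> \<in> cuntz_words n" "star (s \<nu>) * s \<alpha> = s \<delta>" by blast
        moreover then have "\<mu> @ \<delta> \<in> cuntz_words n" using x(2) by (auto simp: cuntz_words_def)
        ultimately show ?thesis
          using word_in_columns[of "\<mu> @ \<delta>"] by (simp add: eq columns_scaleC word_prod_append)
      qed (simp add: eq columns_zero)
    qed
    then show "x \<in> column_finite" unfolding column_finite_def by blast
  qed
  then show "monomials \<subseteq> closure column_finite" using closure_subset by blast
qed simp

text \<open>For self-adjoint \<open>h\<close>, the bound \<open>norm (R - h) \<le> R\<close>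
  expresses positivity in a form that survives limits. For \<open>p\<close> in
  \<open>column_finite\<close> the average \<open>h\<close> of \<open>star p * p\<close> is a
  matrix: its entry at \<open>\<mu>\<close>, \<open>\<nu>\<close> is the inner product of
  \<open>p * s \<mu>\<close> and \<open>p * s \<nu>\<close>. Hence
  \<open>norm_le_if_form_bounded\<close> applies to \<open>R - h\<close>.\<close>

lemma norm_diff_spectral_star_mult_self:
  "norm (scaleC (of_real ((norm x)\<^sup>2)) 1 - spectral 0 0 (star x * x)) \<le> (norm x)\<^sup>2"
proof -
  let ?W = "{x. norm (scaleC (of_real ((norm x)\<^sup>2)) 1 - spectral 0 0 (star x * x)) \<le> (norm x)\<^sup>2}"
  have "column_finite \<subseteq> ?W"
  proof
    fix p assume "p \<in> column_finite"
    then obtain L where L: "\<And>\<nu>. \<nu> \<in> words_of_length L \<Longrightarrow> p * s \<nu> \<in> columns"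
      unfolding column_finite_def by blast
    define h where "h = spectral 0 0 (star p * p)"
    define R where "R = (norm p)\<^sup>2"
    have sandwich: "star v * h * u = spectral 0 0 (star (p * v) * (p * u))"
      if "u \<in> degree (int L)" "v \<in> degree (int L)" for u v
    proof -
      have "spectral 0 0 (star v * (star p * p) * u) = spectral 0 (0 - int L) (star v * (star p * p)) * u"
        by (rule spectral_mult_right[OF that(1)])
      also have "\<dots> = star v * h * u"
        using spectral_mult_left[OF degree_star[OF that(2)], of 0 "- int L" "star p * p"] by (simp add: h_def)
      finally show ?thesis by (simp add: star_mult mult.assoc)
    qed
    have h: "h \<in> matrix_units L L"
      unfolding matrix_units_def
    proof (intro CollectI ballI)
      fix \<mu> \<nu> assume w: "\<mu> \<in> words_of_length L" "\<nu> \<in> words_of_length L"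
      then have "s \<mu> \<in> degree (int L)" "s \<nu> \<in> degree (int L)"
        using degree_word words_lengthD by blast+
      then show "\<exists>c. star (s \<mu>) * h * s \<nu> = scaleC c 1"
        using sandwich scalar_of_matrix_units_0 spectral_star_mult_columns(1) L w by metis
    qed
    have hs: "star h = h"
      using spectral_star[of 0 0 "star p * p"] by (simp add: h_def star_mult star_star)
    define g where "g = scaleC (of_real R) 1 - h"
    have "norm g \<le> R"
    proof (rule norm_le_if_form_bounded)
      show "g \<in> matrix_units L L"
        unfolding g_def by (intro matrix_units_diff h scalar_in_matrix_units)
      show "star g = g" by (simp add: g_def star_diff star_scaleC hs)
      show "R \<ge> 0" by (simp add: R_def)
      fix u assume u: "u \<in> matrix_units L 0"
      have ud: "u \<in> degree (int L)" using matrix_units_degree[OF u] by simp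
      obtain f where f: "u = (\<Sum>\<mu>\<in>words_of_length L. \<Sum>\<nu>\<in>words_of_length 0. scaleC (f \<mu> \<nu>) (s \<mu> * star (s \<nu>)))"
        by (rule matrix_units_expand[OF u]) (rule that)
      have "p * u = (\<Sum>\<mu>\<in>words_of_length L. scaleC (f \<mu> []) (p * s \<mu>))"
        unfolding f by (simp add: sum_distrib_left scaleC_mult_right)
      then have "p * u \<in> columns" by (simp add: columns_sum columns_scaleC L)
      then obtain r where r: "r \<ge> 0" "spectral 0 0 (star (p * u) * (p * u)) = scaleC (of_real r) 1"
        using spectral_star_mult_columns(2) by blast
      \<comment> \<open>Contractivity of the average bounds the form of \<open>h\<close> from above,
        which makes the form of \<open>R - h\<close> nonnegative.\<close>
      have "r \<le> norm (star (p * u) * (p * u))"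
        using norm_spectral[of 0 0 "star (p * u) * (p * u)"] r by (simp add: norm_scaleC)
      also have "\<dots> \<le> R * (norm u)\<^sup>2"
        unfolding cstar_identity R_def power_mult_distrib[symmetric]
        by (intro power_mono norm_mult_ineq) simp
      finally have rR: "r \<le> R * (norm u)\<^sup>2" .
      have "star u * g * u = scaleC (of_real R) (star u * u) - star u * h * u"
        by (simp add: g_def algebra_simps scaleC_mult_left scaleC_mult_right)
      also have "\<dots> = scaleC (of_real (R * (norm u)\<^sup>2 - r)) 1"
        unfolding sandwich[OF ud ud] r(2) star_mult_column[OF u]
        by (simp add: scaleC_scaleC scaleC_diff_left)
      finally show "\<exists>r. star u * g * u = scaleC (of_real r) 1 \<and> 0 \<le> r \<and> r \<le> R * (norm u)\<^sup>2"
        using r(1) rR by (intro exI[of _ "R * (norm u)\<^sup>2 - r"]) simp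
    qed
    then show "p \<in> ?W" by (simp add: g_def h_def R_def)
  qed
  moreover have "closed ?W"
    unfolding scaleC_of_real
    by (intro closed_Collect_le continuous_intros bounded_linear.continuous_on[OF bounded_linear_spectral] continuous_on_star)
  ultimately have "closure column_finite \<subseteq> ?W" by (rule closure_minimal)
  then show ?thesis using dense_column_finite[of x] by blast
qed

text \<open>With \<open>R = (norm x)\<^sup>2\<close>, the norm form of positivity gives
  \<open>h / R = 1 - g\<close> with \<open>norm g \<le> 1\<close>, and the square root iteration
  stays among the self-adjoint elements of degree 0.\<close>

lemma spectral_positive_circle: "positive_in (degree 0) (spectral 0 0 (star x * x))"
proof (cases "x = 0")
  case True
  then show ?thesis unfolding positive_in_def by (intro bexI[of _ 0]) simp_all
next
  case False
  define R where "R = (norm x)\<^sup>2"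
  have R: "R > 0" using False by (simp add: R_def)
  define h where "h = spectral 0 0 (star x * x)"
  have hs: "star h = h"
    using spectral_star[of 0 0 "star x * x"] by (simp add: h_def star_mult star_star)
  have h0: "h \<in> degree 0" by (simp add: h_def spectral_in_degree)
  define g where "g = 1 - scaleR (1 / R) h"
  have "g = scaleR (1 / R) (scaleC (of_real R) 1 - h)"
    using R by (simp add: g_def scaleR_diff_right scaleC_of_real)
  then have "norm g \<le> 1"
    using norm_diff_spectral_star_mult_self[of x] R by (simp add: R_def h_def)
  let ?X = "degree 0 \<inter> {y. star y = y}"
  have scR: "scaleR t y \<in> degree 0" if "y \<in> degree 0" for t y
    using degree_scaleC[OF that, of "of_real t"] by (simp add: scaleC_of_real)
  have gX: "g \<in> ?X"
    by (simp add: g_def star_diff star_scaleR hs degree_diff degree_one scR h0)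
  obtain y where y: "y \<in> ?X" "(1 - y) * (1 - y) = 1 - g"
  proof (rule one_minus_square_root[OF \<open>norm g \<le> 1\<close>])
    show "closed ?X"
      by (intro closed_Int closed_degree closed_Collect_eq continuous_on_star continuous_on_id)
    fix y assume "y \<in> ?X"
    then show "scaleR (1 / 2) (g + y * y) \<in> ?X"
      using gX degree_mult[of y 0 y 0] by (auto simp: star_scaleR star_add star_mult intro!: scR degree_add)
  qed auto
  define z where "z = scaleR (sqrt R) (1 - y)"
  have "star z * z = scaleR R ((1 - y) * (1 - y))"
    using y(1) R by (simp add: z_def star_scaleR star_diff)
  also have "\<dots> = h" using R by (simp add: y(2) g_def)
  finally have "h = star z * z" by simp
  moreover have "z \<in> degree 0" using y(1) by (simp add: z_def scR degree_diff degree_one)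
  ultimately show ?thesis unfolding positive_in_def h_def by blast
qed

lemma degree_0_eq_fixed: "degree 0 = {x. spectral 0 0 x = x}"
  using spectral_degree[of _ 0 0 0] spectral_in_degree[of 0] by auto metis

lemma conditional_expectation_spectral:
  assumes "n \<ge> 2"
  shows "conditional_expectation UNIV (cuntz_sub n S m) (spectral m 0)"
proof -
  have "positive_in {x. spectral m 0 x = x} (spectral m 0 x)" if "positive_in UNIV x" for x
    using that spectral_positive_finite[OF assms, of m] spectral_positive_circle degree_0_eq_fixed
    by (cases "m = 0") (auto simp: positive_in_def)
  moreover have "spectral m 0 (d * x) = d * spectral m 0 x \<and> spectral m 0 (x * d) = spectral m 0 x * d"
    if "spectral m 0 d = d" for d x
    using spectral_mult_spectral_left[of m 0 0 d x] spectral_mult_spectral_right[of m 0 0 x d] that by simp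
  ultimately show ?thesis
    unfolding conditional_expectation_def cuntz_sub_eq
    by (auto simp: spectral_spectral spectral_add spectral_scaleC norm_spectral)
qed

end

section \<open>Diagonal matrices\<close>

context cuntz_family
begin

definition diagonal :: "nat \<Rightarrow> (nat list \<Rightarrow> complex) \<Rightarrow> 'a" where
  "diagonal L c = (\<Sum>\<mu>\<in>words_of_length L. scaleC (c \<mu>) (s \<mu> * star (s \<mu>)))"

lemma diagonal_mult: "diagonal L c * diagonal L d = diagonal L (\<lambda>\<mu>. c \<mu> * d \<mu>)"
proof -
  have "diagonal L c * diagonal L d = (\<Sum>\<mu>\<in>words_of_length L. \<Sum>\<nu>\<in>words_of_length L.
      if \<nu> = \<mu> then scaleC (c \<mu> * d \<mu>) (s \<mu> * star (s \<mu>)) else 0)"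
    unfolding diagonal_def sum_product
  proof (intro sum.cong refl)
    fix \<mu> \<nu> assume w: "\<mu> \<in> words_of_length L" "\<nu> \<in> words_of_length L"
    have "scaleC (c \<mu>) (s \<mu> * star (s \<mu>)) * scaleC (d \<nu>) (s \<nu> * star (s \<nu>))
        = scaleC (c \<mu> * d \<nu>) (s \<mu> * (star (s \<mu>) * s \<nu>) * star (s \<nu>))"
      by (simp add: scaleC_mult_left scaleC_mult_right scaleC_scaleC mult.assoc mult.commute)
    then show "scaleC (c \<mu>) (s \<mu> * star (s \<mu>)) * scaleC (d \<nu>) (s \<nu> * star (s \<nu>))
        = (if \<nu> = \<mu> then scaleC (c \<mu> * d \<mu>) (s \<mu> * star (s \<mu>)) else 0)"
      by (auto simp: words_orthogonal[OF w])
  qed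
  also have "\<dots> = diagonal L (\<lambda>\<mu>. c \<mu> * d \<mu>)" by (simp add: diagonal_def)
  finally show ?thesis .
qed

lemma diagonal_star: "star (diagonal L c) = diagonal L (\<lambda>\<mu>. cnj (c \<mu>))"
  by (simp add: diagonal_def star_sum star_scaleC star_mult star_star)

lemma diagonal_one: "diagonal L (\<lambda>\<mu>. 1) = 1"
  by (simp add: diagonal_def sum_words_projections)

lemma diagonal_diff: "diagonal L c - diagonal L d = diagonal L (\<lambda>\<mu>. c \<mu> - d \<mu>)"
  by (simp add: diagonal_def scaleC_diff_left sum_subtractf)

lemma diagonal_cong: "(\<And>\<mu>. \<mu> \<in> words_of_length L \<Longrightarrow> c \<mu> = d \<mu>) \<Longrightarrow> diagonal L c = diagonal L d"
  by (simp add: diagonal_def)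

lemma diagonal_power: "diagonal L c ^ m = diagonal L (\<lambda>\<mu>. c \<mu> ^ m)"
  by (induction m) (simp_all add: diagonal_one diagonal_mult)

text \<open>The triangle inequality loses the number of words as a factor. Applied to the powers of
  \<open>star d * d\<close> for \<open>d = diagonal L c\<close>, which are again diagonal, it loses
  nothing by \<open>power_bounded_self_adjoint\<close>.\<close>

lemma norm_diagonal_le:
  assumes R: "R \<ge> 0" and c: "\<And>\<mu>. \<mu> \<in> words_of_length L \<Longrightarrow> cmod (c \<mu>) \<le> R"
  shows "norm (diagonal L c) \<le> R"
proof -
  have triv: "norm (diagonal L d) \<le> real (card (words_of_length L)) * M"
    if "\<And>\<mu>. \<mu> \<in> words_of_length L \<Longrightarrow> cmod (d \<mu>) \<le> M" for d M
  proof -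
    have "norm (diagonal L d) \<le> (\<Sum>\<mu>\<in>words_of_length L. M)"
      unfolding diagonal_def
    proof (rule sum_norm_le)
      fix \<mu> assume \<mu>: "\<mu> \<in> words_of_length L"
      then have "norm (s \<mu>) = 1" using words_lengthD by auto
      then show "norm (scaleC (d \<mu>) (s \<mu> * star (s \<mu>))) \<le> M"
        using that[OF \<mu>] by (simp add: norm_scaleC norm_mult_star)
    qed
    then show ?thesis by simp
  qed
  define h where "h = star (diagonal L c) * diagonal L c"
  have h: "h = diagonal L (\<lambda>\<mu>. cnj (c \<mu>) * c \<mu>)" by (simp add: h_def diagonal_star diagonal_mult)
  have "norm h \<le> R\<^sup>2"
  proof (rule power_bounded_self_adjoint)
    show "star h = h" by (simp add: h_def star_mult star_star)
    show "norm (h ^ m) \<le> real (card (words_of_length L)) * (R\<^sup>2) ^ m" for m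
      unfolding h diagonal_power
    proof (rule triv)
      fix \<mu> assume "\<mu> \<in> words_of_length L"
      then have "cmod (c \<mu>) * cmod (c \<mu>) \<le> R * R" using c R by (intro mult_mono) auto
      then show "cmod ((cnj (c \<mu>) * c \<mu>) ^ m) \<le> (R\<^sup>2) ^ m"
        by (simp add: norm_power norm_mult power2_eq_square power_mono)
    qed
  qed simp
  then have "(norm (diagonal L c))\<^sup>2 \<le> R\<^sup>2" by (simp add: h_def cstar_identity)
  then show ?thesis by (rule power2_le_imp_le) (rule R)
qed

end

context gauged_cuntz_family
begin

text \<open>The degree \<open>k\<close> component of a monomial is the monomial itself or 0, hence a
  matrix of shape \<open>(L + k, L)\<close> for some \<open>L\<close>; raising levels makes the
  union over \<open>L\<close> additive.\<close>

lemma approximate_degree: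
  assumes x: "x \<in> degree (int k)" and e: "e > 0"
  obtains L f where "f \<in> matrix_units (L + k) L" "norm (x - f) < e"
proof -
  define U where "U = (\<Union>L. matrix_units (L + k) L)"
  have add: "x + y \<in> U" if xy: "x \<in> U" "y \<in> U" for x y
  proof -
    obtain L M where "x \<in> matrix_units (L + k) L" "y \<in> matrix_units (M + k) M"
      using xy unfolding U_def by blast
    then have "x \<in> matrix_units (max L M + k) (max L M)" "y \<in> matrix_units (max L M + k) (max L M)"
      using matrix_units_raise[of x "L + k" L "max L M - L"] matrix_units_raise[of y "M + k" M "max L M - M"]
      by (simp_all add: add.commute add.left_commute)
    then show ?thesis unfolding U_def using matrix_units_add by blast
  qed
  have U0: "0 \<in> U" by (simp add: U_def)
  have "x \<in> {x. spectral 0 (int k) x \<in> closure U}" for x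
  proof (rule dense_monomials)
    have "closed (spectral 0 (int k) -` closure U)"
      by (rule closed_vimage[OF closed_closure linear_continuous_on[OF bounded_linear_spectral]])
    then show "closed {x. spectral 0 (int k) x \<in> closure U}" by (simp add: vimage_def)
    show "monomials \<subseteq> {x. spectral 0 (int k) x \<in> closure U}"
    proof
      fix x assume "x \<in> monomials"
      then obtain c \<mu> \<nu> where m: "x = scaleC c (s \<mu> * star (s \<nu>))" "\<mu> \<in> cuntz_words n" "\<nu> \<in> cuntz_words n"
        unfolding monomials_def by blast
      have "x \<in> U" if "length \<mu> = length \<nu> + k"
        using matrix_units_scaleC[OF monomial_in_matrix_units[OF in_words_lengthI[OF m(2)] in_words_lengthI[OF m(3)]], of c] that
        by (auto simp: U_def m(1))
      moreover have "x \<in> degree (int (length \<mu>) - int (length \<nu>))"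
        unfolding m(1) by (intro degree_scaleC degree_monomial m)
      ultimately have "spectral 0 (int k) x \<in> U" using U0 by (auto simp: spectral_degree)
      then show "x \<in> {x. spectral 0 (int k) x \<in> closure U}" using closure_subset by blast
    qed
    show "0 \<in> {x. spectral 0 (int k) x \<in> closure U}" using U0 closure_subset by auto
  qed (use closure_add_closed[OF add] in \<open>simp add: spectral_add\<close>)
  then have "x \<in> closure U" using x by (metis dvd_0_right diff_self mem_Collect_eq spectral_degree)
  then obtain f where "f \<in> U" "dist f x < e" using e unfolding closure_approachable by blast
  then show ?thesis using that by (auto simp: U_def dist_norm norm_minus_commute)
qed

lemma approximate_degree_0:
  assumes "x \<in> degree 0" "e > 0"
  obtains L f where "f \<in> matrix_units L L" "norm (x - f) < e"
  using approximate_degree[of x 0 e] assms by (metis add_0_right of_nat_0)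

text \<open>For \<open>j \<ge> 0\<close> an isometry \<open>s \<mu>\<close> keeps \<open>x\<close>
  nonzero. For \<open>j < 0\<close> the range projections of the words of length \<open>- j\<close>
  sum to 1, so some \<open>star (s \<mu>) * x\<close> is nonzero.\<close>

lemma degree_mult_nonzero:
  assumes n: "n \<ge> 1" and x: "x \<noteq> 0"
  obtains y where "y \<in> degree j" "y * x \<noteq> 0"
proof (cases "j \<ge> 0")
  case True
  define \<mu> where "\<mu> = replicate (nat j) (1::nat)"
  have \<mu>: "\<mu> \<in> cuntz_words n" using n by (auto simp: \<mu>_def cuntz_words_def)
  have "star (s \<mu>) * (s \<mu> * x) = x" using word_isometry[OF \<mu>] by (simp add: mult.assoc[symmetric])
  then have "s \<mu> * x \<noteq> 0" using x by auto
  then show ?thesis using that degree_word[OF \<mu>] True by (simp add: \<mu>_def)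
next
  case False
  define a where "a = nat (- j)"
  have "\<exists>\<mu>\<in>words_of_length a. star (s \<mu>) * x \<noteq> 0"
  proof (rule ccontr)
    assume "\<not> ?thesis"
    then have "(\<Sum>\<mu>\<in>words_of_length a. s \<mu> * (star (s \<mu>) * x)) = 0" by simp
    then show False using expand_left[of x a] x by simp
  qed
  then obtain \<mu> where \<mu>: "\<mu> \<in> words_of_length a" "star (s \<mu>) * x \<noteq> 0" by blast
  have "star (s \<mu>) \<in> degree (- int (length \<mu>))"
    using words_lengthD[OF \<mu>(1)] by (intro degree_star degree_word) simp
  then show ?thesis using that \<mu> words_lengthD[OF \<mu>(1)] False by (simp add: a_def)
qed

end

section \<open>Intermediate algebras in which the diagonal is a Cartan subalgebra\<close>

lemma conditional_expectation_diff:
  assumes E: "conditional_expectation B D E" and B: "cstar_subalgebra B" and xy: "x \<in> B" "y \<in> B"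
  shows "E (x - y) = E x - E y"
proof -
  have "E (x + scaleC (-1) y) = E x + scaleC (-1) (E y)"
    using E xy cstar_subalgebra_scaleC[OF B xy(2)] unfolding conditional_expectation_def by metis
  then show ?thesis by (simp add: scaleC_minus_left)
qed

locale cartan_intermediate = gauged_cuntz_family n S \<tau> for n and S :: "nat \<Rightarrow> 'a::cstar_algebra_1" and \<tau> +
  fixes B :: "'a set"
  assumes n2: "n \<ge> 2"
    and B: "cstar_subalgebra B"
    and gauge_fixed_subset: "gauge_fixed \<tau> \<subseteq> B"
    and cartan: "cartan_subalgebra (cuntz_diagonal n S) B"
begin

abbreviation D :: "'a set" where
  "D \<equiv> cuntz_diagonal n S"

lemma degree_0_subset: "degree 0 \<subseteq> B"
  using gauge_fixed_subset by (simp add: degree_0_eq)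

lemma D: "cstar_subalgebra D"
  using cartan by (simp add: cartan_subalgebra_def)

lemma D_subset: "D \<subseteq> B"
  using cartan by (simp add: cartan_subalgebra_def)

lemma D_commute: "x \<in> D \<Longrightarrow> y \<in> D \<Longrightarrow> x * y = y * x"
  using cartan by (simp add: cartan_subalgebra_def)

lemma projection_in_D: "\<mu> \<in> cuntz_words n \<Longrightarrow> s \<mu> * star (s \<mu>) \<in> D"
  unfolding cuntz_diagonal_def cstar_generated_def by (rule hull_inc) blast

lemma one_in_D: "1 \<in> D"
  using projection_in_D[of "[]"] by (simp add: cuntz_words_def)

lemma diagonal_in_D: "diagonal L c \<in> D"
  unfolding diagonal_def
  by (intro cstar_subalgebra_sum[OF D] cstar_subalgebra_scaleC[OF D] projection_in_D) (simp add: words_lengthD)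

lemma D_degree_0: "D \<subseteq> degree 0"
  unfolding cuntz_diagonal_def cstar_generated_def
proof (rule hull_minimal)
  show "{s \<mu> * star (s \<mu>) | \<mu>. \<mu> \<in> cuntz_words n} \<subseteq> degree 0"
    using degree_monomial by fastforce
qed (rule cstar_subalgebra_degree_0)

lemma matrix_units_degree_0: "f \<in> matrix_units L L \<Longrightarrow> f \<in> degree 0"
  using matrix_units_degree by fastforce

text \<open>\<open>E f\<close> lies in the commutative \<open>D\<close>, so
  \<open>p * E f = p * E f * p = E (p * f * p)\<close> for each word projection \<open>p\<close>,
  and \<open>p * f * p\<close> is a multiple of \<open>p\<close>. Thus every expectation onto
  \<open>D\<close> compresses matrices to their diagonal.\<close>

lemma expectation_matrix_units:
  assumes E: "conditional_expectation B D E" and f: "f \<in> matrix_units L L"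
    and c: "\<And>\<mu>. \<mu> \<in> words_of_length L \<Longrightarrow> star (s \<mu>) * f * s \<mu> = scaleC (c \<mu>) 1"
  shows "E f = diagonal L c"
proof -
  have fB: "f \<in> B" using matrix_units_degree_0[OF f] degree_0_subset by blast
  have ED: "E x \<in> D" if "x \<in> B" for x using E that by (simp add: conditional_expectation_def)
  have Ebi: "E (d * x) = d * E x" "E (x * d) = E x * d" if "x \<in> B" "d \<in> D" for x d
    using E that by (simp_all add: conditional_expectation_def)
  have "E f = (\<Sum>\<mu>\<in>words_of_length L. s \<mu> * star (s \<mu>)) * E f" by (simp add: sum_words_projections)
  also have "\<dots> = (\<Sum>\<mu>\<in>words_of_length L. (s \<mu> * star (s \<mu>)) * E f)" by (simp add: sum_distrib_right)
  also have "\<dots> = diagonal L c"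
    unfolding diagonal_def
  proof (rule sum.cong[OF refl])
    fix \<mu> assume \<mu>: "\<mu> \<in> words_of_length L"
    define p where "p = s \<mu> * star (s \<mu>)"
    have p: "p \<in> D" using projection_in_D words_lengthD[OF \<mu>] by (simp add: p_def)
    have "p * p = s \<mu> * (star (s \<mu>) * s \<mu>) * star (s \<mu>)" by (simp add: p_def mult.assoc)
    then have pp: "p * p = p" using word_isometry words_lengthD[OF \<mu>] by (simp add: p_def)
    have pfp: "p * f * p = scaleC (c \<mu>) p"
    proof -
      have "p * f * p = s \<mu> * (star (s \<mu>) * f * s \<mu>) * star (s \<mu>)" by (simp add: p_def mult.assoc)
      then show ?thesis by (simp add: c[OF \<mu>] p_def mult_scaleC_1 scaleC_mult_left)
    qed
    have pf: "p * f \<in> B" using p fB D_subset cstar_subalgebra_mult[OF B] by blast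
    have "p * E f = p * p * E f" by (simp add: pp)
    also have "\<dots> = p * E f * p" using D_commute[OF p ED[OF fB]] by (metis mult.assoc)
    also have "\<dots> = E (p * f * p)" using Ebi(2)[OF pf p] Ebi(1)[OF fB p] by simp
    also have "\<dots> = scaleC (c \<mu>) p"
      unfolding pfp using E cstar_subalgebra_scaleC[OF D p] by (simp add: conditional_expectation_def)
    finally show "s \<mu> * star (s \<mu>) * E f = scaleC (c \<mu>) (s \<mu> * star (s \<mu>))" by (simp add: p_def)
  qed
  finally show ?thesis .
qed

lemma matrix_units_diagonal_coefficients:
  assumes "f \<in> matrix_units L L"
  obtains c where "\<And>\<mu>. \<mu> \<in> words_of_length L \<Longrightarrow> star (s \<mu>) * f * s \<mu> = scaleC (c \<mu>) 1"
proof -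
  have "\<forall>\<mu>\<in>words_of_length L. \<exists>c. star (s \<mu>) * f * s \<mu> = scaleC c 1"
    using assms by (simp add: matrix_units_def)
  then show ?thesis using that by metis
qed

lemma words_nonempty: "words_of_length L \<noteq> {}"
  using n2 by (auto simp: words_of_length_def intro!: exI[of _ "replicate L 1"])

text \<open>\<open>\<delta>\<close> is the norm of the image of \<open>h\<close> under the faithful expectation onto \<open>D\<close>.\<close>

lemma diagonal_entry_lower_bound:
  assumes h: "h \<in> degree 0" "positive_in B h" "h \<noteq> 0"
  obtains \<delta> where "\<delta> > 0"
    "\<And>L f e. f \<in> matrix_units L L \<Longrightarrow> norm (h - f) \<le> e \<Longrightarrow>
       \<exists>\<alpha>\<in>words_of_length L. \<exists>c. star (s \<alpha>) * f * s \<alpha> = scaleC c 1 \<and> \<delta> - e \<le> cmod c"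
proof -
  obtain E where E: "conditional_expectation B D E" and faith: "faithful_on B E"
    using cartan unfolding cartan_subalgebra_def by blast
  have hB: "h \<in> B" using h(1) degree_0_subset by blast
  show ?thesis
  proof
    show "norm (E h) > 0" using faith h(2,3) unfolding faithful_on_def by auto
    fix L f e assume f: "f \<in> matrix_units L L" and e: "norm (h - f) \<le> e"
    obtain c where c: "\<And>\<mu>. \<mu> \<in> words_of_length L \<Longrightarrow> star (s \<mu>) * f * s \<mu> = scaleC (c \<mu>) 1"
      using matrix_units_diagonal_coefficients[OF f] by blast
    have fB: "f \<in> B" using matrix_units_degree_0[OF f] degree_0_subset by blast
    have "norm (E h - E f) \<le> norm (h - f)"
      using conditional_expectation_diff[OF E B hB fB] E cstar_subalgebra_diff[OF B hB fB]
      unfolding conditional_expectation_def by metis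
    then have Ef: "norm (E h) - e \<le> norm (E f)"
      using e norm_triangle_ineq2[of "E h" "E f"] by linarith
    \<comment> \<open>The norm of a diagonal matrix is at most its largest entry, so the position
      \<open>\<alpha>\<close> of that entry inherits the lower bound on
      \<open>norm (E f)\<close>.\<close>
    define M where "M = Max ((\<lambda>\<mu>. cmod (c \<mu>)) ` words_of_length L)"
    have "M \<in> (\<lambda>\<mu>. cmod (c \<mu>)) ` words_of_length L"
      unfolding M_def using words_nonempty by (intro Max_in) auto
    then obtain \<alpha> where \<alpha>: "\<alpha> \<in> words_of_length L" "cmod (c \<alpha>) = M" by auto
    have "E f = diagonal L c" by (rule expectation_matrix_units[OF E f]) (rule c)
    moreover have "norm (diagonal L c) \<le> M"
    proof (rule norm_diagonal_le)
      show "M \<ge> 0" using \<alpha>(2) by (metis norm_ge_zero)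
    qed (simp add: M_def)
    ultimately show "\<exists>\<alpha>\<in>words_of_length L. \<exists>d. star (s \<alpha>) * f * s \<alpha> = scaleC d 1 \<and> norm (E h) - e \<le> cmod d"
      using \<alpha> c[OF \<alpha>(1)] Ef by (intro bexI[of _ \<alpha>] exI[of _ "c \<alpha>"]) auto
  qed
qed

text \<open>A matrix near \<open>a\<close> need not be diagonal, but an expectation onto
  \<open>D\<close> fixes \<open>a\<close>, is contractive and makes the matrix diagonal.\<close>

lemma approximate_D:
  assumes a: "a \<in> D" and e: "e > 0"
  obtains L c where "norm (a - diagonal L c) < e"
proof -
  obtain E where E: "conditional_expectation B D E"
    using cartan unfolding cartan_subalgebra_def by blast
  have "a \<in> degree 0" using a D_degree_0 by auto
  then obtain L f where f: "f \<in> matrix_units L L" "norm (a - f) < e"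
    using approximate_degree_0[OF _ e] by blast
  have aB: "a \<in> B" and fB: "f \<in> B"
    using a D_subset matrix_units_degree_0[OF f(1)] degree_0_subset by auto
  obtain c where c: "\<And>\<mu>. \<mu> \<in> words_of_length L \<Longrightarrow> star (s \<mu>) * f * s \<mu> = scaleC (c \<mu>) 1"
    using matrix_units_diagonal_coefficients[OF f(1)] by blast
  have "norm (E a - E f) \<le> norm (a - f)"
    using conditional_expectation_diff[OF E B aB fB] E cstar_subalgebra_diff[OF B aB fB]
    unfolding conditional_expectation_def by metis
  moreover have "E a = a" using E a by (simp add: conditional_expectation_def)
  moreover have "E f = diagonal L c" by (rule expectation_matrix_units[OF E f(1)]) (rule c)
  ultimately show ?thesis using that[of L c] f(2) by simp
qed

text \<open>Since \<open>y\<close> moves the degree by \<open>i\<close>, it maps the cylinder of \<open>\<alpha> @ 1\<^sup>i 2\<close> off itself up to a small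
  error, whereas an element that commutes with the diagonal leaves every cylinder invariant.\<close>

lemma zero_if_commutes_with_D_pos:
  assumes i: "i > 0" and y: "y \<in> degree (int i)" and comm: "\<And>d. d \<in> D \<Longrightarrow> d * y = y * d"
  shows "y = 0"
proof (rule ccontr)
  assume "y \<noteq> 0"
  define h where "h = y * star y"
  have h0: "h \<in> degree 0" using degree_mult[OF y degree_star[OF y]] by (simp add: h_def)
  define \<kappa> where "\<kappa> = replicate i (1::nat)"
  have \<kappa>: "\<kappa> \<in> cuntz_words n" using n2 by (auto simp: \<kappa>_def cuntz_words_def)
  \<comment> \<open>\<open>y\<close> may lie outside \<open>B\<close>. Multiplied by
    \<open>star (s \<kappa>)\<close> it has degree 0, which shows that \<open>y * star y\<close> is
    positive in \<open>B\<close>.\<close>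
  define f0 where "f0 = y * star (s \<kappa>)"
  have "f0 \<in> degree (int i + - int i)"
    unfolding f0_def using degree_word[OF \<kappa>] by (intro degree_mult y degree_star) (simp add: \<kappa>_def)
  then have "star f0 \<in> B" using degree_star[of f0 0] degree_0_subset by auto
  moreover have "h = star (star f0) * star f0"
  proof -
    have "star (star f0) * star f0 = y * (star (s \<kappa>) * s \<kappa>) * star y"
      by (simp add: f0_def star_mult star_star mult.assoc)
    then show ?thesis by (simp add: word_isometry[OF \<kappa>] h_def)
  qed
  ultimately have hpos: "positive_in B h" unfolding positive_in_def by blast
  have "norm h \<noteq> 0" using \<open>y \<noteq> 0\<close> by (simp add: h_def norm_mult_star)
  then have "h \<noteq> 0" by auto
  then obtain \<delta> where \<delta>: "\<delta> > 0"
    "\<And>L f e. f \<in> matrix_units L L \<Longrightarrow> norm (h - f) \<le> e \<Longrightarrow>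
       \<exists>\<alpha>\<in>words_of_length L. \<exists>c. star (s \<alpha>) * f * s \<alpha> = scaleC c 1 \<and> \<delta> - e \<le> cmod c"
    using diagonal_entry_lower_bound[OF h0 hpos] by metis
  \<comment> \<open>Chosen so that the accumulated error \<open>e * (4 * norm y + 3)\<close> stays
    strictly below \<open>\<delta>\<close>; moreover \<open>e \<le> 1\<close> bounds
    \<open>norm f\<close> by \<open>norm y + 1\<close> and \<open>e\<^sup>2\<close> by
    \<open>e\<close>.\<close>
  define e where "e = min 1 (\<delta> / (4 * norm y + 4))"
  have ny: "4 * norm y + 4 > 0" by (smt (verit) norm_ge_zero)
  have e: "e > 0" "e \<le> 1" using \<delta>(1) ny by (simp_all add: e_def)
  have "e \<le> \<delta> / (4 * norm y + 4)" by (simp add: e_def)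
  then have e\<delta>: "e * (4 * norm y + 4) \<le> \<delta>" using ny by (simp add: pos_le_divide_eq)
  obtain L f where f: "f \<in> matrix_units (L + i) L" "norm (y - f) < e"
    using approximate_degree[OF y e(1)] by blast
  define h' where "h' = f * star f"
  have h': "h' \<in> matrix_units (L + i) (L + i)"
    unfolding h'_def by (rule matrix_units_mult[OF f(1) matrix_units_star[OF f(1)]])
  have hh': "norm (h - h') \<le> e * (2 * norm y + 1)"
  proof -
    have "h - h' = (y - f) * star y + f * star (y - f)"
      by (simp add: h_def h'_def star_diff algebra_simps)
    then have "norm (h - h') \<le> norm (y - f) * norm y + norm f * norm (y - f)"
      by (metis norm_triangle_mono norm_mult_ineq norm_star)
    also have "norm f \<le> norm y + 1"
      using f(2) e(2) norm_triangle_ineq2[of f y] by (simp add: norm_minus_commute)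
    then have "norm (y - f) * norm y + norm f * norm (y - f) \<le> e * norm y + (norm y + 1) * e"
      using f(2) e(1) by (intro add_mono mult_mono) auto
    finally show ?thesis by (simp add: algebra_simps)
  qed
  obtain \<alpha> c where \<alpha>: "\<alpha> \<in> words_of_length (L + i)" "star (s \<alpha>) * h' * s \<alpha> = scaleC c 1"
    and c: "\<delta> - e * (2 * norm y + 1) \<le> cmod c"
    using \<delta>(2)[OF h' hh'] by blast
  obtain \<alpha>1 \<alpha>2 where split: "\<alpha> = \<alpha>1 @ \<alpha>2" "\<alpha>1 \<in> words_of_length L" "\<alpha>2 \<in> words_of_length i"
    using split_words[OF \<alpha>(1)] by metis
  define \<beta> where "\<beta> = \<kappa> @ [2]"
  have \<beta>: "\<beta> \<in> words_of_length (i + 1)" using n2 by (auto simp: \<beta>_def \<kappa>_def words_of_length_def)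
  define G where "G = s \<alpha> * s \<beta>"
  have G: "star G * G = 1" "G * star G \<in> D"
  proof -
    have w: "\<alpha> @ \<beta> \<in> cuntz_words n" using append_words[OF \<alpha>(1) \<beta>] words_lengthD by blast
    show "star G * G = 1" using word_isometry[OF w] by (simp add: G_def word_prod_append)
    show "G * star G \<in> D" using projection_in_D[OF w] by (simp add: G_def word_prod_append)
  qed
  have nG: "norm G = 1" by (rule norm_unitary[OF G(1)])
  have nsand: "norm (star G * x * G) \<le> norm x" for x
    using norm_mult_ineq[of "star G * x" G] norm_mult_ineq[of "star G" x] nG by simp
  \<comment> \<open>The entry of \<open>f\<close> at \<open>\<alpha>\<close>,
    \<open>\<alpha>1\<close> is a scalar, so \<open>star (s \<beta>)\<close> meets the word
    \<open>\<alpha>2 @ \<beta>\<close>. Its first \<open>i + 1\<close> letters are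
    \<open>\<alpha>2 @ [1]\<close>, whereas \<open>\<beta>\<close> ends in 2.\<close>
  have GfG: "star G * f * G = 0"
  proof -
    obtain d where d: "star (s \<alpha>) * f * s \<alpha>1 = scaleC d 1"
      using f(1) \<alpha>(1) split(2) unfolding matrix_units_def by blast
    define \<beta>' where "\<beta>' = replicate (i - 1) 1 @ [2::nat]"
    have "\<beta> = [1] @ \<beta>'" using i by (cases i) (simp_all add: \<beta>_def \<beta>'_def \<kappa>_def)
    then have "s \<alpha>2 * s \<beta> = s (\<alpha>2 @ [1]) * s \<beta>'" by (simp only: word_prod_append mult.assoc)
    moreover have "star (s \<beta>) * s (\<alpha>2 @ [1]) = 0"
    proof -
      have "\<alpha>2 @ [1] \<in> words_of_length (i + 1)" using split(3) n2 by (auto simp: words_of_length_def)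
      moreover have "\<beta> \<noteq> \<alpha>2 @ [1]" by (simp add: \<beta>_def)
      ultimately show ?thesis using words_orthogonal[OF \<beta>] by simp
    qed
    ultimately have "star (s \<beta>) * (s \<alpha>2 * s \<beta>) = 0" by (simp add: mult.assoc[symmetric])
    moreover have "star G * f * G = star (s \<beta>) * (star (s \<alpha>) * f * s \<alpha>1) * (s \<alpha>2 * s \<beta>)"
      by (simp add: G_def split(1) word_prod_append star_mult mult.assoc)
    ultimately show ?thesis by (simp add: d mult_scaleC_1 scaleC_mult_left)
  qed
  have "star G * y * G = star G * (y - f) * G" using GfG by (simp add: algebra_simps)
  then have yG: "norm (star G * y * G) \<le> e" using nsand[of "y - f"] f(2) by simp
  \<comment> \<open>\<open>G * star G\<close> lies in \<open>D\<close>, so it can be inserted on the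
    left and moved past \<open>y\<close>; the compression of \<open>h\<close> becomes the product of
    the small compression of \<open>y\<close> and its adjoint.\<close>
  have "star G * h * G = star G * (G * star G * y) * star y * G"
    using G(1) by (simp add: h_def mult.assoc[symmetric])
  also have "\<dots> = (star G * y * G) * star (star G * y * G)"
    unfolding comm[OF G(2)] by (simp add: star_mult star_star mult.assoc)
  finally have "norm (star G * h * G) = (norm (star G * y * G))\<^sup>2" by (simp add: norm_mult_star)
  also have "\<dots> \<le> e\<^sup>2" using yG by (intro power_mono) auto
  also have "\<dots> \<le> e" using e by (simp add: power2_eq_square mult_left_le_one_le)
  finally have hG: "norm (star G * h * G) \<le> e" .
  have "star G * h' * G = star (s \<beta>) * (star (s \<alpha>) * h' * s \<alpha>) * s \<beta>"
    by (simp add: G_def star_mult mult.assoc)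
  also have "\<dots> = scaleC c 1"
    using words_orthogonal[OF \<beta> \<beta>] by (simp add: \<alpha>(2) mult_scaleC_1 scaleC_mult_left)
  finally have "cmod c = norm (star G * h' * G)" by (simp add: norm_scaleC)
  also have "star G * h' * G = star G * h * G - star G * (h - h') * G" by (simp add: algebra_simps)
  also have "norm \<dots> \<le> e + e * (2 * norm y + 1)"
    using norm_triangle_ineq4[of "star G * h * G" "star G * (h - h') * G"] hG nsand[of "h - h'"] hh' by linarith
  finally have "\<delta> \<le> e * (4 * norm y + 3)" using c by (simp add: algebra_simps)
  then show False using e\<delta> e(1) by (simp add: algebra_simps)
qed

lemma zero_if_commutes_with_D:
  assumes j: "j \<noteq> 0" and y: "y \<in> degree j" and comm: "\<And>d. d \<in> D \<Longrightarrow> d * y = y * d"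
  shows "y = 0"
proof (cases "j > 0")
  case True
  then show ?thesis using zero_if_commutes_with_D_pos[of "nat j" y] y comm by simp
next
  case False
  have "d * star y = star y * d" if "d \<in> D" for d
    using comm[OF cstar_subalgebra_star[OF D that]] by (metis star_mult star_star)
  then have "star y = 0"
    using zero_if_commutes_with_D_pos[of "nat (- j)" "star y"] degree_star[OF y] False j by simp
  then show ?thesis by (metis star_0 star_star)
qed

section \<open>Fourier components of normalizers\<close>

text \<open>\<open>q\<close> acts as a spectral projection of \<open>a * a\<close> away from 0 and
  \<open>r\<close> as a local inverse: \<open>a * a\<close> is invertible on \<open>q\<close>, and
  \<open>a\<close> is small off \<open>q\<close>. Both come from a diagonal matrix near
  \<open>a * a\<close>, cut off and inverted entrywise.\<close>

lemma D_local_inverse: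
  assumes a: "a \<in> D" "star a = a" and \<eta>: "\<eta> > 0"
  obtains q r where "r \<in> D" "q = a * a * r" "star q = q" "norm (1 - q) \<le> 1" "norm (a * (1 - q)) \<le> \<eta>"
proof -
  \<comment> \<open>With cutoff \<open>2 * e\<close>, the part of \<open>a * a\<close> off
    \<open>q\<close> has norm at most \<open>e + 2 * e = \<eta>\<^sup>2\<close>, and
    \<open>norm h \<le> 1 / (2 * e)\<close> keeps \<open>norm (1 - t)\<close> at most 1/2.\<close>
  define e where "e = \<eta>\<^sup>2 / 3"
  have e: "e > 0" using \<eta> by (simp add: e_def)
  define b where "b = a * a"
  have b: "b \<in> D" using cstar_subalgebra_mult[OF D a(1) a(1)] by (simp add: b_def)
  obtain L c where c: "norm (b - diagonal L c) < e" using approximate_D[OF b e] by blast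
  define h where "h = diagonal L (\<lambda>\<mu>. if cmod (c \<mu>) > 2 * e then inverse (c \<mu>) else 0)"
  define q where "q = diagonal L (\<lambda>\<mu>. if cmod (c \<mu>) > 2 * e then 1 else 0)"
  have hD: "h \<in> D" and qD: "q \<in> D" by (simp_all add: h_def q_def diagonal_in_D)
  have ch: "diagonal L c * h = q"
    unfolding h_def q_def diagonal_mult by (rule diagonal_cong) (use e in \<open>auto intro!: right_inverse\<close>)
  have hq: "h * q = h"
    unfolding h_def q_def diagonal_mult by (rule diagonal_cong) auto
  have qq: "q * q = q"
    unfolding q_def diagonal_mult by (rule diagonal_cong) auto
  have sq: "star q = q"
    unfolding q_def diagonal_star by (rule diagonal_cong) auto
  have q1: "1 - q = diagonal L (\<lambda>\<mu>. if cmod (c \<mu>) > 2 * e then 0 else 1)"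
    unfolding q_def diagonal_one[of L, symmetric] diagonal_diff by (rule diagonal_cong) auto
  have nq1: "norm (1 - q) \<le> 1" unfolding q1 by (rule norm_diagonal_le) auto
  have "cmod (inverse z) \<le> 1 / (2 * e)" if "cmod z > 2 * e" for z
  proof -
    have "1 / cmod z \<le> 1 / (2 * e)" by (rule frac_le) (use that e in auto)
    then show ?thesis by (simp add: norm_divide inverse_eq_divide)
  qed
  then have nh: "norm h \<le> 1 / (2 * e)"
    unfolding h_def using e by (intro norm_diagonal_le) auto
  have ncq: "norm (diagonal L c * (1 - q)) \<le> 2 * e"
    unfolding q1 diagonal_mult using e by (intro norm_diagonal_le) auto
  have "b * (1 - q) = (b - diagonal L c) * (1 - q) + diagonal L c * (1 - q)" by (simp add: algebra_simps)
  moreover have "norm ((b - diagonal L c) * (1 - q)) \<le> e * 1"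
    by (rule order_trans[OF norm_mult_ineq mult_mono]) (use c nq1 e in auto)
  ultimately have nbq: "norm (b * (1 - q)) \<le> \<eta>\<^sup>2"
    using ncq norm_triangle_ineq[of "(b - diagonal L c) * (1 - q)" "diagonal L c * (1 - q)"]
    by (simp add: e_def)
  \<comment> \<open>\<open>b * h\<close> is only close to \<open>q\<close>; adding
    \<open>1 - q\<close> makes it invertible, and multiplying \<open>t * q = b * h\<close> by the
    inverse \<open>u\<close> of \<open>t\<close> corrects the error.\<close>
  define t where "t = b * h + (1 - q)"
  have "1 - t = (diagonal L c - b) * h" by (simp add: t_def ch[symmetric] algebra_simps)
  then have "norm (1 - t) \<le> norm (diagonal L c - b) * norm h" by (simp add: norm_mult_ineq)
  also have "\<dots> \<le> e * (1 / (2 * e))"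
    by (rule mult_mono) (use c nh e in \<open>auto simp: norm_minus_commute\<close>)
  also have "\<dots> < 1" using e by simp
  finally have "norm (1 - t) < 1" .
  then obtain u where u: "u \<in> D" "u * t = 1"
  proof (rule left_inverse_near_one)
    have "1 - t \<in> D"
      unfolding t_def using b hD qD one_in_D
      by (intro cstar_subalgebra_diff[OF D] cstar_subalgebra_add[OF D] cstar_subalgebra_mult[OF D])
    then show "x * (1 - t) \<in> D" if "x \<in> D" for x using cstar_subalgebra_mult[OF D that] by blast
  qed (use D one_in_D in \<open>auto simp: cstar_subalgebra_closed cstar_subalgebra_add\<close>)
  have "t * q = b * h" by (simp add: t_def algebra_simps qq hq mult.assoc)
  then have "q = u * (b * h)" using u(2) by (metis mult.assoc mult.left_neutral)
  also have "\<dots> = b * (h * u)"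
    using D_commute[OF u(1) cstar_subalgebra_mult[OF D b hD]] by (simp add: mult.assoc)
  finally have qb: "q = a * a * (h * u)" by (simp add: b_def mult.assoc)
  have "(norm (a * (1 - q)))\<^sup>2 = norm (star (a * (1 - q)) * (a * (1 - q)))" by (simp add: cstar_identity)
  also have "star (a * (1 - q)) * (a * (1 - q)) = (1 - q) * (b * (1 - q))"
    by (simp add: star_mult star_diff a sq b_def mult.assoc)
  also have "norm \<dots> \<le> 1 * \<eta>\<^sup>2"
    by (rule order_trans[OF norm_mult_ineq mult_mono]) (use nq1 nbq in auto)
  finally have "(norm (a * (1 - q)))\<^sup>2 \<le> \<eta>\<^sup>2" by (simp only: mult_1_left)
  then have "norm (a * (1 - q)) \<le> \<eta>" by (rule power2_le_imp_le) (use \<eta> in simp)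
  then show ?thesis using that[OF cstar_subalgebra_mult[OF D hD u(1)] qb sq nq1] by blast
qed

text \<open>A relation \<open>d1 * v = v * d2\<close> over \<open>D\<close> passes to the component
  \<open>x\<close>, because \<open>D\<close> has degree 0. From
  \<open>v * (d * a) = (v * d * star v) * v\<close> it follows that
  \<open>u = star v * x * a\<close> commutes with \<open>D\<close>; so \<open>u\<close> has degree 0
  and lies in \<open>B\<close>, and \<open>v * u = x * a * a\<close>. It remains to divide by
  \<open>a * a\<close>.\<close>

lemma spectral_normalizer_in_B:
  assumes v: "v \<in> normalizers D B"
  shows "spectral 0 k v \<in> B"
proof -
  have vB: "v \<in> B" and vd: "\<And>d. d \<in> D \<Longrightarrow> v * d * star v \<in> D" "\<And>d. d \<in> D \<Longrightarrow> star v * d * v \<in> D"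
    using v by (auto simp: normalizers_def)
  have D0: "d \<in> degree 0" if "d \<in> D" for d using that D_degree_0 by blast
  define x where "x = spectral 0 k v"
  define a where "a = star v * v"
  have a: "a \<in> D" "star a = a" using vd(2)[OF one_in_D] by (simp_all add: a_def star_mult star_star)
  have left: "spectral 0 k (d * v) = d * x" and right: "spectral 0 k (v * d) = x * d" if "d \<in> D" for d
    using spectral_mult_left[OF D0[OF that], of 0 k v] spectral_mult_right[OF D0[OF that], of 0 k v]
    by (simp_all add: x_def)
  define w where "w = star v * x"
  have swap: "w * (d * a) = a * d * w" if d: "d \<in> D" for d
  proof -
    have "v * (d * a) = (v * d * star v) * v" by (simp add: a_def mult.assoc)
    then have "x * (d * a) = (v * d * star v) * x"
      using left[OF vd(1)[OF d]] right[OF cstar_subalgebra_mult[OF D d a(1)]] by metis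
    then show ?thesis by (simp add: w_def a_def mult.assoc)
  qed
  define u where "u = w * a"
  have aw: "u = a * w" using swap[OF one_in_D] by (simp add: u_def)
  have comm: "d * u = u * d" if d: "d \<in> D" for d
  proof -
    have "u * d = w * (d * a)" using D_commute[OF a(1) d] by (simp add: u_def mult.assoc)
    also have "\<dots> = d * u" using swap[OF d] D_commute[OF a(1) d] by (simp add: aw mult.assoc[symmetric])
    finally show ?thesis by simp
  qed
  have "spectral 0 j u = 0" if "j \<noteq> 0" for j
  proof (rule zero_if_commutes_with_D[OF that spectral_in_degree])
    fix d assume d: "d \<in> D"
    show "d * spectral 0 j u = spectral 0 j u * d"
      using spectral_mult_left[OF D0[OF d], of 0 j u] spectral_mult_right[OF D0[OF d], of 0 j u] comm[OF d] by simp
  qed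
  then have "spectral 0 0 u = u" by (simp add: spectral_fixed_iff)
  then have uB: "u \<in> B" using spectral_in_degree[of 0 u] degree_0_subset by auto
  \<comment> \<open>Since \<open>v * star v\<close> lies in \<open>D\<close>,
    \<open>(v * star v) * x\<close> is the component of \<open>(v * star v) * v = v * a\<close>,
    which is \<open>x * a\<close>.\<close>
  have "v * u = (v * star v) * x * a" by (simp add: u_def w_def mult.assoc)
  also have "(v * star v) * x = spectral 0 k ((v * star v) * v)"
    using left[of "v * star v"] vd(1)[OF one_in_D] by simp
  also have "\<dots> = x * a" using right[OF a(1)] by (simp add: a_def mult.assoc)
  finally have xaa: "x * a * a \<in> B" using cstar_subalgebra_mult[OF B vB uB] by simp
  have "x \<in> closure B"
    unfolding closure_approachable
  proof (intro allI impI)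
    fix e :: real assume e: "e > 0"
    \<comment> \<open>As \<open>a = star v * v\<close>, \<open>(norm (v * (1 - q)))\<^sup>2\<close>
      is at most \<open>norm (a * (1 - q)) \<le> \<eta>\<close>; the square makes the final error
      \<open>e / 2\<close>.\<close>
    define \<eta> where "\<eta> = (e / 2)\<^sup>2"
    have \<eta>: "\<eta> > 0" using e by (simp add: \<eta>_def)
    obtain q r where qr: "r \<in> D" "q = a * a * r" "star q = q" "norm (1 - q) \<le> 1" "norm (a * (1 - q)) \<le> \<eta>"
      by (rule D_local_inverse[OF a \<eta>]) (rule that)
    have qD: "q \<in> D" unfolding qr(2) by (intro cstar_subalgebra_mult[OF D] a qr)
    have "x * q = x * a * a * r" by (simp add: qr(2) mult.assoc)
    then have xq: "x * q \<in> B" using cstar_subalgebra_mult[OF B xaa] qr(1) D_subset by auto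
    have "(norm (v * (1 - q)))\<^sup>2 = norm (star (v * (1 - q)) * (v * (1 - q)))" by (simp add: cstar_identity)
    also have "star (v * (1 - q)) * (v * (1 - q)) = (1 - q) * (a * (1 - q))"
      by (simp add: star_mult star_diff qr(3) a_def mult.assoc)
    also have "norm \<dots> \<le> 1 * \<eta>"
      by (rule order_trans[OF norm_mult_ineq mult_mono]) (use qr in auto)
    finally have "(norm (v * (1 - q)))\<^sup>2 \<le> (e / 2)\<^sup>2" by (simp only: \<eta>_def mult_1_left)
    then have "norm (v * (1 - q)) \<le> e / 2" by (rule power2_le_imp_le) (use e in simp)
    moreover have "x - x * q = spectral 0 k (v * (1 - q))"
      using right[OF qD] by (simp add: algebra_simps spectral_diff x_def)
    ultimately have "norm (x - x * q) \<le> e / 2" using norm_spectral order_trans by metis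
    then show "\<exists>y\<in>B. dist y x < e" using xq e by (intro bexI[of _ "x * q"]) (auto simp: dist_norm norm_minus_commute)
  qed
  then show ?thesis using cstar_subalgebra_closed[OF B] by (simp add: x_def)
qed

text \<open>\<open>degree 0\<close> is simple, so \<open>degree k\<close> is irreducible as a bimodule over it.\<close>

lemma degree_subset_B:
  assumes x: "x \<in> B" "x \<in> degree k" "x \<noteq> 0"
  shows "degree k \<subseteq> B"
proof
  fix y assume y: "y \<in> degree k"
  define h where "h = star x * x"
  have h0: "h \<in> degree 0" using degree_mult[OF degree_star[OF x(2)] x(2)] by (simp add: h_def)
  have "norm h \<noteq> 0" using x(3) by (simp add: h_def cstar_identity)
  then have "h \<noteq> 0" by auto
  moreover have "positive_in B h" unfolding positive_in_def h_def using x(1) by blast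
  ultimately obtain \<delta> where \<delta>: "\<delta> > 0"
    "\<And>L f e. f \<in> matrix_units L L \<Longrightarrow> norm (h - f) \<le> e \<Longrightarrow>
       \<exists>\<alpha>\<in>words_of_length L. \<exists>c. star (s \<alpha>) * f * s \<alpha> = scaleC c 1 \<and> \<delta> - e \<le> cmod c"
    using diagonal_entry_lower_bound[OF h0] by metis
  \<comment> \<open>This leaves an entry \<open>c\<close> of modulus at least
    \<open>2 * \<delta> / 3\<close>, twice the approximation error, so that \<open>h\<close>
    compressed by \<open>\<alpha>\<close> and divided by \<open>c\<close> is within 1/2 of
    1.\<close>
  have "\<delta> / 3 > 0" using \<delta>(1) by simp
  then obtain L f where f: "f \<in> matrix_units L L" "norm (h - f) < \<delta> / 3"
    by (rule approximate_degree_0[OF h0]) (rule that)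
  then obtain \<alpha> c where \<alpha>: "\<alpha> \<in> words_of_length L" and fc: "star (s \<alpha>) * f * s \<alpha> = scaleC c 1"
    and c: "\<delta> - \<delta> / 3 \<le> cmod c"
    using \<delta>(2)[of f L "\<delta> / 3"] by force
  have \<alpha>w: "\<alpha> \<in> cuntz_words n" "length \<alpha> = L" using words_lengthD[OF \<alpha>] by auto
  have c0: "cmod c > 0" using c \<delta>(1) by linarith
  define g where "g = star (s \<alpha>) * h * s \<alpha>"
  have s\<alpha>: "s \<alpha> \<in> degree (int L)" using degree_word[OF \<alpha>w(1)] \<alpha>w(2) by simp
  have g0: "g \<in> degree 0"
    using degree_mult[OF degree_mult[OF degree_star[OF s\<alpha>] h0] s\<alpha>] by (simp add: g_def)
  define t where "t = scaleC (inverse c) g"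
  have "norm (1 - t) < 1"
  proof -
    have "1 - t = scaleC (inverse c) (star (s \<alpha>) * (f - h) * s \<alpha>)"
      using c0 fc[unfolded mult.assoc] by (simp add: t_def g_def algebra_simps scaleC_diff_right scaleC_scaleC)
    then have "norm (1 - t) = inverse (cmod c) * norm (star (s \<alpha>) * (f - h) * s \<alpha>)"
      by (simp add: norm_scaleC norm_inverse)
    also have "norm (star (s \<alpha>) * (f - h) * s \<alpha>) \<le> norm (f - h)"
      using norm_mult_ineq[of "star (s \<alpha>) * (f - h)" "s \<alpha>"] norm_mult_ineq[of "star (s \<alpha>)" "f - h"] \<alpha>w(1) by simp
    then have "inverse (cmod c) * norm (star (s \<alpha>) * (f - h) * s \<alpha>) \<le> inverse (cmod c) * (\<delta> / 3)"
      using f(2) c0 by (intro mult_left_mono) (auto simp: norm_minus_commute)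
    also have "\<dots> < 1" using c c0 \<delta>(1) by (simp add: field_simps)
    finally show ?thesis .
  qed
  then obtain u where u: "u \<in> degree 0" "u * t = 1"
  proof (rule left_inverse_near_one)
    show "z * (1 - t) \<in> degree 0" if "z \<in> degree 0" for z
      using degree_mult[OF that degree_diff[OF degree_one degree_scaleC[OF g0]]] by (simp add: t_def)
  qed (use closed_degree degree_one degree_add in auto)
  have "y * s \<mu> * star (s \<mu>) \<in> B" if \<mu>: "\<mu> \<in> words_of_length L" for \<mu>
  proof -
    have s\<mu>: "s \<mu> \<in> degree (int L)" using degree_word words_lengthD[OF \<mu>] by auto
    \<comment> \<open>\<open>l\<close> and \<open>r\<close> have degree 0, hence lie in
      \<open>B\<close>. In \<open>l * x * r\<close> the factor \<open>x\<close> is completed to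
      \<open>star x * x\<close>, compressed by \<open>\<alpha>\<close> and inverted by
      \<open>u\<close>, which leaves \<open>y * s \<mu> * star (s \<mu>)\<close>.\<close>
    define l where "l = y * s \<mu> * u * scaleC (inverse c) (star (s \<alpha>) * star x)"
    define r where "r = s \<alpha> * star (s \<mu>)"
    have "l \<in> degree (k + int L + 0 + (- int L + - k))"
      unfolding l_def by (intro degree_mult degree_scaleC degree_star y s\<mu> u s\<alpha> x)
    moreover have "r \<in> degree (int L + - int L)"
      unfolding r_def by (intro degree_mult degree_star s\<mu> s\<alpha>)
    ultimately have "l \<in> B" "r \<in> B" using degree_0_subset by auto
    then have "l * x * r \<in> B" using x(1) cstar_subalgebra_mult[OF B] by blast
    moreover have "l * x * r = y * s \<mu> * (u * t) * star (s \<mu>)"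
      by (simp add: l_def r_def t_def g_def h_def scaleC_mult_left scaleC_mult_right mult.assoc)
    ultimately show ?thesis by (simp add: u(2))
  qed
  then show "y \<in> B"
    using expand_right[of y L] cstar_subalgebra_sum[OF B, of "words_of_length L" "\<lambda>\<mu>. y * s \<mu> * star (s \<mu>)"] by simp
qed

end

section \<open>The degrees contained in the intermediate algebra\<close>

lemma subgroup_int_eq_multiples:
  fixes K :: "int set"
  assumes zero: "0 \<in> K" and add: "\<And>j k. j \<in> K \<Longrightarrow> k \<in> K \<Longrightarrow> j + k \<in> K" and neg: "\<And>k. k \<in> K \<Longrightarrow> - k \<in> K"
  obtains m :: nat where "K = {k. int m dvd k}"
proof (cases "K = {0}")
  case True
  then show ?thesis using that[of 0] by auto
next
  case False
  have "\<exists>m::nat. m > 0 \<and> int m \<in> K"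
  proof -
    obtain k where k: "k \<in> K" "k \<noteq> 0" using False zero by blast
    then have "int (nat \<bar>k\<bar>) \<in> K" using neg[OF k(1)] by (cases "k > 0") auto
    then show ?thesis using k(2) by (intro exI[of _ "nat \<bar>k\<bar>"]) auto
  qed
  then obtain m :: nat where m: "m > 0" "int m \<in> K" and least: "\<And>j. j < m \<Longrightarrow> \<not> (j > 0 \<and> int j \<in> K)"
    using exists_least_iff[of "\<lambda>m. m > 0 \<and> int m \<in> K"] by auto
  have mult_nat: "int m * int q \<in> K" for q
  proof (induction q)
    case (Suc q)
    show ?case using add[OF Suc.IH m(2)] by (simp add: algebra_simps)
  qed (simp add: zero)
  have mult: "int m * q \<in> K" for q
  proof (cases "q \<ge> 0")
    case True
    then show ?thesis using mult_nat[of "nat q"] by simp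
  next
    case False
    then show ?thesis using neg[OF mult_nat[of "nat (- q)"]] by simp
  qed
  have "int m dvd k" if k: "k \<in> K" for k
  proof -
    have "k mod int m = k + int m * (- (k div int m))" by (simp add: minus_div_mult_eq_mod[symmetric] mult.commute)
    then have "k mod int m \<in> K" using add[OF k mult] by metis
    moreover have "nat (k mod int m) < m" using m(1) by (simp add: nat_less_iff)
    ultimately have "k mod int m = 0" using least[of "nat (k mod int m)"] m(1) by (metis less_le_not_le nat_0_le nat_0_iff neq0_conv of_nat_0_less_iff pos_mod_sign order_antisym)
    then show ?thesis by (simp add: dvd_eq_mod_eq_0)
  qed
  moreover have "k \<in> K" if "int m dvd k" for k using that mult by (auto elim: dvdE)
  ultimately show ?thesis using that[of m] by blast
qed

context cartan_intermediate
begin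

text \<open>The components of a normalizer lie in \<open>B\<close>, so by irreducibility they vanish
  in every degree outside \<open>K\<close>; as normalizers generate \<open>B\<close>, the subgroup
  \<open>K\<close> determines \<open>B\<close>.\<close>

lemma B_eq_cuntz_sub: "\<exists>m. B = cuntz_sub n S m"
proof -
  define K where "K = {k. degree k \<subseteq> B}"
  \<comment> \<open>One nonzero product of degree \<open>j + k\<close> in \<open>B\<close> suffices,
    since \<open>degree_subset_B\<close> then puts the whole spectral subspace into
    \<open>B\<close>.\<close>
  have "j + k \<in> K" if j: "j \<in> K" and k: "k \<in> K" for j k
  proof -
    have n1: "n \<ge> 1" using n2 by simp
    obtain x where x: "x \<in> degree k" "x * 1 \<noteq> 0"
      by (rule degree_mult_nonzero[OF n1 one_neq_zero]) (rule that)
    then have x0: "x \<noteq> 0" by simp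
    obtain y where y: "y \<in> degree j" "y * x \<noteq> 0"
      by (rule degree_mult_nonzero[OF n1 x0]) (rule that)
    have "y * x \<in> B" using j k x(1) y(1) cstar_subalgebra_mult[OF B] unfolding K_def by blast
    then show ?thesis using degree_subset_B[OF _ degree_mult[OF y(1) x(1)] y(2)] by (simp add: K_def)
  qed
  moreover have "- k \<in> K" if k: "k \<in> K" for k
  proof -
    have "x \<in> B" if "x \<in> degree (- k)" for x
      using degree_star[OF that] k cstar_subalgebra_star[OF B, of "star x"] by (auto simp: K_def star_star)
    then show ?thesis by (auto simp: K_def)
  qed
  moreover have "0 \<in> K" by (simp add: K_def degree_0_subset)
  ultimately obtain m where m: "K = {k. int m dvd k}" using subgroup_int_eq_multiples[of K] by blast
  have "cuntz_sub n S m \<subseteq> B"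
    unfolding cuntz_sub_def cstar_generated_def
  proof (rule hull_minimal, safe)
    fix \<mu> \<nu> assume w: "\<mu> \<in> cuntz_words n" "\<nu> \<in> cuntz_words n" "int m dvd int (length \<mu>) - int (length \<nu>)"
    then have "int (length \<mu>) - int (length \<nu>) \<in> K" by (simp add: m)
    then show "s \<mu> * star (s \<nu>) \<in> B" using degree_monomial[OF w(1,2)] unfolding K_def by blast
  qed (rule B)
  moreover have "cstar_generated (normalizers D B) \<subseteq> cuntz_sub n S m"
    unfolding cstar_generated_def
  proof (rule hull_minimal)
    show "cstar_subalgebra (cuntz_sub n S m)" unfolding cuntz_sub_def by (rule cstar_subalgebra_cstar_generated)
    show "normalizers D B \<subseteq> cuntz_sub n S m"
    proof
      fix v assume v: "v \<in> normalizers D B"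
      have "spectral 0 k v = 0" if "\<not> int m dvd k" for k
      proof -
        have "\<not> degree k \<subseteq> B" using that m unfolding K_def by blast
        then show ?thesis using degree_subset_B[OF spectral_normalizer_in_B[OF v] spectral_in_degree] by blast
      qed
      then show "v \<in> cuntz_sub n S m" by (simp add: cuntz_sub_eq spectral_fixed_iff)
    qed
  qed
  moreover have "cstar_generated (normalizers D B) = B" using cartan by (simp add: cartan_subalgebra_def)
  ultimately show ?thesis by blast
qed

end

theorem mainTheorem4:
  fixes n :: nat
    and S :: "nat \<Rightarrow> 'a::cstar_algebra_1"
    and \<tau> :: "complex \<Rightarrow> 'a \<Rightarrow> 'a"
    and B :: "'a set"
  assumes "n \<ge> 2"
    and "cuntz_algebra n S"
    and "gauge_action n S \<tau>"
    and "cstar_subalgebra B"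
    and "gauge_fixed \<tau> \<subseteq> B"
    and "cartan_subalgebra (cuntz_diagonal n S) B"
  shows "(\<exists>m::nat. B = cuntz_sub n S m) \<and>
         (\<exists>E. conditional_expectation UNIV B E)"
proof -
  have "cuntz_relations n S" "cstar_generated (S ` {1..n}) = UNIV"
    using assms(2) by (simp_all add: cuntz_algebra_def)
  then interpret cartan_intermediate n S \<tau> B
    using assms by unfold_locales
  obtain m where "B = cuntz_sub n S m" using B_eq_cuntz_sub by blast
  then show ?thesis using conditional_expectation_spectral[OF n2, of m] by blast
qed

end
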